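(* Let $q$ be an odd prime power, $d\ge 2$, and let $\phi:\mathbb{F}_q^d\times\mathbb{F}_q^d\to\mathbb{F}_q$ be any distance type function. Let $n,t\in\mathbb{N}$ and let $A\subseteq\mathbb{F}_q^d$ satisfy $$|A|\ \ge\ 12\,n^2\,q^{\frac{d-1}{2}+t}.$$ Then for every distance graph $\mathcal{G}$ with $n$ vertices and maximum vertex degree $t$, the set $A$ contains an isometric copy of $\mathcal{G}$ with respect to $\phi$.
   Context: A distance type function is a function $\phi:\mathbb{F}_q^d\times\mathbb{F}_q^d\to\mathbb{F}_q$ that is either a non-degenerate bilinear form, or of the form $\phi(x,y)=Q(x-y)$ for a non-degenerate quadratic form $Q$ on $\mathbb{F}_q^d$. A distance graph is a finite simple graph $\mathcal{G}=(V,E)$ together with a nonzero length $\lambda_e\in\mathbb{F}_q^*$ attached to each edge $e\in E$. Its vertices are labeled $V=\{v_1,\dots,v_n\}$, and the edge joining $v_i$ and $v_j$ is denoted $e_{i,j}$. A set $X\subseteq\mathbb{F}_q^d$ is an isometric copy of $\mathcal{G}$ with respect to $\phi$ if there is a bijection $\iota:V\to X$ such that $\phi(\iota(v_i),\iota(v_j))=\lambda_{e_{i,j}}$ for all $i<j$ with $v_i,v_j$ adjacent. (When $\phi$ is symmetric the order of the two arguments is irrelevant.) "A contains an isometric copy" means some such $X$ is a subset of $A$. *)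

theory Defs
  imports "HOL-Analysis.Finite_Cartesian_Product" "HOL-Analysis.Cartesian_Space"
begin

text \<open>
  The field with \<open>q\<close> elements is a type \<open>'a\<close> of sort \<open>{field, finite}\<close> with \<open>q = CARD('a)\<close>,
  and its \<open>d\<close>-dimensional coordinate space is \<open>'a ^ 'd\<close> with \<open>d = CARD('d)\<close>.
\<close>

definition bilinear_form :: "('a::field ^ 'd \<Rightarrow> 'a ^ 'd \<Rightarrow> 'a) \<Rightarrow> bool" where
  "bilinear_form B \<longleftrightarrow>
     (\<forall>x. Vector_Spaces.linear (*s) (*) (\<lambda>y. B x y)) \<and>
     (\<forall>y. Vector_Spaces.linear (*s) (*) (\<lambda>x. B x y))"

definition nondegenerate_bilinear_form :: "('a::field ^ 'd \<Rightarrow> 'a ^ 'd \<Rightarrow> 'a) \<Rightarrow> bool" where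
  "nondegenerate_bilinear_form B \<longleftrightarrow> bilinear_form B \<and>
     (\<forall>x. (\<forall>y. B x y = 0) \<longrightarrow> x = 0) \<and>
     (\<forall>y. (\<forall>x. B x y = 0) \<longrightarrow> y = 0)"

definition polar_form :: "('a::field ^ 'd \<Rightarrow> 'a) \<Rightarrow> 'a ^ 'd \<Rightarrow> 'a ^ 'd \<Rightarrow> 'a" where
  "polar_form Q x y = Q (x + y) - Q x - Q y"

definition quadratic_form :: "('a::field ^ 'd \<Rightarrow> 'a) \<Rightarrow> bool" where
  "quadratic_form Q \<longleftrightarrow> (\<forall>c x. Q (c *s x) = c\<^sup>2 * Q x) \<and> bilinear_form (polar_form Q)"

text \<open>
  The following notion of non-degeneracy is the usual one in odd characteristic, where the
  polar form is twice the symmetric bilinear form attached to \<open>Q\<close>.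
\<close>

definition nondegenerate_quadratic_form :: "('a::field ^ 'd \<Rightarrow> 'a) \<Rightarrow> bool" where
  "nondegenerate_quadratic_form Q \<longleftrightarrow>
     quadratic_form Q \<and> nondegenerate_bilinear_form (polar_form Q)"

definition distance_type_function :: "('a::field ^ 'd \<Rightarrow> 'a ^ 'd \<Rightarrow> 'a) \<Rightarrow> bool" where
  "distance_type_function \<phi> \<longleftrightarrow> nondegenerate_bilinear_form \<phi> \<or>
     (\<exists>Q. nondegenerate_quadratic_form Q \<and> \<phi> = (\<lambda>x y. Q (x - y)))"

text \<open>
  Edges are two-element sets of vertices; \<open>v\<close> is the labelling \<open>v\<^sub>1, \<dots>, v\<^sub>n\<close> of the vertices, which
  matters because a bilinear form need not be symmetric. Lengths off the edge set are irrelevant.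
\<close>

locale distance_graph =
  fixes n :: nat and V :: "'v set" and v :: "nat \<Rightarrow> 'v"
    and E :: "'v set set" and len :: "'v set \<Rightarrow> 'a::field"
  assumes labelling: "bij_betw v {1..n} V"
    and edges: "\<And>e. e \<in> E \<Longrightarrow> e \<subseteq> V \<and> card e = 2"
    and length_nonzero: "\<And>e. e \<in> E \<Longrightarrow> len e \<noteq> 0"

definition vertex_degree :: "'v set set \<Rightarrow> 'v \<Rightarrow> nat" where
  "vertex_degree E x = card {e \<in> E. x \<in> e}"

text \<open>Inserting \<open>0\<close> only serves to give the graph without vertices maximum degree \<open>0\<close>.\<close>

definition max_degree :: "'v set \<Rightarrow> 'v set set \<Rightarrow> nat" where
  "max_degree V E = Max (insert 0 (vertex_degree E ` V))"

definition isometric_copy ::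
  "('a::field ^ 'd \<Rightarrow> 'a ^ 'd \<Rightarrow> 'a) \<Rightarrow> nat \<Rightarrow> 'v set \<Rightarrow> (nat \<Rightarrow> 'v) \<Rightarrow> 'v set set \<Rightarrow> ('v set \<Rightarrow> 'a)
    \<Rightarrow> ('a ^ 'd) set \<Rightarrow> bool" where
  "isometric_copy \<phi> n V v E len X \<longleftrightarrow>
     (\<exists>\<iota>. bij_betw \<iota> V X \<and>
       (\<forall>i\<in>{1..n}. \<forall>j\<in>{1..n}. i < j \<and> {v i, v j} \<in> E \<longrightarrow>
          \<phi> (\<iota> (v i)) (\<iota> (v j)) = len {v i, v j}))"

end

theory Submission
  imports Defs "HOL-Algebra.Algebraic_Closure_Type" "HOL-Algebra.Sylow"
    "HOL-Analysis.Complex_Transcendental" "HOL-Number_Theory.Cong"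
begin

text \<open>
  The vertices are embedded greedily in the order of their labels, keeping for every remaining
  vertex a large set of candidates. What makes this work is a second moment bound: for
  \<open>\<lambda> \<noteq> 0\<close> the numbers \<open>N(y) = |{x \<in> S. \<phi>(y,x) = \<lambda>}|\<close> satisfy
  \<open>\<Sum>\<^sub>y (N(y) - |S|/q)\<^sup>2 \<le> 16 q\<^bsup>d-1\<^esup> |S|\<close>. For a bilinear form this is Plancherel's identity.
  For \<open>\<phi>(x,y) = Q(x - y)\<close> the Fourier transform of the sphere \<open>Q = \<lambda>\<close> is a combination of a
  Kloosterman and a Salie sum. Salie sums have an explicit evaluation.

  For Kloosterman sums, let \<open>K\<^sub>n\<close> be the sum over the field with \<open>q\<^sup>n\<close> elements. Counting pairs with
  given sum and product gives \<open>K\<^sub>2\<^sub>n = 2 q\<^sup>n - K\<^sub>n\<^sup>2\<close>. So if \<open>|K\<^sub>1| > 2 \<surd>q\<close>, then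
  \<open>|K\<^sub>n| / \<surd>q\<^sup>n\<close> is unbounded along the powers \<open>n\<close> of \<open>2\<close>. But it is bounded, by Stepanov's method
  applied to the curves \<open>z\<^sup>2 = (y\<^sup>q - y + u)\<^sup>2 - 4a\<close>.
\<close>

(* This notation would prevent the use of X as a variable. *)
no_notation Polynomials.var (\<open>X\<index>\<close>)

section \<open>Stepanov's method\<close>

text \<open>The quadratic case needs square-root cancellation in Kloosterman sums; the elementary
  bound of order q^(3/4) would raise the exponent required of \<open>A\<close>. Stepanov's method
  gives only upper bounds on point counts, only with a poor constant, and here only for extensions
  of even degree. None of this does harm. The fibres of the trace partition the field, so upper
  bounds for all of them also control deviations from below. Powers of 2 are even. And after
  division by sqrt(q^n) the doubling formula reads e -> 2 - e^2, which drives every |e| > 2 to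
  infinity, so mere boundedness forces |e| \<le> 2.

  The hypothesis on \<open>A\<close> is a balance. A vertex with k embedded neighbours keeps about
  |A| / q^k candidates, and it needs about n^2 q^((d+1)/2) of them only while a further neighbour is
  missing, that is for k \<le> t - 1. In the constant 12, a factor 2 pays for the accumulated losses
  and a factor 6 for Chebyshev's inequality.\<close>

lemma homogeneous_system:
  fixes L :: "'e \<Rightarrow> 'i \<Rightarrow> 'b::field"
  assumes "finite S" "finite I" "card S < card I"
  shows "\<exists>c. (\<exists>i\<in>I. c i \<noteq> 0) \<and> (\<forall>e\<in>S. (\<Sum>i\<in>I. c i * L e i) = 0)"
  using assms
proof (induction S arbitrary: I L rule: finite_induct)
  case empty
  then obtain i where "i \<in> I" by fastforce
  then show ?case by (intro exI[of _ "\<lambda>_. 1"]) auto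
next
  case (insert e S)
  show ?case
  proof (cases "\<forall>i\<in>I. L e i = 0")
    case True
    from insert.IH[of I L] insert.prems insert.hyps obtain c
      where "(\<exists>i\<in>I. c i \<noteq> 0)" "(\<forall>e\<in>S. (\<Sum>i\<in>I. c i * L e i) = 0)" by auto
    then show ?thesis using True by (intro exI[of _ c]) auto
  next
    case False
    then obtain k where k: "k \<in> I" "L e k \<noteq> 0" by blast
    define J where "J = I - {k}"
    have J: "finite J" "I = insert k J" "k \<notin> J" using insert.prems k by (auto simp: J_def)
    have "card S < card J" using insert J by simp
    \<comment> \<open>Equation \<open>e\<close> is solved for the unknown \<open>k\<close>;
      substituting the solution turns every other equation into one over \<open>J\<close>.\<close>
    from insert.IH[OF \<open>finite J\<close> this, of "\<lambda>e' i. L e' i - L e' k * L e i / L e k"]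
    obtain c where c: "\<exists>i\<in>J. c i \<noteq> 0"
      "\<And>e'. e' \<in> S \<Longrightarrow> (\<Sum>i\<in>J. c i * (L e' i - L e' k * L e i / L e k)) = 0" by blast
    define w where "w = (\<Sum>i\<in>J. c i * L e i)"
    define c' where "c' = c(k := - w / L e k)"
    have sum: "(\<Sum>i\<in>I. c' i * L e' i) = - w / L e k * L e' k + (\<Sum>i\<in>J. c i * L e' i)" for e'
    proof -
      have "(\<Sum>i\<in>J. c' i * L e' i) = (\<Sum>i\<in>J. c i * L e' i)"
        by (rule sum.cong) (use J in \<open>auto simp: c'_def\<close>)
      then show ?thesis using J by (simp add: c'_def)
    qed
    have "(\<Sum>i\<in>I. c' i * L e' i) = 0" if "e' \<in> S" for e'
    proof -
      have "(\<Sum>i\<in>J. c i * (L e' i - L e' k * L e i / L e k)) =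
            (\<Sum>i\<in>J. c i * L e' i) - (\<Sum>i\<in>J. (c i * L e i) * (L e' k / L e k))"
        unfolding sum_subtractf[symmetric] by (rule sum.cong) (auto simp: algebra_simps)
      also have "\<dots> = (\<Sum>i\<in>J. c i * L e' i) - w * (L e' k / L e k)"
        by (simp add: w_def sum_distrib_right sum_divide_distrib)
      finally show ?thesis using c(2)[OF that] by (simp add: sum)
    qed
    moreover have "(\<Sum>i\<in>I. c' i * L e i) = 0" using k by (simp add: sum w_def)
    moreover have "\<exists>i\<in>I. c' i \<noteq> 0" using c(1) J by (auto simp: c'_def)
    ultimately show ?thesis by (intro exI[of _ c']) auto
  qed
qed

text \<open>\<open>scaled_shift f p\<close> is the expansion of \<open>p(X + f(X) T)\<close> in powers of \<open>T\<close>.\<close>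

definition scaled_shift :: "'b::comm_ring_1 poly \<Rightarrow> 'b poly \<Rightarrow> 'b poly poly" where
  "scaled_shift f p = fold_coeffs (\<lambda>a w. [:[:a:]:] + [:[:0, 1:], f:] * w) p 0"

lemma scaled_shift_0 [simp]: "scaled_shift f 0 = 0"
  by (simp add: scaled_shift_def)

lemma scaled_shift_pCons:
  "scaled_shift f (pCons a p) = [:[:a:]:] + [:[:0, 1:], f:] * scaled_shift f p"
  by (cases "p = 0 \<and> a = 0") (auto simp: scaled_shift_def)

definition eval_coeffs :: "'b::comm_ring_1 \<Rightarrow> 'b poly poly \<Rightarrow> 'b poly" where
  "eval_coeffs x w = map_poly (\<lambda>c. poly c x) w"

lemma coeff_eval_coeffs [simp]: "poly.coeff (eval_coeffs x w) i = poly (poly.coeff w i) x"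
  by (simp add: eval_coeffs_def coeff_map_poly)

lemma eval_coeffs_simps [simp]:
  "eval_coeffs x 0 = 0"
  "eval_coeffs x 1 = 1"
  "eval_coeffs x (pCons a w) = pCons (poly a x) (eval_coeffs x w)"
  "eval_coeffs x (w + w') = eval_coeffs x w + eval_coeffs x w'"
  "eval_coeffs x (smult a w) = smult (poly a x) (eval_coeffs x w)"
  by (auto simp: poly_eq_iff coeff_pCons split: nat.splits)

lemma eval_coeffs_mult [simp]: "eval_coeffs x (w * w') = eval_coeffs x w * eval_coeffs x w'"
  by (simp add: poly_eq_iff coeff_mult poly_sum)

lemma eval_coeffs_power [simp]: "eval_coeffs x (w ^ n) = eval_coeffs x w ^ n"
  by (induction n) auto

lemma eval_coeffs_sum: "eval_coeffs x (\<Sum>i\<in>A. w i) = (\<Sum>i\<in>A. eval_coeffs x (w i))"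
  by (induction A rule: infinite_finite_induct) auto

text \<open>Specialising X to \<open>x\<close> leaves the Taylor expansion of \<open>p\<close> at
  \<open>x\<close>, with T stretched by \<open>poly f x\<close>. No derivatives are taken, so no
  factorials have to be inverted in positive characteristic.\<close>

lemma eval_coeffs_scaled_shift:
  "eval_coeffs x (scaled_shift f p) = pcompose p [:x, poly f x:]"
  by (induction p) (auto simp: scaled_shift_pCons pcompose_pCons)

text \<open>Each T brings one \<open>f\<close>, of degree \<open>k + 1\<close>, in place of one X,
  so it may raise the degree by \<open>k\<close>. Giving T this weight makes the bound additive
  under products.\<close>

definition weighted_degree_le :: "nat \<Rightarrow> nat \<Rightarrow> 'b::comm_ring_1 poly poly \<Rightarrow> bool" where
  "weighted_degree_le k D w \<longleftrightarrow> (\<forall>i. degree (poly.coeff w i) \<le> D + i * k)"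

lemma weighted_degree_le_add:
  "weighted_degree_le k D w \<Longrightarrow> weighted_degree_le k D w' \<Longrightarrow> weighted_degree_le k D (w + w')"
  unfolding weighted_degree_le_def by (auto intro: degree_add_le)

lemma weighted_degree_le_mult:
  assumes "weighted_degree_le k D w" "weighted_degree_le k D' w'"
  shows "weighted_degree_le k (D + D') (w * w')"
  unfolding weighted_degree_le_def
proof
  fix n
  have "degree (poly.coeff w i * poly.coeff w' (n - i)) \<le> D + D' + n * k" if "i \<le> n" for i
  proof -
    have "degree (poly.coeff w i * poly.coeff w' (n - i)) \<le> (D + i * k) + (D' + (n - i) * k)"
      using assms unfolding weighted_degree_le_def
      by (meson add_mono degree_mult_le le_trans)
    also have "\<dots> = D + D' + (i + (n - i)) * k" by (simp only: algebra_simps)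
    finally show ?thesis using that by simp
  qed
  then show "degree (poly.coeff (w * w') n) \<le> D + D' + n * k"
    unfolding coeff_mult by (intro degree_sum_le) auto
qed

lemma weighted_degree_le_const: "degree a \<le> D \<Longrightarrow> weighted_degree_le k D [:a:]"
  by (auto simp: weighted_degree_le_def coeff_pCons split: nat.splits)

lemma weighted_degree_le_power:
  "weighted_degree_le k 0 w \<Longrightarrow> weighted_degree_le k 0 (w ^ n)"
  by (induction n) (use weighted_degree_le_mult[of k 0 w 0] in
      \<open>auto simp: weighted_degree_le_const one_pCons\<close>)

lemma weighted_degree_le_scaled_shift:
  assumes "degree f \<le> Suc k"
  shows "weighted_degree_le k (degree p) (scaled_shift f p)"
proof (induction p)
  case 0
  then show ?case by (simp add: weighted_degree_le_def)
next
  case (pCons a p)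
  show ?case
  proof (cases "p = 0")
    case True
    then show ?thesis by (simp add: scaled_shift_pCons weighted_degree_le_const)
  next
    case False
    have "weighted_degree_le k 1 [:[:0, 1:], f:]"
      using assms by (auto simp: weighted_degree_le_def coeff_pCons split: nat.splits)
    from weighted_degree_le_mult[OF this pCons.IH]
    have "weighted_degree_le k (degree (pCons a p)) ([:[:0, 1:], f:] * scaled_shift f p)"
      using False by simp
    then show ?thesis unfolding scaled_shift_pCons
      by (intro weighted_degree_le_add) (auto intro!: weighted_degree_le_const)
  qed
qed

text \<open>Modulo f T the substitution changes nothing, so f(X + f T) is divisible by
  \<open>f\<close>. At a point with \<open>poly f x ^ b = 1\<close> the power \<open>f ^ b\<close>
  then expands as \<open>u ^ b\<close>, whose coefficients have degrees bounded independently of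
  \<open>b\<close>. This keeps the linear system of Stepanov's method small.\<close>

lemma scaled_shift_self_factor:
  fixes f :: "'b::field poly"
  assumes "degree f = Suc k"
  obtains u where "scaled_shift f f = smult f u" "weighted_degree_le k 0 u"
proof -
  have "\<exists>w. scaled_shift f p = [:p:] + [:0, f:] * w" for p
  proof (induction p)
    case 0
    show ?case by (intro exI[of _ 0]) simp
  next
    case (pCons a p)
    then obtain w where w: "scaled_shift f p = [:p:] + [:0, f:] * w" by blast
    have X: "[:[:0, 1:], f:] = [:[:0, 1:]:] + [:0, f:]" by simp
    have "scaled_shift f (pCons a p) = [:[:a:] + [:0, 1:] * p:] + [:0, f:] * ([:[:0, 1:]:] * w + scaled_shift f p)"
      unfolding scaled_shift_pCons X by (simp add: w algebra_simps)
    moreover have "[:a:] + [:0, 1:] * p = pCons a p" by simp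
    ultimately show ?case by metis
  qed
  then obtain w where w: "scaled_shift f f = [:f:] + [:0, f:] * w" by blast
  define u where "u = 1 + [:0, 1:] * w"
  have "scaled_shift f f = smult f u"
    unfolding w u_def by (simp add: poly_eq_iff coeff_pCons split: nat.splits)
  moreover have "weighted_degree_le k 0 u"
    unfolding weighted_degree_le_def
  proof
    fix i
    have "degree (poly.coeff (scaled_shift f f) i) \<le> Suc k + i * k"
      using weighted_degree_le_scaled_shift[of f k f] assms by (auto simp: weighted_degree_le_def)
    \<comment> \<open>Cancelling \<open>f\<close> removes exactly its degree \<open>Suc k\<close>
      from the bound.\<close>
    then show "degree (poly.coeff u i) \<le> 0 + i * k"
      using assms calculation degree_mult_eq[of f "poly.coeff u i"]
      by (cases "poly.coeff u i = 0"; cases "f = 0") auto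
  qed
  ultimately show thesis using that by blast
qed

text \<open>
  The auxiliary polynomial of Stepanov's method is nonzero: otherwise multiplying its lowest block
  \<open>r + s f\<^sup>b\<close> by \<open>(r - s f\<^sup>b) f\<close> would make \<open>r\<^sup>2 f\<close> a constant multiple of \<open>s\<^sup>2\<close>.
\<close>
lemma stepanov_nonzero:
  fixes f :: "'b::field poly" and r s :: "nat \<Rightarrow> 'b poly"
  assumes frob: "\<And>p q :: 'b poly. (p + q) ^ Q = p ^ Q + q ^ Q"
    and Q: "Q = 2 * b + 1" and c: "poly f c \<noteq> 0" and odd: "odd (order \<rho> f)"
    and deg: "\<And>j. j < J \<Longrightarrow> 2 * degree (r j) + degree f < Q"
      "\<And>j. j < J \<Longrightarrow> 2 * degree (s j) < Q"
    and nz: "\<exists>j<J. r j \<noteq> 0 \<or> s j \<noteq> 0"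
  shows "(\<Sum>j<J. (r j + s j * f ^ b) * ([:- c, 1:] ^ Q) ^ j) \<noteq> 0"
proof
  assume zero: "(\<Sum>j<J. (r j + s j * f ^ b) * ([:- c, 1:] ^ Q) ^ j) = 0"
  define Y where "Y = [:- c, 1:] ^ Q"
  define g where "g j = r j + s j * f ^ b" for j
  define P where "P j \<longleftrightarrow> j < J \<and> (r j \<noteq> 0 \<or> s j \<noteq> 0)" for j
  define j0 where "j0 = (LEAST j. P j)"
  have j0: "P j0" unfolding j0_def by (rule LeastI_ex) (use nz in \<open>auto simp: P_def\<close>)
  have g0: "g j = 0" if "j < j0" for j
    using not_less_Least[OF that[unfolded j0_def]] j0 that by (auto simp: P_def g_def)
  have Y0: "Y \<noteq> 0" by (simp add: Y_def)
  have "0 = (\<Sum>j<J. g j * Y ^ j)" using zero by (simp add: g_def Y_def)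
  also have "\<dots> = (\<Sum>j\<in>{j0..<J}. g j * Y ^ j)"
    by (rule sum.mono_neutral_right) (auto simp: g0)
  also have "\<dots> = g j0 * Y ^ j0 + (\<Sum>j\<in>{j0<..<J}. g j * Y ^ j)"
    using j0 by (subst sum.atLeast_Suc_lessThan) (auto simp: P_def atLeastSucLessThan_greaterThanLessThan)
  also have "(\<Sum>j\<in>{j0<..<J}. g j * Y ^ j) = Y ^ j0 * (Y * (\<Sum>j\<in>{j0<..<J}. g j * Y ^ (j - j0 - 1)))"
    unfolding sum_distrib_left
  proof (rule sum.cong)
    fix j assume "j \<in> {j0<..<J}"
    then have "j = j0 + (1 + (j - j0 - 1))" by auto
    then have "Y ^ j = Y ^ j0 * (Y * Y ^ (j - j0 - 1))" by (metis power_add power_one_right)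
    then show "g j * Y ^ j = Y ^ j0 * (Y * (g j * Y ^ (j - j0 - 1)))" by (simp add: algebra_simps)
  qed simp
  finally have "Y ^ j0 * (g j0 + Y * (\<Sum>j\<in>{j0<..<J}. g j * Y ^ (j - j0 - 1))) = 0"
    by (simp add: algebra_simps)
  then have "g j0 + Y * (\<Sum>j\<in>{j0<..<J}. g j * Y ^ (j - j0 - 1)) = 0" using Y0 by simp
  \<comment> \<open>All later blocks carry a further factor \<open>Y\<close>, so \<open>Y\<close>
    divides the lowest block by itself.\<close>
  then have "g j0 = Y * (- (\<Sum>j\<in>{j0<..<J}. g j * Y ^ (j - j0 - 1)))"
    by (simp add: add_eq_0_iff2)
  then have Yg: "Y dvd g j0" by (metis dvdI)
  define R S where "R = r j0" and "S = s j0"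
  have "f ^ Q = f ^ b * f ^ b * f" by (simp add: Q power_add mult_2)
  then have "g j0 * (R - S * f ^ b) * f = R\<^sup>2 * f - S\<^sup>2 * f ^ Q"
    by (simp add: g_def R_def S_def algebra_simps power2_eq_square)
  then have 1: "Y dvd R\<^sup>2 * f - S\<^sup>2 * f ^ Q" using Yg by (metis dvd_mult2)
  \<comment> \<open>Raised to the additive power \<open>Q\<close>, this makes \<open>f ^ Q\<close>
    congruent to the constant \<open>e\<close> modulo \<open>Y\<close>, which removes the only term
    of large degree.\<close>
  obtain h where h: "f = [:- c, 1:] * h + [:poly f c:]"
  proof -
    have "poly (f - [:poly f c:]) c = 0" by simp
    then obtain h where "f - [:poly f c:] = [:- c, 1:] * h" unfolding poly_eq_0_iff_dvd by (auto elim: dvdE)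
    then show ?thesis using that by (metis diff_add_cancel)
  qed
  define e where "e = poly f c ^ Q"
  have "f ^ Q = ([:- c, 1:] * h) ^ Q + [:poly f c:] ^ Q"
    using arg_cong[OF h, of "\<lambda>p. p ^ Q"] by (simp only: frob)
  also have "\<dots> = Y * h ^ Q + [:e:]"
    by (simp only: power_mult_distrib Y_def e_def poly_const_pow)
  finally have fQ: "f ^ Q = Y * h ^ Q + [:e:]" .
  have "R\<^sup>2 * f - smult e (S\<^sup>2) = (R\<^sup>2 * f - S\<^sup>2 * f ^ Q) + Y * (h ^ Q * S\<^sup>2)"
    by (simp add: fQ algebra_simps)
  then have "Y dvd R\<^sup>2 * f - smult e (S\<^sup>2)" using 1 by (metis dvd_add dvd_triv_left)
  moreover have "degree (R\<^sup>2 * f - smult e (S\<^sup>2)) < degree Y"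
  proof -
    have "degree (R\<^sup>2 * f) \<le> 2 * degree R + degree f"
      by (metis degree_mult_le degree_power_le mult.commute le_trans add_le_mono1)
    moreover have "degree (smult e (S\<^sup>2)) \<le> 2 * degree S"
      by (metis degree_power_le degree_smult_le le_trans mult.commute)
    moreover have "degree Y = Q" by (simp add: Y_def degree_linear_power)
    ultimately show ?thesis using deg[of j0] j0
      by (intro degree_diff_less) (auto simp: P_def R_def S_def)
  qed
  ultimately have "R\<^sup>2 * f - smult e (S\<^sup>2) = 0" by (metis dvd_imp_degree_le not_le)
  then have eq: "R\<^sup>2 * f = smult e (S\<^sup>2)" by simp
  have e: "e \<noteq> 0" using c by (simp add: e_def)
  have f0: "f \<noteq> 0" using c by auto
  have RS: "R \<noteq> 0" "S \<noteq> 0"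
    using j0 eq e f0 by (auto simp: P_def R_def S_def)
  \<comment> \<open>Equal polynomials have equal orders at \<open>\<rho>\<close>, but the left side
    has odd order there and the right side even order.\<close>
  have "order \<rho> (R\<^sup>2 * f) = 2 * order \<rho> R + order \<rho> f"
    using RS f0 by (simp add: order_mult power2_eq_square)
  moreover have "order \<rho> (smult e (S\<^sup>2)) = 2 * order \<rho> S"
    using RS e by (simp add: order_mult power2_eq_square order_smult)
  ultimately have "2 * order \<rho> R + order \<rho> f = 2 * order \<rho> S" using eq by metis
  then show False using odd by presburger
qed

section \<open>Vanishing orders and the choice of parameters\<close>

lemma pcompose_power: "pcompose (p ^ n) q = pcompose p q ^ n"
  by (induction n) (auto simp: pcompose_mult pcompose_1)

lemma le_order_if_taylor_coeffs_vanish: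
  fixes P :: "'b::field poly"
  assumes "P \<noteq> 0" "y \<noteq> 0" and "\<And>i. i < l \<Longrightarrow> poly.coeff (pcompose P [:x, y:]) i = 0"
  shows "l \<le> order x P"
proof -
  \<comment> \<open>\<open>z\<close> inverts the substitution x + y T.\<close>
  define z where "z = [:- x / y, 1 / y:]"
  have "monom 1 l dvd pcompose P [:x, y:]" using assms(3) by (simp add: monom_1_dvd_iff')
  then obtain s where s: "pcompose P [:x, y:] = [:0, 1:] ^ l * s"
    by (auto simp: monom_altdef elim: dvdE)
  have "P = pcompose P (pcompose [:x, y:] z)"
    using assms(2) by (simp add: z_def pcompose_pCons)
  also have "\<dots> = z ^ l * pcompose s z"
    by (simp add: pcompose_assoc s pcompose_mult pcompose_power) (simp add: pcompose_pCons)
  also have "z = smult (1 / y) [:- x, 1:]" by (simp add: z_def)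
  finally have "P = [:- x, 1:] ^ l * smult ((1 / y) ^ l) (pcompose s (smult (1 / y) [:- x, 1:]))"
    by (simp only: smult_power mult_smult_left mult_smult_right)
  then have "[:- x, 1:] ^ l dvd P" by (metis dvdI)
  then show ?thesis using assms(1) by (simp add: order_divides)
qed

lemma card_mult_le_degree:
  fixes P :: "'b::field poly"
  assumes "P \<noteq> 0" "0 < l" "\<And>x. x \<in> Z \<Longrightarrow> l \<le> order x P"
  shows "finite Z" "card Z * l \<le> degree P"
proof -
  have sub: "Z \<subseteq> {x. poly P x = 0}" using assms by (force simp: order_root)
  have fin: "finite {x. poly P x = 0}" using assms(1) by (rule poly_roots_finite)
  show "finite Z" using sub fin by (rule finite_subset)
  have "card Z * l = (\<Sum>x\<in>Z. l)" by simp
  also have "\<dots> \<le> (\<Sum>x\<in>Z. order x P)" by (rule sum_mono) (rule assms(3))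
  also have "\<dots> \<le> (\<Sum>x | poly P x = 0. order x P)" by (rule sum_mono2[OF fin sub]) simp
  also have "\<dots> \<le> degree P" by (rule sum_order_le_degree[OF assms(1)])
  finally show "card Z * l \<le> degree P" .
qed

lemma dvd_power_add_diff:
  fixes a h :: "'b::comm_ring_1"
  shows "d dvd (a + d * h) ^ n - a ^ n"
proof (induction n)
  case (Suc n)
  have "(a + d * h) ^ Suc n - a ^ Suc n = a * ((a + d * h) ^ n - a ^ n) + d * (h * (a + d * h) ^ n)"
    by (simp add: algebra_simps)
  then show ?case using Suc by simp
qed simp

text \<open>This compares equations with unknowns in \<open>stepanov_bound\<close>. The terms
  \<open>2 * R * D\<close> agree on both sides, and the surplus \<open>8 * (1 + 2 * m)\<close> over
  \<open>R\<close> is chosen so that the rest has the common factor \<open>1 + 2 * m\<close>. What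
  remains is \<open>Q + 8 * R < 8 * D\<close>, where \<open>8 * D\<close> is about
  \<open>2 * Q\<close>; \<open>R\<close> at least 9 is enough for this.\<close>

lemma stepanov_parameters:
  fixes Q R m :: nat
  assumes "Q = R * R" "9 \<le> R"
  shows "2 * R * (Q div 4 + (R + 8 * (1 + 2 * m)) + 2 * R * m) < (R + 8 * (1 + 2 * m)) * (Q div 4) * 2"
proof -
  define D where "D = Q div 4"
  have D: "Q \<le> 4 * D + 3" by (simp add: D_def)
  have "9 * R \<le> Q" using assms by simp
  then have "8 * R + 6 < Q" using assms(2) by linarith
  then have "Q + 8 * R < 8 * D" using D \<open>8 * R + 6 < Q\<close> by linarith
  then have "(Q + 8 * R) * (1 + 2 * m) < 8 * D * (1 + 2 * m)" by (intro mult_strict_right_mono) auto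
  moreover have "2 * R * (D + (R + 8 * (1 + 2 * m)) + 2 * R * m) = 2 * R * D + 2 * ((Q + 8 * R) * (1 + 2 * m))"
    by (simp add: assms algebra_simps)
  moreover have "(R + 8 * (1 + 2 * m)) * D * 2 = 2 * R * D + 2 * (8 * D * (1 + 2 * m))"
    by (simp add: algebra_simps)
  ultimately show ?thesis unfolding D_def by linarith
qed

text \<open>
  Stepanov's method: an auxiliary polynomial of degree about \<open>Q R\<close> that vanishes to order \<open>2 R\<close>
  at every point of \<open>Z\<close>.
\<close>
theorem stepanov_bound:
  fixes f :: "'b::field poly" and Z :: "'b set"
  assumes frob: "\<And>p q :: 'b poly. (p + q) ^ Q = p ^ Q + q ^ Q"
    and Q: "Q = 2 * b + 1" "Q = R * R" "9 \<le> R"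
    and m: "degree f = m" "1 \<le> m" "2 * m \<le> Q"
    and c: "poly f c \<noteq> 0" and odd: "odd (order \<rho> f)"
    and Z: "\<And>x. x \<in> Z \<Longrightarrow> x ^ Q = x" "\<And>x. x \<in> Z \<Longrightarrow> poly f x ^ b = 1"
  shows "finite Z" "2 * card Z \<le> Q + R * (17 * m + 8)"
proof -
  obtain k where k: "m = Suc k" using m by (cases m) auto
  obtain u where u: "scaled_shift f f = smult f u" "weighted_degree_le k 0 u"
    using scaled_shift_self_factor[of f k] m k by auto
  \<comment> \<open>\<open>D\<close> is a quarter of \<open>Q\<close> so that blocks of degree below
    \<open>D\<close> satisfy the degree conditions of \<open>stepanov_nonzero\<close>.
    \<open>J\<close> exceeds \<open>R\<close> by the surplus that yields more unknowns than
    equations. A degree of about \<open>Q * J\<close> divided by the vanishing order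
    \<open>l\<close> bounds \<open>Z\<close> by about half of \<open>Q\<close>.\<close>
  define D J l where "D = Q div 4" and "J = R + 8 * (1 + 2 * m)" and "l = 2 * R"
  define N where "N = D + J + l * m"
  define c' where "c' = (- c) ^ Q"
  define I where "I = ({..<J} \<times> {..<D}) \<times> (UNIV :: bool set)"
  \<comment> \<open>\<open>M\<close> is the Taylor expansion of \<open>p\<close> at a point
    \<open>x\<close> of \<open>Z\<close> modulo T^Q, with \<open>x\<close> kept as a variable. On
    \<open>Z\<close> the power \<open>f ^ b\<close> becomes \<open>u ^ b\<close>, and
    \<open>(x - c) ^ Q\<close> becomes \<open>x + c'\<close> because \<open>x ^ Q = x\<close>; so
    the coefficients have small degree in \<open>x\<close>.\<close>
  define M where "M = (\<lambda>((j, d), t). scaled_shift f (monom 1 d) * (if t then u ^ b else 1) * [:[:c', 1:] ^ j:])"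
  define p where "p = (\<lambda>((j, d), t). monom 1 d * (if t then f ^ b else 1) * ([:- c, 1:] ^ Q) ^ j)"
  have "9 * 9 \<le> R * R" using Q(3) by (intro mult_le_mono)
  then have Q81: "81 \<le> Q" using Q(2) by simp
  have D1: "1 \<le> D" using Q81 by (simp add: D_def)
  have b0: "0 < b" using Q81 Q(1) by linarith
  have "2 * R \<le> R * R" using Q(3) by (intro mult_le_mono) auto
  then have lQ: "l \<le> Q" using Q(2) by (simp add: l_def)
  have fin: "finite I" and "card I = J * D * 2" by (simp_all add: I_def card_cartesian_product)
  moreover have "card ({..<l} \<times> {..<N}) = l * N" by (simp add: card_cartesian_product)
  moreover have "l * N < J * D * 2"
    using stepanov_parameters[OF Q(2,3)] by (simp add: N_def l_def D_def J_def)
  ultimately have "card ({..<l} \<times> {..<N}) < card I" by simp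
  \<comment> \<open>The equations make the coefficients of T^i with \<open>i < l\<close> vanish
    identically in X; all degrees that occur are below \<open>N\<close>.\<close>
  from homogeneous_system[OF _ fin this, of "\<lambda>e \<iota>. poly.coeff (poly.coeff (M \<iota>) (fst e)) (snd e)"]
  obtain a where a: "\<exists>\<iota>\<in>I. a \<iota> \<noteq> 0"
      "\<And>e. e \<in> {..<l} \<times> {..<N} \<Longrightarrow> (\<Sum>\<iota>\<in>I. a \<iota> * poly.coeff (poly.coeff (M \<iota>) (fst e)) (snd e)) = 0"
    by blast
  define W where "W = (\<Sum>\<iota>\<in>I. smult [:a \<iota>:] (M \<iota>))"
  define P where "P = (\<Sum>\<iota>\<in>I. smult (a \<iota>) (p \<iota>))"
  have M_deg: "degree (poly.coeff (M \<iota>) i) < D + J + i * k" if "\<iota> \<in> I" for \<iota> i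
  proof -
    from that obtain j d t where \<iota>: "\<iota> = ((j, d), t)" "j < J" "d < D" by (auto simp: I_def)
    have 1: "weighted_degree_le k d (scaled_shift f (monom 1 d))"
      using weighted_degree_le_scaled_shift[of f k "monom 1 d"] m k by (simp add: degree_monom_eq)
    have 2: "weighted_degree_le k 0 (if t then u ^ b else 1)"
      using weighted_degree_le_power[OF u(2)] weighted_degree_le_power[OF u(2), of 0] by simp
    have 3: "weighted_degree_le k j [:[:c', 1:] ^ j:]"
      by (rule weighted_degree_le_const) (simp add: degree_linear_power)
    have "weighted_degree_le k (d + 0 + j) (M \<iota>)"
      unfolding \<iota> M_def prod.case by (intro weighted_degree_le_mult 1 2 3)
    then have "degree (poly.coeff (M \<iota>) i) \<le> d + j + i * k" by (simp add: weighted_degree_le_def)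
    then show ?thesis using \<iota> by linarith
  qed
  have W0: "poly.coeff W i = 0" if "i < l" for i
  proof (rule poly_eqI)
    fix e
    have c: "poly.coeff (poly.coeff W i) e = (\<Sum>\<iota>\<in>I. a \<iota> * poly.coeff (poly.coeff (M \<iota>) i) e)"
      by (simp add: W_def coeff_sum)
    show "poly.coeff (poly.coeff W i) e = poly.coeff 0 e"
    proof (cases "e < N")
      case True
      then show ?thesis using a(2)[of "(i, e)"] that c by simp
    next
      case False
      have "poly.coeff (poly.coeff (M \<iota>) i) e = 0" if "\<iota> \<in> I" for \<iota>
      proof (rule coeff_eq_0)
        have "i * k \<le> l * m" using \<open>i < l\<close> k by (intro mult_le_mono) auto
        then show "degree (poly.coeff (M \<iota>) i) < e"
          using M_deg[OF that, of i] False by (simp add: N_def)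
      qed
      then show ?thesis by (simp add: c)
    qed
  qed
  have P0: "P \<noteq> 0"
  proof -
    define r s where "r j = (\<Sum>d<D. monom (a ((j, d), False)) d)"
      and "s j = (\<Sum>d<D. monom (a ((j, d), True)) d)" for j
    have deg: "degree (r j) \<le> D - 1" "degree (s j) \<le> D - 1" for j
      using D1 unfolding r_def s_def by (auto intro!: degree_sum_le order.trans[OF degree_monom_le])
    have coeff: "poly.coeff (r j) d = a ((j, d), False)" "poly.coeff (s j) d = a ((j, d), True)"
      if "d < D" for j d
      using that by (simp_all add: r_def s_def coeff_sum if_distrib sum.delta cong: if_cong)
    have "P = (\<Sum>j<J. \<Sum>d<D. smult (a ((j, d), False)) (p ((j, d), False)) + smult (a ((j, d), True)) (p ((j, d), True)))"
      unfolding P_def I_def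
      by (simp add: sum.cartesian_product' UNIV_bool add.commute)
    also have "\<dots> = (\<Sum>j<J. (r j + s j * f ^ b) * ([:- c, 1:] ^ Q) ^ j)"
    proof (intro sum.cong refl)
      fix j
      have r: "r j = (\<Sum>d<D. smult (a ((j, d), False)) (monom 1 d))"
        and s: "s j = (\<Sum>d<D. smult (a ((j, d), True)) (monom 1 d))"
        by (simp_all add: r_def s_def smult_monom)
      show "(\<Sum>d<D. smult (a ((j, d), False)) (p ((j, d), False)) + smult (a ((j, d), True)) (p ((j, d), True)))
          = (r j + s j * f ^ b) * ([:- c, 1:] ^ Q) ^ j"
        by (simp add: r s p_def sum_distrib_right sum.distrib distrib_right)
    qed
    also have "\<dots> \<noteq> 0"
    proof (rule stepanov_nonzero[OF frob Q(1) c odd])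
      have 4: "4 * D \<le> Q" by (simp add: D_def)
      fix j
      show "2 * degree (r j) + degree f < Q" using deg(1)[of j] 4 m D1 by linarith
      show "2 * degree (s j) < Q" using deg(2)[of j] 4 D1 by linarith
    next
      obtain j d t where "j < J" "d < D" "a ((j, d), t) \<noteq> 0" using a(1) by (auto simp: I_def)
      then have "poly.coeff (if t then s j else r j) d \<noteq> 0" by (cases t) (simp_all add: coeff)
      then have "r j \<noteq> 0 \<or> s j \<noteq> 0" by (cases t) auto
      then show "\<exists>j<J. r j \<noteq> 0 \<or> s j \<noteq> 0" using \<open>j < J\<close> by blast
    qed
    finally show ?thesis .
  qed
  have degP: "degree P \<le> D + m * b + Q * (J - 1)"
    unfolding P_def
  proof (intro degree_sum_le order.trans[OF degree_smult_le])
    fix \<iota> assume "\<iota> \<in> I"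
    then obtain j d t where \<iota>: "\<iota> = ((j, d), t)" "j < J" "d < D" by (auto simp: I_def)
    have "degree (f ^ b) \<le> m * b" using degree_power_le[of f b] m by simp
    then have 1: "degree (if t then f ^ b else 1) \<le> m * b" by simp
    have "degree (([:- c, 1:] ^ Q) ^ j) = Q * j"
      by (simp only: power_mult[symmetric] degree_linear_power)
    moreover have "Q * j \<le> Q * (J - 1)" using \<iota> by (intro mult_le_mono) auto
    ultimately have 2: "degree (([:- c, 1:] ^ Q) ^ j) \<le> Q * (J - 1)" by simp
    have "degree (p \<iota>) \<le> degree (monom (1::'b) d) + degree (if t then f ^ b else 1) + degree (([:- c, 1:] ^ Q) ^ j)"
      unfolding \<iota> p_def prod.case by (meson degree_mult_le order.trans add_le_mono1)
    then show "degree (p \<iota>) \<le> D + m * b + Q * (J - 1)"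
      using 1 2 \<iota> by (simp add: degree_monom_eq)
  qed (simp add: I_def)
  have order: "l \<le> order x P" if "x \<in> Z" for x
  proof (rule le_order_if_taylor_coeffs_vanish[OF P0])
    define y where "y = poly f x"
    show y0: "poly f x \<noteq> 0" using Z(2)[OF that] b0 by (auto simp: power_0_left)
    have yb: "y ^ b = 1" using Z(2)[OF that] by (simp add: y_def)
    define T where "T = (monom 1 Q :: 'b poly)"
    have cong: "T dvd pcompose (p \<iota>) [:x, y:] - eval_coeffs x (M \<iota>)" if "\<iota> \<in> I" for \<iota>
    proof -
      from that obtain j d t where \<iota>: "\<iota> = ((j, d), t)" by (auto simp: I_def)
      have "[:x - c:] ^ Q = [:x:] ^ Q + [:- c:] ^ Q" by (simp flip: frob)
      then have xc: "(x - c) ^ Q = x + c'"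
        using Z(1)[OF \<open>x \<in> Z\<close>] by (simp add: poly_const_pow c'_def)
      \<comment> \<open>By Frobenius the power \<open>Q\<close> produces no term strictly between
        degree 0 and degree \<open>Q\<close>, so modulo \<open>T\<close> only a constant is
        left.\<close>
      have "[:x - c, y:] = [:x - c:] + monom y 1" by (simp add: monom_altdef)
      then have "[:x - c, y:] ^ Q = [:x - c:] ^ Q + monom y 1 ^ Q" by (simp only: frob)
      also have "monom y 1 ^ Q = T * [:y ^ Q:]" by (simp add: monom_power T_def smult_monom)
      finally have lin: "[:x - c, y:] ^ Q = [:x + c':] + T * [:y ^ Q:]"
        by (simp add: poly_const_pow xc)
      have "pcompose (f ^ b) [:x, y:] = eval_coeffs x (scaled_shift f f) ^ b"
        by (simp add: pcompose_power eval_coeffs_scaled_shift y_def)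
      also have "\<dots> = eval_coeffs x (u ^ b)" by (simp add: u(1) smult_power yb flip: y_def)
      finally have "pcompose (if t then f ^ b else 1) [:x, y:] = eval_coeffs x (if t then u ^ b else 1)"
        by (simp add: pcompose_1)
      then have "pcompose (p \<iota>) [:x, y:] - eval_coeffs x (M \<iota>) =
          (eval_coeffs x (scaled_shift f (monom 1 d)) * eval_coeffs x (if t then u ^ b else 1)) *
          (([:x + c':] + T * [:y ^ Q:]) ^ j - [:x + c':] ^ j)"
        unfolding \<iota> p_def M_def prod.case lin[symmetric]
        by (simp add: pcompose_mult pcompose_power eval_coeffs_scaled_shift y_def pcompose_pCons
              algebra_simps poly_const_pow)
      then show ?thesis using dvd_power_add_diff by (metis dvd_mult)
    qed
    have "pcompose P [:x, y:] - eval_coeffs x W = (\<Sum>\<iota>\<in>I. smult (a \<iota>) (pcompose (p \<iota>) [:x, y:] - eval_coeffs x (M \<iota>)))"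
      by (simp add: P_def W_def pcompose_sum pcompose_smult eval_coeffs_sum smult_diff_right sum_subtractf)
    also have "T dvd \<dots>" by (intro dvd_sum dvd_smult cong)
    finally have "poly.coeff (pcompose P [:x, y:] - eval_coeffs x W) i = 0" if "i < Q" for i
      using that by (simp add: T_def monom_1_dvd_iff')
    then show "poly.coeff (pcompose P [:x, poly f x:]) i = 0" if "i < l" for i
      using that lQ W0[OF that] by (simp add: y_def)
  qed
  have l0: "0 < l" using Q by (simp add: l_def)
  show "finite Z" using card_mult_le_degree(1)[OF P0 l0 order] .
  have "card Z * l \<le> D + m * b + Q * (J - 1)"
    using card_mult_le_degree(2)[OF P0 l0 order] degP by (rule le_trans)
  also have "\<dots> \<le> Q + m * Q + Q * (J - 1)"
    using Q(1) by (intro add_mono mult_le_mono) (auto simp: D_def)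
  also have "\<dots> = Q * (J + m)"
    using Q(3) by (cases J) (auto simp: J_def algebra_simps)
  finally have "card Z * (2 * R) \<le> R * R * (J + m)" by (simp only: l_def Q(2))
  then have "R * (2 * card Z) \<le> R * (R * (J + m))" by (simp only: mult.assoc mult.commute mult.left_commute)
  then have "2 * card Z \<le> R * (J + m)" using Q(3) by simp
  \<comment> \<open>Of \<open>17 * m + 8\<close>, the surplus in \<open>J\<close> contributes
    \<open>16 * m + 8\<close> and the degree of \<open>f ^ b\<close> the last
    \<open>m\<close>.\<close>
  also have "\<dots> = Q + R * (17 * m + 8)" by (simp add: J_def Q(2) algebra_simps)
  finally show "2 * card Z \<le> Q + R * (17 * m + 8)" .
qed

section \<open>Finite subfields of the algebraic closure\<close>

text \<open>By Sylow, a prime \<open>l\<close> dividing the cardinality is the order of an additive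
  subgroup. Adding a nonzero element \<open>x\<close> permutes the subgroup, and comparing sums
  gives \<open>of_nat l * x = 0\<close>, so the characteristic divides \<open>l\<close>.\<close>

lemma card_prime_power: "\<exists>e. CARD('a::{field,finite}) = CHAR('a) ^ e"
proof -
  define p where "p = CHAR('a)"
  have p: "prime p"
    using prime_CHAR_semidom[where ?'a = 'a] finite_imp_CHAR_pos[where ?'a = 'a] by (simp add: p_def)
  have q0: "CARD('a) \<noteq> 0" by simp
  have "prime_factors CARD('a) \<subseteq> {p}"
  proof
    fix l assume l: "l \<in> prime_factors CARD('a)"
    then have pl: "prime l" and ldvd: "l dvd CARD('a)" by (auto simp: in_prime_factors_iff)
    define G where "G = \<lparr>carrier = (UNIV :: 'a set), monoid.mult = (+), one = (0 :: 'a)\<rparr>"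
    interpret G: group G
    proof (rule groupI)
      fix x assume "x \<in> carrier G"
      show "\<exists>y\<in>carrier G. y \<otimes>\<^bsub>G\<^esub> x = \<one>\<^bsub>G\<^esub>"
        by (intro bexI[of _ "- x"]) (auto simp: G_def)
    qed (auto simp: G_def add_ac)
    have "Coset.order G = l ^ 1 * (CARD('a) div l)"
      using ldvd by (simp add: G_def Coset.order_def)
    from sylow_thm[OF pl G.group_axioms this] obtain H where H: "subgroup H G" "card H = l"
      by (auto simp: G_def)
    have "finite H" "H \<noteq> {0}" using H pl by (auto intro: card_ge_0_finite simp: prime_gt_0_nat)
    moreover have "0 \<in> H" using subgroup.one_closed[OF H(1)] by (simp add: G_def)
    ultimately obtain x where x: "x \<in> H" "x \<noteq> 0" by blast
    have add: "y + x \<in> H" if "y \<in> H" for y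
      using subgroup.m_closed[OF H(1) that x(1)] by (simp add: G_def)
    have "(\<Sum>y\<in>H. y) = (\<Sum>y\<in>H. y + x)"
    proof -
      have "(\<lambda>y. y + x) ` H = H"
        using add \<open>finite H\<close> by (intro card_subset_eq) (auto simp: card_image)
      then show ?thesis using sum.reindex[of "\<lambda>y. y + x" H "\<lambda>y. y"] by (simp add: inj_on_def)
    qed
    then have "of_nat l * x = 0" by (simp add: sum.distrib H(2))
    then have "p dvd l" using x by (simp add: p_def of_nat_eq_0_iff_char_dvd)
    then show "l \<in> {p}" using primes_dvd_imp_eq[OF p pl] by simp
  qed
  then have "CARD('a) = p ^ multiplicity p CARD('a)"
    using prime_factorization_nat[of "CARD('a)"]
    by (cases "prime_factors CARD('a) = {}")
       (auto simp: subset_singleton_iff prime_factors_multiplicity not_dvd_imp_multiplicity_0)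
  then show ?thesis unfolding p_def by blast
qed

lemma power_card_eq_self: "x ^ CARD('a) = x" for x :: "'a::{field,finite}"
proof (cases "x = 0")
  case False
  have "x * (\<Prod>y\<in>UNIV-{0}. x * y) = x * x ^ (CARD('a) - 1) * \<Prod>(UNIV-{0})"
    by (simp add: prod.distrib mult_ac)
  also have "x * x ^ (CARD('a) - 1) = x ^ CARD('a)"
    by (metis finite_UNIV_card_ge_0 finite_class.finite_UNIV power_eq_if zero_less_iff_neq_zero)
  also have "(\<Prod>y\<in>UNIV-{0}. x * y) = (\<Prod>y\<in>UNIV-{0}. y)"
    by (rule prod.reindex_bij_witness[of _ "\<lambda>y. y / x" "\<lambda>y. x * y"]) (use False in auto)
  finally show ?thesis by simp
qed (simp add: zero_power)

lemma prime_CHAR: "prime CHAR('a::{field,finite})"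
  using prime_CHAR_semidom[where ?'a = 'a] finite_imp_CHAR_pos[where ?'a = 'a] by simp

lemma frobenius_alg_closure:
  fixes x y :: "'a::{field,finite} alg_closure"
  shows "(x + y) ^ (CARD('a) ^ n) = x ^ (CARD('a) ^ n) + y ^ (CARD('a) ^ n)"
proof -
  obtain e where "CARD('a) = CHAR('a) ^ e" using card_prime_power[where ?'a = 'a] by blast
  then have "CARD('a) ^ n = CHAR('a alg_closure) ^ (e * n)" by (simp add: power_mult)
  then show ?thesis by (intro freshmans_dream') (simp_all add: prime_CHAR)
qed

lemma frobenius_poly_alg_closure:
  fixes f g :: "'a::{field,finite} alg_closure poly"
  shows "(f + g) ^ (CARD('a) ^ n) = f ^ (CARD('a) ^ n) + g ^ (CARD('a) ^ n)"
proof -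
  obtain e where "CARD('a) = CHAR('a) ^ e" using card_prime_power[where ?'a = 'a] by blast
  then have "CARD('a) ^ n = CHAR('a alg_closure poly) ^ (e * n)" by (simp add: power_mult)
  then show ?thesis by (intro freshmans_dream') (simp_all add: prime_CHAR)
qed

lemma frobenius_diff_alg_closure:
  fixes x y :: "'a::{field,finite} alg_closure"
  shows "(x - y) ^ (CARD('a) ^ n) = x ^ (CARD('a) ^ n) - y ^ (CARD('a) ^ n)"
  using frobenius_alg_closure[of "x - y" y n] by (simp add: algebra_simps)

lemma of_nat_card_alg_closure: "of_nat CARD('a) = (0 :: 'a::{field,finite} alg_closure)"
proof -
  obtain e where e: "CARD('a) = CHAR('a) ^ e" using card_prime_power[where ?'a = 'a] by blast
  have "2 \<le> CARD('a)" using card_mono[of UNIV "{0, 1 :: 'a}"] by simp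
  then have "e \<noteq> 0" using e by (cases e) auto
  then show ?thesis
    by (simp add: of_nat_eq_0_iff_char_dvd) (simp add: e dvd_power)
qed

section \<open>Simple roots and the subfields with q^n elements\<close>

lemma order_eq_1_if_simple_root:
  fixes p :: "'b::field poly"
  assumes "poly p x = 0" "poly (pderiv p) x \<noteq> 0"
  shows "order x p = 1"
proof -
  have p0: "p \<noteq> 0" using assms by auto
  have "\<not> 2 \<le> order x p"
  proof
    assume "2 \<le> order x p"
    then have "[:- x, 1:]\<^sup>2 dvd p" using p0 by (simp add: order_divides)
    then obtain h where h: "p = [:- x, 1:]\<^sup>2 * h" unfolding dvd_def by blast
    have "pderiv p = [:- x, 1:] * pderiv ([:- x, 1:] * h) + [:- x, 1:] * h * pderiv [:- x, 1:]"
      unfolding h power2_eq_square mult.assoc by (simp only: pderiv_mult mult.assoc)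
    then show False using assms by simp
  qed
  moreover have "order x p \<noteq> 0" using assms p0 by (simp add: order_root)
  ultimately show ?thesis by linarith
qed

lemma card_roots_if_simple:
  fixes p :: "'b::alg_closed_field poly"
  assumes "p \<noteq> 0" and simple: "\<And>x. poly p x = 0 \<Longrightarrow> poly (pderiv p) x \<noteq> 0"
  shows "card {x. poly p x = 0} = degree p"
proof -
  obtain A where A: "size A = degree p" "p = smult (lead_coeff p) (\<Prod>x\<in>#A. [:-x, 1:])"
    using alg_closed_imp_factorization[OF assms(1)] by blast
  have count: "count A x \<le> 1" for x
  proof (rule ccontr)
    assume "\<not> count A x \<le> 1"
    then have "{#x, x#} \<subseteq># A" by (simp add: subseteq_mset_def)
    then obtain B where B: "A = {#x, x#} + B" by (metis subset_mset.le_iff_add)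
    define g where "g y = [:- y, 1:]" for y :: 'b
    have "p = smult (lead_coeff p) (\<Prod>y\<in>#A. g y)" using A(2) by (simp add: g_def)
    also have "\<dots> = g x ^ 2 * smult (lead_coeff p) (\<Prod>y\<in>#B. g y)"
      by (simp add: B power2_eq_square mult.assoc)
    finally have "[:- x, 1:]\<^sup>2 dvd p" unfolding g_def by (rule dvdI)
    then have "2 \<le> order x p" using assms(1) by (simp add: order_divides)
    moreover have "poly p x = 0" using calculation assms(1) by (simp add: order_root)
    ultimately show False using order_eq_1_if_simple_root[of p x] simple by simp
  qed
  have roots: "{x. poly p x = 0} = set_mset A"
    by (subst A(2)) (use assms(1) in \<open>auto simp: poly_prod_mset prod_mset_zero_iff\<close>)
  have "A = mset_set (set_mset A)"
    by (rule multiset_eqI) (use count in \<open>auto simp: count_mset_set' le_Suc_eq not_in_iff[symmetric]\<close>)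
  then have "size A = card (set_mset A)" by (metis size_mset_set)
  then show ?thesis using A(1) roots by simp
qed

text \<open>Arbitrarily large degrees are needed in one argument, so the extensions are subsets of a
  single type: the fixed points of the iterates of the Frobenius map.\<close>

definition extension_field :: "nat \<Rightarrow> 'a::{field,finite} alg_closure set" where
  "extension_field n = {x. x ^ (CARD('a) ^ n) = x}"

lemma extension_field_closed:
  assumes "x \<in> extension_field n" "y \<in> extension_field n"
  shows "x + y \<in> extension_field n" "x - y \<in> extension_field n"
    "x * y \<in> extension_field n" "x / y \<in> extension_field n"
  using assms by (auto simp: extension_field_def frobenius_alg_closure frobenius_diff_alg_closure
      power_mult_distrib power_divide)

lemma zero_in_extension_field [simp]: "0 \<in> extension_field n"
  by (simp add: extension_field_def)

text \<open>The polynomial X^(q^n) - X has derivative -1, since q is 0 in the field; hence all its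
  roots are simple.\<close>

lemma card_extension_field:
  assumes "0 < n"
  shows "finite (extension_field n :: 'a::{field,finite} alg_closure set)"
    "card (extension_field n :: 'a alg_closure set) = CARD('a) ^ n"
proof -
  define p where "p = (monom 1 (CARD('a) ^ n) + [:0, - 1:] :: 'a alg_closure poly)"
  have q2: "2 \<le> CARD('a)" using card_mono[of UNIV "{0, 1 :: 'a}"] by simp
  have "CARD('a) ^ 1 \<le> CARD('a) ^ n" using assms by (intro power_increasing) auto
  then have deg: "degree p = CARD('a) ^ n"
    unfolding p_def using q2 by (subst degree_add_eq_left) (auto simp: degree_monom_eq)
  have "pderiv p = [:- 1:]"
    using assms of_nat_card_alg_closure[where ?'a = 'a]
    by (simp add: p_def pderiv_add pderiv_monom pderiv_pCons)
  moreover have "p \<noteq> 0" using deg assms by auto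
  ultimately have *: "card {x. poly p x = 0} = CARD('a) ^ n" "finite {x. poly p x = 0}"
    using card_roots_if_simple[of p] deg by (auto intro: poly_roots_finite)
  have "extension_field n = {x. poly p x = 0}"
    by (auto simp: extension_field_def p_def poly_monom)
  then show "finite (extension_field n :: 'a alg_closure set)"
    "card (extension_field n :: 'a alg_closure set) = CARD('a) ^ n" using * by simp_all
qed

lemma extension_field_1: "extension_field 1 = range (to_ac :: 'a::{field,finite} \<Rightarrow> _)"
proof (rule sym, rule card_subset_eq)
  show "finite (extension_field 1 :: 'a alg_closure set)" by (rule card_extension_field) simp
  show "range (to_ac :: 'a \<Rightarrow> _) \<subseteq> extension_field 1"
    by (auto simp: extension_field_def power_card_eq_self simp flip: to_ac_power)
  show "card (range (to_ac :: 'a \<Rightarrow> _)) = card (extension_field 1 :: 'a alg_closure set)"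
    by (simp add: card_extension_field card_image inj_to_ac)
qed

lemma extension_field_dvd: "extension_field n \<subseteq> extension_field (n * k)"
proof -
  have "x ^ (CARD('a) ^ (n * k)) = x" if "x ^ (CARD('a) ^ n) = x" for x :: "'a::{field,finite} alg_closure"
    using that by (induction k) (simp_all add: power_add power_mult)
  then show ?thesis by (auto simp: extension_field_def)
qed

text \<open>On \<open>extension_field n\<close> this is the trace to the base field. Taken on the
  whole closure it is additive without side conditions and can be solved for a preimage.\<close>

definition trace_sum :: "nat \<Rightarrow> 'a::{field,finite} alg_closure \<Rightarrow> 'a alg_closure" where
  "trace_sum n x = (\<Sum>i<n. x ^ (CARD('a) ^ i))"

lemma trace_sum_add: "trace_sum n (x + y) = trace_sum n x + trace_sum n y"
  by (simp add: trace_sum_def frobenius_alg_closure sum.distrib)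

lemma trace_sum_diff: "trace_sum n (x - y) = trace_sum n x - trace_sum n y"
  by (simp add: trace_sum_def frobenius_diff_alg_closure sum_subtractf)

text \<open>A telescoping sum. Its use: \<open>y ^ CARD('a) - y\<close> has trace 0 exactly when
  \<open>y\<close> lies in \<open>extension_field n\<close>.\<close>

lemma trace_sum_power_diff:
  fixes x :: "'a::{field,finite} alg_closure"
  shows "trace_sum n (x ^ CARD('a) - x) = x ^ (CARD('a) ^ n) - x"
proof (induction n)
  case (Suc n)
  have "(x ^ CARD('a)) ^ CARD('a) ^ n = x ^ CARD('a) ^ Suc n"
    by (simp only: power_mult[symmetric] power_Suc)
  then have "(x ^ CARD('a) - x) ^ CARD('a) ^ n = x ^ CARD('a) ^ Suc n - x ^ CARD('a) ^ n"
    by (simp only: frobenius_diff_alg_closure)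
  then show ?case using Suc by (simp add: trace_sum_def)
qed (simp add: trace_sum_def)

lemma trace_sum_frobenius:
  fixes x :: "'a::{field,finite} alg_closure"
  shows "trace_sum n x ^ CARD('a) = trace_sum n (x ^ CARD('a))"
proof -
  have "(\<Sum>i\<in>A. g i) ^ CARD('a) = (\<Sum>i\<in>A. g i ^ CARD('a))" for A and g :: "nat \<Rightarrow> 'a alg_closure"
    using frobenius_alg_closure[where n = 1 and ?'a = 'a]
    by (induction A rule: infinite_finite_induct) (simp_all add: zero_power)
  moreover have "(x ^ CARD('a) ^ i) ^ CARD('a) = (x ^ CARD('a)) ^ CARD('a) ^ i" for i
    by (simp only: power_mult[symmetric] mult.commute)
  ultimately show ?thesis by (simp only: trace_sum_def)
qed

text \<open>Transitivity of the trace: the argument on the right is the relative trace from degree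
  \<open>2 * n\<close> down to degree \<open>n\<close>.\<close>

lemma trace_sum_double:
  fixes x :: "'a::{field,finite} alg_closure"
  shows "trace_sum (2 * n) x = trace_sum n (x + x ^ (CARD('a) ^ n))"
proof -
  have "trace_sum (n + k) x = trace_sum n x + trace_sum k (x ^ (CARD('a) ^ n))" for k
    by (induction k) (simp_all add: trace_sum_def power_add power_mult add.assoc)
  from this[of n] show ?thesis by (simp add: mult_2 trace_sum_add)
qed

lemma trace_sum_in_base:
  assumes "x \<in> extension_field n"
  shows "trace_sum n x \<in> extension_field 1"
proof -
  have "trace_sum n (x ^ CARD('a)) - trace_sum n x = 0"
    using assms by (simp add: trace_sum_diff[symmetric] trace_sum_power_diff extension_field_def)
  then show ?thesis by (simp add: extension_field_def trace_sum_frobenius)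
qed

lemma trace_sum_surj:
  fixes j :: "'a::{field,finite} alg_closure"
  assumes "0 < n"
  obtains u where "trace_sum n u = j"
proof -
  define p where "p = (\<Sum>i<n. monom 1 (CARD('a) ^ i)) - [:j:]"
  have q2: "2 \<le> CARD('a)" using card_mono[of UNIV "{0, 1 :: 'a}"] by simp
  obtain k where k: "n = Suc k" using assms by (cases n) auto
  \<comment> \<open>The exponents are distinct and positive, so the top one keeps coefficient 1 and
    \<open>p\<close> is not constant.\<close>
  have "poly.coeff p (CARD('a) ^ k) = 1"
    using q2 by (simp add: p_def k coeff_sum coeff_pCons sum.delta' split: nat.splits cong: if_cong)
  then have "CARD('a) ^ k \<le> degree p" by (intro le_degree) simp
  then have "0 < degree p" by (metis finite_UNIV_card_ge_0 finite_class.finite_UNIV less_le_trans zero_less_power)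
  then obtain u where "poly p u = 0" using alg_closed_imp_poly_has_root by blast
  then have "trace_sum n u = j" by (simp add: p_def trace_sum_def poly_sum poly_monom)
  then show thesis by (rule that)
qed

text \<open>\<open>of_ac\<close> is only meaningful on the image of the base field, where the trace takes its values.\<close>

definition field_trace :: "nat \<Rightarrow> 'a::{field,finite} alg_closure \<Rightarrow> 'a" where
  "field_trace n x = of_ac (trace_sum n x)"

lemma to_ac_field_trace:
  "x \<in> extension_field n \<Longrightarrow> to_ac (field_trace n x) = trace_sum n x"
  unfolding field_trace_def by (rule to_ac_of_ac) (use trace_sum_in_base extension_field_1 in blast)

lemma field_trace_add:
  assumes "x \<in> extension_field n" "y \<in> extension_field n"
  shows "field_trace n (x + y) = field_trace n x + field_trace n y"
proof -
  have "to_ac (field_trace n (x + y)) = to_ac (field_trace n x + field_trace n y)"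
    using assms by (simp add: to_ac_field_trace extension_field_closed trace_sum_add)
  then show ?thesis by (simp only: to_ac_eq_iff)
qed

text \<open>A preimage exists in the closure because a polynomial equation is solvable there. It
  lies in the extension because the trace of \<open>u ^ CARD('a) - u\<close> is the difference of
  \<open>j\<close> with its own Frobenius image, hence 0.\<close>

lemma field_trace_surj:
  fixes j :: "'a::{field,finite}"
  assumes "0 < n"
  obtains u where "u \<in> extension_field n" "field_trace n u = j"
proof -
  obtain u where u: "trace_sum n u = to_ac j" using trace_sum_surj[OF assms] .
  have "to_ac j ^ CARD('a) = to_ac j" by (simp add: power_card_eq_self flip: to_ac_power)
  then have "trace_sum n (u ^ CARD('a) - u) = 0"
    by (simp add: trace_sum_diff trace_sum_frobenius[symmetric] u)
  then have "u \<in> extension_field n" by (simp add: trace_sum_power_diff extension_field_def)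
  then show thesis using that u by (simp add: field_trace_def)
qed

section \<open>The Weil bound for Kloosterman sums\<close>

lemma two_neq_zero_alg_closure:
  assumes "odd CARD('a::{field,finite})"
  shows "(2 :: 'a alg_closure) \<noteq> 0"
proof
  assume 2: "(2 :: 'a alg_closure) = 0"
  obtain k where "CARD('a) = 2 * k + 1" using assms by (auto elim: oddE)
  then have "(of_nat CARD('a) :: 'a alg_closure) = 2 * of_nat k + 1" by simp
  then show False using 2 by (simp add: of_nat_card_alg_closure)
qed

text \<open>The additive map y -> y^q - y has the base field as kernel, and it is onto because the
  closure is algebraically closed; so each fibre is a coset of the base field.\<close>

lemma card_artin_schreier_fibre:
  fixes w :: "'a::{field,finite} alg_closure"
  shows "finite {y. y ^ CARD('a) - y = w}" "card {y. y ^ CARD('a) - y = w} = CARD('a)"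
proof -
  have q2: "2 \<le> CARD('a)" using card_mono[of UNIV "{0, 1 :: 'a}"] by simp
  have "degree (monom 1 CARD('a) + [:- w, - 1:]) = CARD('a)"
    using q2 by (subst degree_add_eq_left) (auto simp: degree_monom_eq)
  then obtain y0 where "poly (monom 1 CARD('a) + [:- w, - 1:]) y0 = 0"
    using alg_closed_imp_poly_has_root[of "monom 1 CARD('a) + [:- w, - 1:]"] q2 by auto
  then have y0: "y0 ^ CARD('a) - y0 = w" by (simp add: poly_monom algebra_simps)
  have add: "(x + y) ^ CARD('a) = x ^ CARD('a) + y ^ CARD('a)"
    and diff: "(x - y) ^ CARD('a) = x ^ CARD('a) - y ^ CARD('a)" for x y :: "'a alg_closure"
    using frobenius_alg_closure[of x y 1] frobenius_diff_alg_closure[of x y 1] by simp_all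
  have "{y. y ^ CARD('a) - y = w} = (\<lambda>z. y0 + z) ` extension_field 1"
  proof (intro equalityI subsetI)
    fix y assume "y \<in> {y. y ^ CARD('a) - y = w}"
    then have "y - y0 \<in> extension_field 1" using y0 by (simp add: extension_field_def diff algebra_simps)
    then show "y \<in> (\<lambda>z. y0 + z) ` extension_field 1" by (intro image_eqI[of _ _ "y - y0"]) auto
  next
    fix y assume "y \<in> (\<lambda>z. y0 + z) ` extension_field 1"
    then obtain z where "y = y0 + z" "z ^ CARD('a) = z" by (auto simp: extension_field_def)
    then show "y \<in> {y. y ^ CARD('a) - y = w}" using y0 by (simp add: add)
  qed
  moreover have "finite (extension_field 1 :: 'a alg_closure set)"
    "card (extension_field 1 :: 'a alg_closure set) = CARD('a)"
    using card_extension_field[of 1, where ?'a = 'a] by simp_all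
  ultimately show "finite {y. y ^ CARD('a) - y = w}" "card {y. y ^ CARD('a) - y = w} = CARD('a)"
    by (simp_all add: card_image inj_on_def del: One_nat_def)
qed

text \<open>
  Writing \<open>x + a/x = y\<^sup>q - y + u\<^sub>0\<close> with \<open>u\<^sub>0\<close> of trace \<open>j\<close> turns the count into one of points on
  \<open>z\<^sup>2 = (y\<^sup>q - y + u\<^sub>0)\<^sup>2 - 4a\<close>, where \<open>z = x - a/x\<close>.
\<close>
lemma card_trace_fibre:
  fixes a j :: "'a::{field,finite} alg_closure"
  assumes odd: "odd CARD('a)" and a: "a \<in> extension_field n" "a \<noteq> 0" and n: "4 \<le> n" "even n"
  shows "CARD('a) * card {x \<in> extension_field n - {0}. trace_sum n (x + a / x) = j} \<le>
    CARD('a) ^ n + CARD('a) ^ (n div 2) * (34 * CARD('a) + 8) + 2 * CARD('a)"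
proof -
  define q Q R where "q = CARD('a)" and "Q = q ^ n" and "R = q ^ (n div 2)"
  define b where "b = (Q - 1) div 2"
  have "2 \<le> q" using card_mono[of UNIV "{0, 1 :: 'a}"] by (simp add: q_def)
  then have q3: "3 \<le> q" using odd by (cases "q = 2") (auto simp: q_def)
  have Qb: "Q = 2 * b + 1" using odd by (simp add: b_def Q_def q_def)
  obtain k where "n = 2 * k" using n by (auto elim!: evenE)
  then have QR: "Q = R * R" by (simp add: Q_def R_def power_add mult_2)
  have "3 ^ 2 \<le> q ^ 2" using q3 by (rule power_mono) simp
  also have "q ^ 2 \<le> R" unfolding R_def using n q3 by (intro power_increasing) auto
  finally have R9: "9 \<le> R" by simp
  have "4 * q \<le> q * q * q" using q3 mult_le_mono[OF q3 q3] by simp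
  also have "\<dots> = q ^ 3" by (simp add: power3_eq_cube)
  also have "\<dots> \<le> Q" unfolding Q_def using n q3 by (intro power_increasing) auto
  finally have Qm: "2 * (2 * q) \<le> Q" by simp
  have n0: "0 < n" using n by simp
  have finF: "finite (extension_field n :: 'a alg_closure set)" using card_extension_field[OF n0] by simp
  have two: "(2 :: 'a alg_closure) \<noteq> 0" using two_neq_zero_alg_closure[OF odd] .
  then have "(2 :: 'a alg_closure) * 2 \<noteq> 0" by (simp only: mult_eq_0_iff) simp
  then have four: "(4 :: 'a alg_closure) \<noteq> 0" by simp
  obtain u0 where u0: "trace_sum n u0 = j" using trace_sum_surj[OF n0] .
  define v where "v = monom 1 q + [:u0, - 1:]"
  define f where "f = v\<^sup>2 + [:- 4 * a:]"
  have v: "poly v y = y ^ q - y + u0" for y by (simp add: v_def poly_monom)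
  have "degree v = q" unfolding v_def using q3 by (subst degree_add_eq_left) (auto simp: degree_monom_eq)
  then have "degree (v\<^sup>2) = 2 * q" using q3 by (subst degree_power_eq) auto
  then have degf: "degree f = 2 * q" unfolding f_def using q3 by (subst degree_add_eq_left) auto
  \<comment> \<open>Stepanov's method wants a point where \<open>f\<close> does not vanish; any
    point with value 1 is one.\<close>
  obtain c where "poly (f - 1) c = 0"
  proof -
    have "degree (f + (- 1)) = 2 * q" using degf q3 by (subst degree_add_eq_left) auto
    then show ?thesis using alg_closed_imp_poly_has_root[of "f - 1"] q3 that by auto
  qed
  then have c: "poly f c \<noteq> 0" by simp
  obtain \<rho> where \<rho>: "poly f \<rho> = 0" using alg_closed_imp_poly_has_root[of f] degf q3 by auto
  \<comment> \<open>Hence the derivative of \<open>f\<close> is -2 v, and at a root of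
    \<open>f\<close> the value of v^2 is 4a, which is nonzero. So the roots of \<open>f\<close> are
    simple, in particular of odd order.\<close>
  have "pderiv v = [:- 1:]"
    using of_nat_card_alg_closure[where ?'a = 'a]
    by (simp add: v_def pderiv_add pderiv_monom pderiv_pCons q_def)
  then have "poly (pderiv f) \<rho> = - 2 * poly v \<rho>"
    by (simp add: f_def pderiv_add pderiv_pCons power2_eq_square pderiv_mult)
  moreover have "poly v \<rho> \<noteq> 0" using \<rho> a four by (auto simp: f_def)
  ultimately have "poly (pderiv f) \<rho> \<noteq> 0" using two by simp
  from order_eq_1_if_simple_root[OF \<rho> this] have odd_order: "odd (order \<rho> f)" by simp
  \<comment> \<open>By Euler's criterion, these are the points of the extension where
    \<open>f\<close> takes a nonzero square as value.\<close>
  define Z where "Z = {y. y ^ Q = y \<and> poly f y ^ b = 1}"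
  have frob: "(p + r) ^ Q = p ^ Q + r ^ Q" for p r :: "'a alg_closure poly"
    unfolding Q_def q_def by (rule frobenius_poly_alg_closure)
  have "1 \<le> 2 * q" using q3 by simp
  note stepanov = stepanov_bound[OF frob Qb QR R9 degf this Qm c odd_order, of Z]
  have Z: "finite Z" "2 * card Z \<le> Q + R * (17 * (2 * q) + 8)"
    subgoal by (rule stepanov(1)) (simp_all add: Z_def)
    subgoal by (rule stepanov(2)) (simp_all add: Z_def)
    done
  define S where "S = {x \<in> extension_field n - {0}. trace_sum n (x + a / x) = j}"
  define W where "W w = {y :: 'a alg_closure. y ^ q - y = w}" for w
  have W: "finite (W w)" "card (W w) = q" for w
    using card_artin_schreier_fibre[of w] by (simp_all add: W_def q_def)
  define U where "U r s = {x :: 'a alg_closure. r + x * (s + x) = 0}" for r s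
  \<comment> \<open>\<open>T1\<close> collects pairs with \<open>y\<close> in \<open>Z\<close> and
    \<open>x\<close> a root of X^2 - v(y) X + a, at most two for each \<open>y\<close>.
    \<open>T2\<close> collects the pairs with x^2 = a: there f(y) = 0, so \<open>y\<close> is
    missing from \<open>Z\<close>.\<close>
  define T1 where "T1 = (SIGMA y:Z. U a (- poly v y))"
  define T2 where "T2 = (SIGMA x:U (- a) 0. W (x + a / x - u0))"
  have finS: "finite S" using finF by (simp add: S_def)
  have deg2: "finite (U r s)" "card (U r s) \<le> 2" for r s
    using poly_roots_finite[of "[:r, s, 1:]"] card_poly_roots_bound[of "[:r, s, 1:]"]
    by (simp_all add: U_def)
  have T1: "finite T1" "card T1 \<le> card Z * 2"
  proof -
    show "finite T1" unfolding T1_def using Z(1) deg2(1) by (intro finite_SigmaI) auto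
    have "card T1 = (\<Sum>y\<in>Z. card (U a (- poly v y)))"
      unfolding T1_def using Z(1) deg2(1) by (intro card_SigmaI) auto
    also have "\<dots> \<le> (\<Sum>y\<in>Z. 2)" using deg2(2) by (intro sum_mono) auto
    finally show "card T1 \<le> card Z * 2" by simp
  qed
  have T2: "finite T2" "card T2 \<le> 2 * q"
  proof -
    show "finite T2" unfolding T2_def using W(1) deg2(1) by (intro finite_SigmaI) auto
    have "card T2 = card (U (- a) 0) * q"
      unfolding T2_def using W deg2(1) by (subst card_SigmaI) auto
    also have "\<dots> \<le> 2 * q" using deg2(2) by (intro mult_le_mono) auto
    finally show "card T2 \<le> 2 * q" .
  qed
  have "(SIGMA x:S. W (x + a / x - u0)) \<subseteq> prod.swap ` T1 \<union> T2"
  proof (rule subsetI)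
    fix s assume "s \<in> (SIGMA x:S. W (x + a / x - u0))"
    then obtain x y where s: "s = (x, y)" and x: "x \<in> S" and y: "y \<in> W (x + a / x - u0)" by blast
    have x0: "x \<in> extension_field n" "x \<noteq> 0" "trace_sum n (x + a / x) = j" using x by (auto simp: S_def)
    have yq: "y ^ q - y = x + a / x - u0" using y by (simp add: W_def)
    have vy: "poly v y = x + a / x" using yq by (simp add: v)
    \<comment> \<open>Both \<open>x + a / x\<close> and \<open>u0\<close> have trace
      \<open>j\<close>, so the Artin-Schreier solution \<open>y\<close> lies in the
      extension.\<close>
    have "y ^ Q - y = trace_sum n (y ^ q - y)" by (simp add: trace_sum_power_diff Q_def q_def)
    also have "\<dots> = 0" by (simp add: yq trace_sum_diff x0(3) u0)
    finally have yQ: "y ^ Q = y" by simp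
    define r where "r = a / x"
    have xr: "a = x * r" using x0(2) by (simp add: r_def)
    define w where "w = x - r"
    have fy: "poly f y = w\<^sup>2"
      by (simp add: f_def vy w_def flip: r_def) (simp add: xr algebra_simps power2_eq_square)
    show "s \<in> prod.swap ` T1 \<union> T2"
    proof (cases "w = 0")
      case True
      then have "x \<in> U (- a) 0" by (simp add: U_def w_def xr)
      then have "(x, y) \<in> T2" using y by (simp add: T2_def)
      then show ?thesis by (simp add: s)
    next
      case False
      have "w \<in> extension_field n" unfolding w_def r_def using x0 a by (intro extension_field_closed) auto
      then have "w ^ Q = w" by (simp add: extension_field_def Q_def q_def)
      then have "w * w ^ (2 * b) = w * 1" using Qb by simp
      then have "w ^ (2 * b) = 1" using False by (metis mult_cancel_left)
      then have "poly f y ^ b = 1" by (simp add: fy power_mult)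
      then have "y \<in> Z" using yQ by (simp add: Z_def)
      moreover have "x \<in> U a (- poly v y)" by (simp add: U_def vy flip: r_def) (simp add: xr algebra_simps)
      ultimately have "(y, x) \<in> T1" by (simp add: T1_def)
      then show ?thesis by (force simp: s)
    qed
  qed
  moreover have "finite (prod.swap ` T1 \<union> T2)" using T1 T2 by simp
  ultimately have "card (SIGMA x:S. W (x + a / x - u0)) \<le> card (prod.swap ` T1 \<union> T2)"
    by (rule card_mono[rotated])
  also have "\<dots> \<le> card T1 + card T2"
    by (meson card_Un_le card_image_le T1(1) add_le_mono1 order.trans)
  also have "\<dots> \<le> Q + R * (34 * q + 8) + 2 * q" using T1(2) T2(2) Z(2) by simp
  also have "card (SIGMA x:S. W (x + a / x - u0)) = q * card S"
    using finS W by (subst card_SigmaI) auto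
  finally show ?thesis by (simp add: S_def q_def Q_def R_def)
qed

section \<open>Additive characters and Kloosterman sums over the extensions\<close>

definition additive_character :: "('a::{field,finite} \<Rightarrow> complex) \<Rightarrow> bool" where
  "additive_character \<psi> \<longleftrightarrow>
    (\<forall>x y. \<psi> (x + y) = \<psi> x * \<psi> y) \<and> (\<forall>x. cmod (\<psi> x) = 1) \<and> (\<exists>x. \<psi> x \<noteq> 1)"

lemma additive_character_add: "additive_character \<psi> \<Longrightarrow> \<psi> (x + y) = \<psi> x * \<psi> y"
  and norm_additive_character: "additive_character \<psi> \<Longrightarrow> cmod (\<psi> x) = 1"
  by (simp_all add: additive_character_def)

lemma additive_character_scale:
  assumes "additive_character \<psi>" "c \<noteq> 0"
  shows "additive_character (\<lambda>x. \<psi> (c * x))"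
proof -
  obtain x where "\<psi> x \<noteq> 1" using assms by (auto simp: additive_character_def)
  then have "\<psi> (c * (x / c)) \<noteq> 1" using assms(2) by simp
  then have "\<exists>y. \<psi> (c * y) \<noteq> 1" by blast
  then show ?thesis using assms(1) by (simp add: additive_character_def distrib_left)
qed

lemma sum_multiplicative_eq_0:
  fixes f :: "'g::ab_group_add \<Rightarrow> complex"
  assumes "finite F" "\<And>x y. x \<in> F \<Longrightarrow> y \<in> F \<Longrightarrow> x + y \<in> F"
    and "\<And>x y. x \<in> F \<Longrightarrow> y \<in> F \<Longrightarrow> f (x + y) = f x * f y"
    and u: "u \<in> F" "f u \<noteq> 1"
  shows "(\<Sum>x\<in>F. f x) = 0"
proof -
  have "(\<lambda>x. u + x) ` F = F"
    using assms by (intro card_subset_eq) (auto simp: card_image)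
  then have "(\<Sum>x\<in>F. f x) = (\<Sum>x\<in>F. f (u + x))"
    using sum.reindex[of "\<lambda>x. u + x" F f] by (simp add: inj_on_def)
  also have "\<dots> = f u * (\<Sum>x\<in>F. f x)" using assms by (simp add: sum_distrib_left)
  finally show ?thesis using u by simp
qed

lemma sum_additive_character:
  "additive_character \<psi> \<Longrightarrow> (\<Sum>x\<in>UNIV. \<psi> x) = 0"
  using sum_multiplicative_eq_0[of UNIV \<psi>] by (auto simp: additive_character_def)

definition kloosterman :: "('a::{field,finite} \<Rightarrow> complex) \<Rightarrow> 'a alg_closure \<Rightarrow> nat \<Rightarrow> complex" where
  "kloosterman \<psi> a n = (\<Sum>x\<in>extension_field n - {0}. \<psi> (field_trace n (x + a / x)))"

lemma extension_field_1_subset: "extension_field 1 \<subseteq> extension_field n"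
  using extension_field_dvd[of 1 n] by simp

text \<open>The fibre sizes \<open>N j\<close> are bounded only from above, by a common
  \<open>B\<close>. Since the values of \<open>\<psi>\<close> sum to 0, each \<open>N j\<close> may
  be replaced by \<open>N j - B\<close>. These differences all have the same sign, so their absolute
  values have a known sum, in which the main terms \<open>Q\<close> cancel.\<close>

lemma norm_kloosterman_le:
  fixes \<psi> :: "'a::{field,finite} \<Rightarrow> complex"
  assumes odd: "odd CARD('a)" and \<psi>: "additive_character \<psi>"
    and a: "a \<in> extension_field 1" "a \<noteq> 0" and n: "4 \<le> n" "even n"
  shows "cmod (kloosterman \<psi> a n) \<le> real (CARD('a) ^ (n div 2) * (36 * CARD('a) + 9))"
proof -
  define q Q R where "q = CARD('a)" and "Q = q ^ n" and "R = q ^ (n div 2)"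
  have q0: "0 < q" by (simp add: q_def)
  have aF: "a \<in> extension_field n" using a extension_field_1_subset by blast
  have n0: "0 < n" using n by simp
  define F where "F = (extension_field n - {0} :: 'a alg_closure set)"
  have F: "finite F" "card F = Q - 1"
    using card_extension_field[OF n0, where ?'a = 'a] by (simp_all add: F_def card_Diff_singleton Q_def q_def)
  define t where "t x = field_trace n (x + a / x)" for x
  define N where "N j = card {x \<in> F. t x = j}" for j
  have le: "q * N j \<le> Q + R * (34 * q + 8) + 2 * q" for j
  proof -
    have "t x = j \<longleftrightarrow> trace_sum n (x + a / x) = to_ac j" if "x \<in> F" for x
    proof -
      have "x + a / x \<in> extension_field n" using that aF by (auto simp: F_def intro!: extension_field_closed)
      from to_ac_field_trace[OF this] show ?thesis by (metis t_def to_ac_eq_iff)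
    qed
    then have "{x \<in> F. t x = j} = {x \<in> extension_field n - {0}. trace_sum n (x + a / x) = to_ac j}"
      unfolding F_def by blast
    then show ?thesis
      using card_trace_fibre[OF odd aF a(2) n, of "to_ac j"] by (simp add: N_def q_def Q_def R_def)
  qed
  define B where "B = real (Q + R * (34 * q + 8) + 2 * q) / q"
  have NB: "real (N j) \<le> B" for j
    using of_nat_mono[OF le[of j], where ?'a = real] q0 by (simp add: B_def field_simps)
  have "(\<Sum>j\<in>UNIV. N j) = card F"
    using sum.group[of F UNIV t "\<lambda>_. 1 :: nat"] F by (simp add: N_def)
  then have sumN: "(\<Sum>j\<in>UNIV. real (N j)) = real Q - 1"
    using F(2) q0 by (simp add: Q_def of_nat_diff flip: of_nat_sum)
  have "kloosterman \<psi> a n = (\<Sum>j\<in>UNIV. \<Sum>x\<in>{x \<in> F. t x = j}. \<psi> (t x))"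
    using sum.group[of F UNIV t "\<lambda>x. \<psi> (t x)"] F by (simp add: kloosterman_def F_def t_def)
  also have "\<dots> = (\<Sum>j\<in>UNIV. of_nat (N j) * \<psi> j)" by (simp add: N_def)
  also have "\<dots> = (\<Sum>j\<in>UNIV. of_real (real (N j) - B) * \<psi> j)"
    using sum_additive_character[OF \<psi>]
    by (simp add: left_diff_distrib sum_subtractf sum_distrib_left[symmetric])
  finally have "cmod (kloosterman \<psi> a n) \<le> (\<Sum>j\<in>UNIV. cmod (of_real (real (N j) - B) * \<psi> j))"
    by (simp only: norm_sum)
  also have "\<dots> = (\<Sum>j\<in>UNIV. B - real (N j))"
  proof (rule sum.cong[OF refl])
    fix j
    show "cmod (of_real (real (N j) - B) * \<psi> j) = B - real (N j)"
      using NB[of j] by (simp only: norm_mult norm_of_real norm_additive_character[OF \<psi>]) simp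
  qed
  also have "\<dots> = q * B - (real Q - 1)" by (simp add: sum_subtractf sumN q_def)
  also have "q * B = real (Q + R * (34 * q + 8) + 2 * q)"
    using q0 by (simp only: B_def times_divide_eq_right) simp
  also have "real (Q + R * (34 * q + 8) + 2 * q) - (real Q - 1) = real (R * (34 * q + 8) + 2 * q + 1)"
    by simp
  also have "\<dots> \<le> real (R * (36 * q + 9))"
  proof -
    have "1 * (2 * q + 1) \<le> R * (2 * q + 1)" using q0 by (intro mult_right_mono) (simp_all add: R_def)
    then have "R * (34 * q + 8) + 2 * q + 1 \<le> R * (36 * q + 9)" by (simp add: algebra_simps)
    then show ?thesis by (simp only: of_nat_le_iff)
  qed
  finally show ?thesis by (simp add: q_def R_def)
qed

text \<open>The polynomial X^2 - u X + v has roots in the extension of degree \<open>n\<close> or a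
  conjugate pair in that of degree \<open>2 * n\<close>. Distinct roots of either kind are counted
  twice on their own side. A double root is counted once on each side, as the pair of it with itself
  and as an element that is its own conjugate.\<close>

lemma card_quadratic_splittings:
  fixes u v :: "'a::{field,finite} alg_closure"
  assumes u: "u \<in> extension_field n" and v: "v \<in> extension_field n" "v \<noteq> 0"
  defines "Q \<equiv> CARD('a) ^ n"
  shows "card {p \<in> (extension_field n - {0}) \<times> (extension_field n - {0}). (fst p + snd p, fst p * snd p) = (u, v)}
    + card {z \<in> extension_field (2 * n) - {0}. (z + z ^ Q, z * z ^ Q) = (u, v)} = 2"
    (is "card ?S + card ?T = 2")
proof -
  obtain r1 where "poly [:v, - u, 1:] r1 = 0" using alg_closed_imp_poly_has_root[of "[:v, - u, 1:]"] by auto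
  then have r1: "v + r1 * (r1 - u) = 0" by simp
  define r2 where "r2 = u - r1"
  have r: "r1 + r2 = u" "r1 * r2 = v" using r1 by (simp_all add: r2_def algebra_simps)
  have r0: "r1 \<noteq> 0" "r2 \<noteq> 0" using r(2) v(2) by auto
  have key: "x + y = u \<and> x * y = v \<longleftrightarrow> (x = r1 \<and> y = r2) \<or> (x = r2 \<and> y = r1)" for x y
  proof
    assume xy: "x + y = u \<and> x * y = v"
    have y: "y = r1 + r2 - x" using xy r by (simp add: algebra_simps)
    have "(x - r1) * (x - r2) = r1 * r2 - x * y" by (simp add: y algebra_simps)
    then have "x = r1 \<or> x = r2" using xy r by simp
    then show "(x = r1 \<and> y = r2) \<or> (x = r2 \<and> y = r1)" using y by auto
  qed (use r in \<open>auto simp: add.commute mult.commute\<close>)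
  have frob: "x + y = u \<Longrightarrow> x ^ Q + y ^ Q = u" "x * y = v \<Longrightarrow> x ^ Q * y ^ Q = v" for x y
    using frobenius_alg_closure[of x y n] u v
    by (auto simp: extension_field_def Q_def power_mult_distrib)
  have ext: "x \<in> extension_field n \<longleftrightarrow> x ^ Q = x" "x \<in> extension_field (2 * n) \<longleftrightarrow> (x ^ Q) ^ Q = x"
    for x :: "'a alg_closure"
    by (simp_all add: extension_field_def Q_def mult_2 power_add power_mult)
  have "(r1 ^ Q = r1 \<and> r2 ^ Q = r2) \<or> (r1 ^ Q = r2 \<and> r2 ^ Q = r1)"
    using key frob r by metis
  then consider "r1 ^ Q = r1" "r2 ^ Q = r2" | "r1 ^ Q = r2" "r2 ^ Q = r1" "r1 \<noteq> r2" by metis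
  then show ?thesis
  proof cases
    case 1
    have "?S = {(r1, r2), (r2, r1)}" using 1 r0 r by (auto simp: key ext)
    moreover have "?T = (if r1 = r2 then {r1} else {})" using 1 r0 r by (auto simp: key ext)
    ultimately show ?thesis by auto
  next
    case 2
    have "?S = {}" using 2 by (auto simp: key ext)
    then have "card ?S = 0" by (simp only: card.empty)
    moreover have "?T = {r1, r2}" using 2 r0 r by (auto simp: key ext)
    then have "card ?T = 2" using 2(3) by (simp only: card_2_iff) blast
    ultimately show ?thesis by linarith
  qed
qed

text \<open>The point is that the right side depends only on the sum and the product of
  \<open>x\<close> and \<open>y\<close>.\<close>

lemma add_frac_eq_common:
  fixes x y a :: "'b::field"
  assumes "x \<noteq> 0" "y \<noteq> 0"
  shows "(x + a / x) + (y + a / y) = (x + y) + a * (x + y) / (x * y)"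
proof -
  have "a * (x + y) / (x * y) = a / x + a / y"
    using assms by (simp add: distrib_left add_divide_distrib)
  then show ?thesis by simp
qed

lemma kloosterman_double:
  fixes \<psi> :: "'a::{field,finite} \<Rightarrow> complex"
  assumes \<psi>: "additive_character \<psi>" and a: "a \<in> extension_field 1" "a \<noteq> 0" and n: "0 < n"
  shows "kloosterman \<psi> a (2 * n) = 2 * of_nat (CARD('a) ^ n) - (kloosterman \<psi> a n)\<^sup>2"
proof -
  define Q where "Q = CARD('a) ^ n"
  define F F0 G where "F = (extension_field n :: 'a alg_closure set)" and "F0 = F - {0}"
    and "G = (extension_field (2 * n) - {0} :: 'a alg_closure set)"
  have fin: "finite F" "finite F0" "finite G"
    using card_extension_field[OF n, where ?'a = 'a] card_extension_field[of "2 * n", where ?'a = 'a] n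
    by (simp_all add: F_def F0_def G_def)
  have aF: "a \<in> F" using a extension_field_1_subset by (auto simp: F_def)
  then have aQ: "a ^ Q = a" by (simp add: F_def extension_field_def Q_def)
  have closed: "x \<in> F \<Longrightarrow> y \<in> F \<Longrightarrow> x + y \<in> F" "x \<in> F \<Longrightarrow> y \<in> F \<Longrightarrow> x * y \<in> F"
    "x \<in> F \<Longrightarrow> y \<in> F \<Longrightarrow> x / y \<in> F" for x y
    by (auto simp: F_def intro: extension_field_closed)
  define \<Psi> where "\<Psi> x = \<psi> (field_trace n x)" for x
  have \<Psi>_add: "\<Psi> (x + y) = \<Psi> x * \<Psi> y" if "x \<in> F" "y \<in> F" for x y
    using that by (simp add: \<Psi>_def field_trace_add F_def additive_character_add[OF \<psi>])
  define h where "h w = \<Psi> (fst w + a * fst w / snd w)" for w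
  define g where "g p = (fst p + snd p, fst p * snd p)" for p :: "'a alg_closure \<times> 'a alg_closure"
  define g' where "g' z = (z + z ^ Q, z * z ^ Q)" for z :: "'a alg_closure"
  have "(kloosterman \<psi> a n)\<^sup>2 = (\<Sum>p\<in>F0 \<times> F0. \<Psi> (fst p + a / fst p) * \<Psi> (snd p + a / snd p))"
    by (simp add: kloosterman_def power2_eq_square sum_product sum.cartesian_product split_def
        F0_def F_def \<Psi>_def)
  also have "\<dots> = (\<Sum>p\<in>F0 \<times> F0. h (g p))"
  proof (rule sum.cong[OF refl])
    fix p assume "p \<in> F0 \<times> F0"
    then have p: "fst p \<in> F" "snd p \<in> F" "fst p \<noteq> 0" "snd p \<noteq> 0" by (auto simp: F0_def)
    then have "\<Psi> (fst p + a / fst p) * \<Psi> (snd p + a / snd p) = \<Psi> ((fst p + a / fst p) + (snd p + a / snd p))"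
      using aF by (intro \<Psi>_add[symmetric] closed)
    also have "(fst p + a / fst p) + (snd p + a / snd p) = fst (g p) + a * fst (g p) / snd (g p)"
      using add_frac_eq_common[OF p(3,4)] by (simp add: g_def)
    finally show "\<Psi> (fst p + a / fst p) * \<Psi> (snd p + a / snd p) = h (g p)" by (simp add: h_def)
  qed
  also have "\<dots> = (\<Sum>w\<in>F \<times> F0. \<Sum>p\<in>{p \<in> F0 \<times> F0. g p = w}. h (g p))"
    by (rule sum.group[symmetric]) (use fin closed in \<open>auto simp: g_def F0_def\<close>)
  finally have sq: "(kloosterman \<psi> a n)\<^sup>2 = (\<Sum>w\<in>F \<times> F0. of_nat (card {p \<in> F0 \<times> F0. g p = w}) * h w)"
    by simp
  have zF: "z + z ^ Q \<in> F" "z * z ^ Q \<in> F" if "z \<in> G" for z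
  proof -
    have "(z ^ Q) ^ Q = z" using that by (simp add: G_def extension_field_def Q_def mult_2 power_add power_mult)
    then show "z + z ^ Q \<in> F" "z * z ^ Q \<in> F"
      using frobenius_alg_closure[of z "z ^ Q" n]
      by (simp_all add: F_def extension_field_def Q_def power_mult_distrib add.commute mult.commute)
  qed
  have "kloosterman \<psi> a (2 * n) = (\<Sum>z\<in>G. h (g' z))"
    unfolding kloosterman_def G_def[symmetric]
  proof (rule sum.cong[OF refl])
    fix z assume z: "z \<in> G"
    then have z0: "z \<noteq> 0" by (simp add: G_def)
    \<comment> \<open>Because \<open>a\<close> is fixed by Frobenius, the conjugate of
      \<open>z + a / z\<close> has the same shape at \<open>z ^ Q\<close>. The relative trace is
      therefore the same function \<open>h\<close> of sum and product that occurs in the square of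
      the smaller sum.\<close>
    have "(z + a / z) + (z + a / z) ^ Q = (z + a / z) + (z ^ Q + a / z ^ Q)"
      using frobenius_alg_closure[of z "a / z" n] by (simp add: Q_def[symmetric] power_divide aQ)
    also have "\<dots> = fst (g' z) + a * fst (g' z) / snd (g' z)"
      using add_frac_eq_common[of z "z ^ Q" a] z0 by (simp add: g'_def)
    finally show "\<psi> (field_trace (2 * n) (z + a / z)) = h (g' z)"
      by (simp add: field_trace_def trace_sum_double h_def \<Psi>_def Q_def)
  qed
  also have "\<dots> = (\<Sum>w\<in>F \<times> F0. \<Sum>z\<in>{z \<in> G. g' z = w}. h (g' z))"
    by (rule sum.group[symmetric]) (use fin zF in \<open>auto simp: g'_def F0_def G_def\<close>)
  finally have "kloosterman \<psi> a (2 * n) = (\<Sum>w\<in>F \<times> F0. of_nat (card {z \<in> G. g' z = w}) * h w)"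
    by simp
  then have "(kloosterman \<psi> a n)\<^sup>2 + kloosterman \<psi> a (2 * n) =
      (\<Sum>w\<in>F \<times> F0. of_nat (card {p \<in> F0 \<times> F0. g p = w} + card {z \<in> G. g' z = w}) * h w)"
    by (simp add: sq distrib_right flip: sum.distrib)
  also have "\<dots> = (\<Sum>w\<in>F \<times> F0. 2 * h w)"
  proof (rule sum.cong[OF refl])
    fix w assume "w \<in> F \<times> F0"
    then obtain u v where w: "w = (u, v)" "u \<in> extension_field n" "v \<in> extension_field n" "v \<noteq> 0"
      by (auto simp: F0_def F_def)
    have "card {p \<in> F0 \<times> F0. g p = w} + card {z \<in> G. g' z = w} = 2"
      using card_quadratic_splittings[OF w(2-4)]
      by (simp only: w(1) F0_def F_def G_def g_def g'_def Q_def)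
    then show "of_nat (card {p \<in> F0 \<times> F0. g p = w} + card {z \<in> G. g' z = w}) * h w = 2 * h w" by simp
  qed
  also have "\<dots> = 2 * (\<Sum>v\<in>F0. \<Sum>u\<in>F. h (u, v))"
    by (simp add: sum_distrib_left[symmetric] sum.cartesian_product' sum.swap[of _ F F0])
  \<comment> \<open>For fixed product \<open>v\<close> the argument is linear in the sum
    \<open>u\<close>, with slope \<open>1 + a / v\<close>. Only the slope 0 survives the summation
    over \<open>u\<close>.\<close>
  also have "(\<Sum>v\<in>F0. \<Sum>u\<in>F. h (u, v)) = (\<Sum>v\<in>F0. if v = - a then of_nat Q else 0)"
  proof (rule sum.cong[OF refl])
    fix v assume v: "v \<in> F0"
    then have v0: "v \<noteq> 0" "v \<in> F" by (auto simp: F0_def)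
    define c where "c = 1 + a / v"
    have "1 \<in> F" by (simp add: F_def extension_field_def)
    then have cF: "c \<in> F" using v0 aF by (auto simp: c_def intro!: closed)
    have h: "h (u, v) = \<Psi> (u * c)" for u by (simp add: h_def c_def algebra_simps)
    show "(\<Sum>u\<in>F. h (u, v)) = (if v = - a then of_nat Q else 0)"
    proof (cases "v = - a")
      case True
      then have "c = 0" using a(2) by (simp add: c_def)
      have "\<Psi> 0 * \<Psi> 0 = \<Psi> 0" using \<Psi>_add[of 0 0] by (simp add: F_def)
      moreover have "\<Psi> 0 \<noteq> 0" using norm_additive_character[OF \<psi>] by (metis \<Psi>_def norm_zero zero_neq_one)
      ultimately have "\<Psi> 0 = 1" by simp
      moreover have "card F = Q" using card_extension_field[OF n, where ?'a = 'a] by (simp add: F_def Q_def)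
      ultimately have "(\<Sum>u\<in>F. h (u, v)) = of_nat Q" by (simp add: h \<open>c = 0\<close>)
      then show ?thesis using True by simp
    next
      case False
      have c0: "c \<noteq> 0" using False v0 by (auto simp: c_def field_simps add_eq_0_iff)
      obtain j where "\<psi> j \<noteq> 1" using \<psi> by (auto simp: additive_character_def)
      moreover obtain u where "u \<in> F" "field_trace n u = j"
        using field_trace_surj[OF n, of j] by (auto simp: F_def)
      ultimately have "\<Psi> ((u / c) * c) \<noteq> 1" "u / c \<in> F" using c0 cF closed by (simp_all add: \<Psi>_def)
      then have "(\<Sum>u\<in>F. \<Psi> (u * c)) = 0"
        by (intro sum_multiplicative_eq_0[of F _ "u / c"])
           (use fin closed cF \<Psi>_add in \<open>auto simp: distrib_right\<close>)
      then show ?thesis using False by (simp add: h)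
    qed
  qed
  also have "\<dots> = of_nat Q"
  proof -
    have "- a \<in> F" using extension_field_closed(2)[of 0 n a] aF by (simp add: F_def)
    then have "- a \<in> F0" using a by (simp add: F0_def)
    then show ?thesis using fin by (simp add: sum.delta)
  qed
  finally show ?thesis by (simp add: Q_def algebra_simps)
qed

theorem kloosterman_bound:
  fixes \<psi> :: "'a::{field,finite} \<Rightarrow> complex"
  assumes odd: "odd CARD('a)" and \<psi>: "additive_character \<psi>"
    and a: "a \<in> extension_field 1" "a \<noteq> 0"
  shows "cmod (kloosterman \<psi> a 1) \<le> 2 * sqrt CARD('a)"
proof (rule ccontr)
  assume neg: "\<not> ?thesis"
  define q where "q = CARD('a)"
  have q0: "0 < q" by (simp add: q_def)
  define w where "w k = sqrt q ^ (2 ^ k)" for k :: nat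
  have w0: "0 < w k" for k using q0 by (simp add: w_def)
  \<comment> \<open>Normalised so that the claim becomes \<open>e 0 \<le> 2\<close>, where 2 is the
    repelling fixed point of e -> e^2 - 2.\<close>
  define e where "e k = cmod (kloosterman \<psi> a (2 ^ k)) / w k" for k
  have wSuc: "w (Suc k) = real (q ^ (2 ^ k))" "w (Suc k) = (w k)\<^sup>2" for k
  proof -
    show "w (Suc k) = real (q ^ (2 ^ k))" by (simp add: w_def power_mult)
    show "w (Suc k) = (w k)\<^sup>2" by (simp only: w_def power_Suc power_mult[symmetric] mult.commute)
  qed
  have step: "(e k)\<^sup>2 - 2 \<le> e (Suc k)" for k
  proof -
    define s where "s = kloosterman \<psi> a (2 ^ k)"
    have "kloosterman \<psi> a (2 ^ Suc k) = 2 * of_nat (q ^ (2 ^ k)) - s\<^sup>2"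
      using kloosterman_double[OF \<psi> a, of "2 ^ k"] by (simp add: s_def q_def)
    also have "cmod \<dots> \<ge> cmod (s\<^sup>2) - cmod (2 * of_nat (q ^ (2 ^ k)))"
      by (metis norm_minus_commute norm_triangle_ineq2)
    also have "cmod (2 * of_nat (q ^ (2 ^ k))) = 2 * w (Suc k)"
      by (simp only: norm_mult norm_of_nat wSuc(1)) simp
    finally have "(cmod s)\<^sup>2 - 2 * w (Suc k) \<le> cmod (kloosterman \<psi> a (2 ^ Suc k))"
      by (simp add: norm_power)
    then have "((cmod s)\<^sup>2 - 2 * w (Suc k)) / w (Suc k) \<le> e (Suc k)"
      unfolding e_def using w0[of "Suc k"] by (intro divide_right_mono) auto
    moreover have "((cmod s)\<^sup>2 - 2 * w (Suc k)) / w (Suc k) = (e k)\<^sup>2 - 2"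
      using w0[of "Suc k"] by (simp add: diff_divide_distrib e_def s_def power_divide wSuc(2))
    ultimately show ?thesis by simp
  qed
  define \<eta> where "\<eta> = e 0 - 2"
  have \<eta>: "0 < \<eta>"
    using neg w0[of 0] by (simp add: \<eta>_def e_def w_def q_def field_simps)
  \<comment> \<open>Linear growth is enough for a contradiction: (2 + x)^2 - 2 = 2 + 4x + x^2, which
    is at least 2 + x + \<eta> because x is at least \<eta>.\<close>
  have grow: "2 + real (Suc k) * \<eta> \<le> e k" for k
  proof (induction k)
    case 0
    then show ?case by (simp add: \<eta>_def)
  next
    case (Suc k)
    define x where "x = real (Suc k) * \<eta>"
    have x: "\<eta> \<le> x" "2 + x \<le> e k" using \<eta> Suc by (simp_all add: x_def algebra_simps)
    have "(2 + x)\<^sup>2 \<le> (e k)\<^sup>2" using x \<eta> by (intro power_mono) auto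
    moreover have "(2 + x)\<^sup>2 = 4 + 4 * x + x\<^sup>2" by (simp add: power2_eq_square algebra_simps)
    moreover have "0 \<le> x\<^sup>2" by simp
    ultimately have "2 + (x + \<eta>) \<le> e (Suc k)" using step[of k] x \<eta> by linarith
    then show ?case by (simp add: x_def algebra_simps)
  qed
  \<comment> \<open>From \<open>k = 2\<close> on, the degree \<open>2 ^ k\<close> is even and at
    least 4, as \<open>norm_kloosterman_le\<close> requires.\<close>
  have bound: "e k \<le> real (36 * q + 9)" if "2 \<le> k" for k
  proof -
    from that obtain j where k: "k = Suc j" by (cases k) auto
    have "(2::nat) ^ 2 \<le> 2 ^ k" using that by (intro power_increasing) auto
    then have "cmod (kloosterman \<psi> a (2 ^ k)) \<le> real (q ^ (2 ^ k div 2) * (36 * q + 9))"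
      using norm_kloosterman_le[OF odd \<psi> a, of "2 ^ k"] that by (simp add: q_def)
    also have "\<dots> = w k * real (36 * q + 9)" by (simp add: k wSuc(1))
    finally show ?thesis unfolding e_def using w0[of k] by (simp add: divide_le_eq mult.commute)
  qed
  obtain N :: nat where "real (36 * q + 9) < real N * \<eta>" using reals_Archimedean3[OF \<eta>] by blast
  moreover have "real N * \<eta> \<le> real (Suc (N + 2)) * \<eta>" using \<eta> by (intro mult_right_mono) auto
  ultimately show False using grow[of "N + 2"] bound[of "N + 2"] by linarith
qed

text \<open>Since \<open>a * x + b / x\<close> is \<open>a\<close> times
  \<open>x + (b / a) / x\<close>, the factor \<open>a\<close> can be absorbed into the character. In
  degree 1 the trace is the identity.\<close>

corollary norm_kloosterman_sum_le:
  fixes \<psi> :: "'a::{field,finite} \<Rightarrow> complex"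
  assumes odd: "odd CARD('a)" and \<psi>: "additive_character \<psi>" and ab: "a \<noteq> 0" "b \<noteq> 0"
  shows "cmod (\<Sum>x\<in>UNIV - {0}. \<psi> (a * x + b / x)) \<le> 2 * sqrt CARD('a)"
proof -
  define \<psi>' where "\<psi>' x = \<psi> (a * x)" for x
  have \<psi>': "additive_character \<psi>'" unfolding \<psi>'_def using \<psi> ab(1) by (rule additive_character_scale)
  have "extension_field 1 - {0} = to_ac ` (UNIV - {0 :: 'a})"
    using extension_field_1[where ?'a = 'a] by auto
  moreover have "field_trace 1 (to_ac x + to_ac (b / a) / to_ac x) = x + (b / a) / x" for x :: 'a
    by (simp add: field_trace_def trace_sum_def flip: to_ac_add to_ac_divide)
  ultimately have "kloosterman \<psi>' (to_ac (b / a)) 1 = (\<Sum>x\<in>UNIV - {0}. \<psi>' (x + (b / a) / x))"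
    unfolding kloosterman_def by (simp add: sum.reindex inj_on_def del: One_nat_def to_ac_divide)
  also have "\<dots> = (\<Sum>x\<in>UNIV - {0}. \<psi> (a * x + b / x))"
    using ab by (simp add: \<psi>'_def distrib_left)
  finally show ?thesis
    using kloosterman_bound[OF odd \<psi>', of "to_ac (b / a)"] ab extension_field_1[where ?'a = 'a]
    by (simp del: One_nat_def to_ac_divide)
qed

section \<open>Gauss and Salie sums\<close>

text \<open>The character is exp(2 pi i k / p) after the absolute trace. Trace values are fixed by
  the power \<open>p\<close>, so they are multiples of 1, because X^p - X has at most
  \<open>p\<close> roots. The trace is not identically 0, because as a polynomial it has degree
  below the size of the field.\<close>

lemma exists_additive_character:
  "\<exists>\<psi> :: 'a::{field,finite} \<Rightarrow> complex. additive_character \<psi>"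
proof -
  define p where "p = CHAR('a)"
  have p: "prime p" unfolding p_def by (rule prime_CHAR)
  have p2: "2 \<le> p" using p by (rule prime_ge_2_nat)
  have frob: "(x + y) ^ p ^ i = x ^ p ^ i + y ^ p ^ i" for x y :: 'a and i
    unfolding p_def by (rule freshmans_dream') (simp_all add: prime_CHAR)
  have frob1: "(x + y) ^ p = x ^ p + y ^ p" for x y :: 'a using frob[of x y 1] by simp
  obtain e where e: "CARD('a) = p ^ e" using card_prime_power[where ?'a = 'a] by (auto simp: p_def)
  have "2 \<le> CARD('a)" using card_mono[of UNIV "{0, 1 :: 'a}"] by simp
  then obtain e' where e': "e = Suc e'" using e by (cases e) auto
  define P where "P = {y :: 'a. y ^ p = y}"
  have P: "P \<subseteq> of_nat ` {..<p}"
  proof -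
    define h where "h = (monom 1 p + [:0, - 1:] :: 'a poly)"
    have deg: "degree h = p"
      unfolding h_def using p2 by (subst degree_add_eq_left) (auto simp: degree_monom_eq)
    have h0: "h \<noteq> 0" using deg p2 by auto
    have "{y. poly h y = 0} = P" by (auto simp: h_def P_def poly_monom)
    then have card: "card P \<le> p" "finite P"
      using card_poly_roots_bound[OF h0] poly_roots_finite[OF h0] deg by simp_all
    have "(of_nat k :: 'a) ^ p = of_nat k" for k
      using p2 by (induction k) (simp_all add: frob1 zero_power)
    then have sub: "of_nat ` {..<p} \<subseteq> P" by (auto simp: P_def)
    have "inj_on (of_nat :: nat \<Rightarrow> 'a) {..<p}"
      by (rule inj_onI) (simp add: of_nat_eq_iff_cong_CHAR cong_def p_def)
    then have "card (of_nat ` {..<p} :: 'a set) = p" by (simp add: card_image)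
    then have "of_nat ` {..<p} = P" using card sub by (intro card_seteq) auto
    then show ?thesis by simp
  qed
  define Tr where "Tr x = (\<Sum>i<e. x ^ p ^ i)" for x :: 'a
  have Tr_add: "Tr (x + y) = Tr x + Tr y" for x y by (simp add: Tr_def frob sum.distrib)
  have Tr_P: "Tr x \<in> P" for x
  proof -
    have pow: "(\<Sum>i\<in>A. g i) ^ p = (\<Sum>i\<in>A. g i ^ p)" for A and g :: "nat \<Rightarrow> 'a"
      using p2 by (induction A rule: infinite_finite_induct) (simp_all add: frob1 zero_power)
    have "Tr x ^ p = (\<Sum>i<e. x ^ p ^ Suc i)" unfolding Tr_def pow
      by (simp only: power_mult[symmetric] power_Suc2)
    also have "\<dots> + x = Tr x + x ^ p ^ e"
      using sum.lessThan_Suc_shift[of "\<lambda>i. x ^ p ^ i" e] by (simp add: Tr_def)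
    also have "x ^ p ^ e = x" using power_card_eq_self[of x] by (simp add: e)
    finally show ?thesis by (simp add: P_def)
  qed
  obtain x0 where x0: "Tr x0 \<noteq> 0"
  proof -
    define h where "h = (\<Sum>i<e. monom 1 (p ^ i) :: 'a poly)"
    have inj: "p ^ i = p ^ e' \<longleftrightarrow> i = e'" for i using p2 by (auto simp: power_inject_exp)
    have "poly.coeff h (p ^ e') = 1"
      by (simp add: h_def coeff_sum e' inj sum.delta' cong: if_cong)
    then have h0: "h \<noteq> 0" by auto
    have "degree h \<le> p ^ e'"
      unfolding h_def using p2
      by (intro degree_sum_le order.trans[OF degree_monom_le] power_increasing) (auto simp: e')
    also have "\<dots> < CARD('a)" using p2 by (simp add: e e')
    finally have "card {x. poly h x = 0} < CARD('a)"
      using card_poly_roots_bound[OF h0] by linarith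
    then have "{x. poly h x = 0} \<noteq> UNIV" by auto
    then obtain x where "poly h x \<noteq> 0" by blast
    then show ?thesis using that[of x] by (simp add: h_def Tr_def poly_sum poly_monom)
  qed
  \<comment> \<open>The representative is determined only modulo \<open>p\<close>, which the
    exponential does not notice.\<close>
  define ind where "ind x = (SOME k :: nat. of_nat k = Tr x)" for x
  have ind: "of_nat (ind x) = Tr x" for x
  proof -
    have "Tr x \<in> of_nat ` {..<p}" using P Tr_P[of x] by (rule subsetD)
    then have "\<exists>k. of_nat k = Tr x" by (auto intro: sym)
    then show ?thesis unfolding ind_def by (rule someI_ex)
  qed
  define \<psi> where "\<psi> x = exp (2 * of_real pi * \<i> * of_nat (ind x) / of_nat p)" for x
  have "\<psi> (x + y) = \<psi> x * \<psi> y" for x y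
  proof -
    have "of_nat (ind (x + y)) = (of_nat (ind x + ind y) :: 'a)" by (simp add: ind Tr_add)
    then have "ind (x + y) mod p = (ind x + ind y) mod p"
      by (simp only: of_nat_eq_iff_cong_CHAR cong_def p_def)
    then have "\<psi> (x + y) = exp (2 * of_real pi * \<i> * of_nat (ind x + ind y) / of_nat p)"
      unfolding \<psi>_def using p2 by (subst complex_root_unity_eq) auto
    then show ?thesis by (simp add: \<psi>_def add_divide_distrib distrib_left exp_add)
  qed
  moreover have "cmod (\<psi> x) = 1" for x by (simp add: \<psi>_def norm_exp_eq_Re)
  moreover have "\<psi> x0 \<noteq> 1"
  proof -
    have "\<not> p dvd ind x0" using x0 by (simp add: ind[symmetric] of_nat_eq_0_iff_char_dvd p_def)
    then show ?thesis unfolding \<psi>_def using p2 by (subst complex_root_unity_eq_1) auto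
  qed
  ultimately show ?thesis unfolding additive_character_def by blast
qed

section \<open>Absolute values of quadratic Gauss sums\<close>

lemma additive_character_0: "additive_character \<psi> \<Longrightarrow> \<psi> 0 = 1"
proof -
  assume \<psi>: "additive_character \<psi>"
  have "\<psi> 0 * \<psi> 0 = \<psi> 0" using additive_character_add[OF \<psi>, of 0 0] by simp
  moreover have "\<psi> 0 \<noteq> 0" using norm_additive_character[OF \<psi>, of 0] by auto
  ultimately show ?thesis by simp
qed

lemma cnj_additive_character: "additive_character \<psi> \<Longrightarrow> cnj (\<psi> x) = \<psi> (- x)"
proof -
  assume \<psi>: "additive_character \<psi>"
  have "\<psi> x * \<psi> (- x) = 1"
    using additive_character_add[OF \<psi>, of x "- x"] by (simp add: additive_character_0[OF \<psi>])
  moreover have "\<psi> x * cnj (\<psi> x) = 1"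
    using complex_norm_square[of "\<psi> x"] by (simp add: norm_additive_character[OF \<psi>])
  moreover have "\<psi> x \<noteq> 0" using norm_additive_character[OF \<psi>, of x] by auto
  ultimately show ?thesis by (metis mult_cancel_left)
qed

lemma sum_additive_character_scale:
  "additive_character \<psi> \<Longrightarrow> (\<Sum>x\<in>UNIV. \<psi> (c * x)) = (if c = 0 then of_nat CARD('a) else 0)"
  for c :: "'a::{field,finite}"
  using sum_additive_character[OF additive_character_scale[of \<psi> c]]
  by (simp add: additive_character_0)

text \<open>After expanding the square and writing y = x + h, the terms quadratic in x cancel, and
  the sum over x of what is left vanishes unless h = 0. The domain is a general finite group so that
  both \<open>t\<^sup>2\<close> on the field and \<open>s * Q\<close> on the vector space are
  covered.\<close>

lemma norm_gauss_sum:
  fixes \<psi> :: "'a::{field,finite} \<Rightarrow> complex" and Q :: "'m::{ab_group_add,finite} \<Rightarrow> 'a"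
  assumes \<psi>: "additive_character \<psi>"
    and Q: "\<And>x h. Q (x + h) = Q x + Q h + B h x" "Q 0 = 0" "\<And>x. B 0 x = 0"
    and B: "\<And>h. h \<noteq> 0 \<Longrightarrow> (\<Sum>x\<in>UNIV. \<psi> (B h x)) = 0"
  shows "(cmod (\<Sum>x\<in>UNIV. \<psi> (Q x)))\<^sup>2 = real CARD('m)"
proof -
  have "of_real ((cmod (\<Sum>x\<in>UNIV. \<psi> (Q x)))\<^sup>2) = (\<Sum>y\<in>UNIV. \<psi> (Q y)) * cnj (\<Sum>x\<in>UNIV. \<psi> (Q x))"
    by (rule complex_norm_square)
  also have "cnj (\<Sum>x\<in>UNIV. \<psi> (Q x)) = (\<Sum>x\<in>UNIV. \<psi> (- Q x))"
    by (simp only: cnj_sum cnj_additive_character[OF \<psi>])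
  also have "(\<Sum>y\<in>UNIV. \<psi> (Q y)) * \<dots> = (\<Sum>x\<in>UNIV. \<Sum>y\<in>UNIV. \<psi> (Q y) * \<psi> (- Q x))"
    unfolding sum_product by (rule sum.swap)
  also have "\<dots> = (\<Sum>x\<in>UNIV. \<Sum>h\<in>UNIV. \<psi> (Q (x + h)) * \<psi> (- Q x))"
  proof (rule sum.cong[OF refl])
    fix x
    show "(\<Sum>y\<in>UNIV. \<psi> (Q y) * \<psi> (- Q x)) = (\<Sum>h\<in>UNIV. \<psi> (Q (x + h)) * \<psi> (- Q x))"
      by (rule sum.reindex_bij_witness[of _ "\<lambda>h. x + h" "\<lambda>y. y - x"]) auto
  qed
  also have "\<dots> = (\<Sum>x\<in>UNIV. \<Sum>h\<in>UNIV. \<psi> (Q h) * \<psi> (B h x))"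
    by (simp add: Q(1) additive_character_add[OF \<psi>, symmetric])
  also have "\<dots> = (\<Sum>h\<in>UNIV. \<psi> (Q h) * (\<Sum>x\<in>UNIV. \<psi> (B h x)))"
    by (subst sum.swap) (simp add: sum_distrib_left)
  also have "\<dots> = (\<Sum>(h::'m)\<in>UNIV. if h = 0 then of_nat CARD('m) else 0)"
    by (rule sum.cong) (auto simp: B Q additive_character_0[OF \<psi>])
  also have "\<dots> = of_real (real CARD('m))" by simp
  finally show ?thesis by (simp only: of_real_eq_iff)
qed

text \<open>The Legendre symbol, except that its value at 0 is 1 and not the customary 0; the sums
  formed with it run over nonzero arguments.\<close>

definition quadratic_character :: "'a::field \<Rightarrow> complex" where
  "quadratic_character s = (if \<exists>t. s = t\<^sup>2 then 1 else - 1)"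

lemma quadratic_character_eq:
  "\<exists>t. s = t\<^sup>2 \<Longrightarrow> quadratic_character s = 1"
  "\<nexists>t. s = t\<^sup>2 \<Longrightarrow> quadratic_character s = - 1"
  by (simp_all add: quadratic_character_def)

lemma norm_quadratic_character: "cmod (quadratic_character s) = 1"
  by (simp add: quadratic_character_def)

lemma two_neq_zero:
  assumes "odd CARD('a::{field,finite})"
  shows "(2 :: 'a) \<noteq> 0"
  using two_neq_zero_alg_closure[OF assms] by (metis to_ac_0 to_ac_numeral)

text \<open>Squaring is at most two-to-one, so the nonzero squares fill at least half of the nonzero
  elements. Their multiples by the nonsquare \<open>y\<close> are disjoint from them and just as
  many, so they make up the rest, and \<open>x\<close> is among them.\<close>

lemma nonsquare_mult_nonsquare:
  fixes x y :: "'a::{field,finite}"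
  assumes odd: "odd CARD('a)" and x: "\<nexists>t. x = t\<^sup>2" and y: "\<nexists>t. y = t\<^sup>2"
  shows "\<exists>t. x * y = t\<^sup>2"
proof -
  define S where "S = (\<lambda>t :: 'a. t\<^sup>2) ` (UNIV - {0})"
  have x0: "x \<noteq> 0" using x by (metis zero_power2)
  have y0: "y \<noteq> 0" using y by (metis zero_power2)
  have fib: "card {t \<in> UNIV - {0}. t\<^sup>2 = u} \<le> 2" for u :: 'a
  proof -
    have "{t \<in> UNIV - {0}. t\<^sup>2 = u} \<subseteq> {t. poly [:- u, 0, 1:] t = 0}"
      by (auto simp: power2_eq_square)
    then have "card {t \<in> UNIV - {0}. t\<^sup>2 = u} \<le> card {t. poly [:- u, 0, 1:] t = 0}"
      by (intro card_mono) auto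
    also have "\<dots> \<le> 2" using card_poly_roots_bound[of "[:- u, 0, 1:]"] by simp
    finally show ?thesis .
  qed
  have "CARD('a) - 1 = card (UNIV - {0 :: 'a})" by (simp add: card_Diff_singleton)
  also have "\<dots> = (\<Sum>u\<in>S. card {t \<in> UNIV - {0}. t\<^sup>2 = u})"
    using sum.group[of "UNIV - {0 :: 'a}" S "\<lambda>t. t\<^sup>2" "\<lambda>_. 1 :: nat"] by (simp add: S_def)
  also have "\<dots> \<le> (\<Sum>u\<in>S. 2)" by (rule sum_mono) (rule fib)
  finally have card: "CARD('a) - 1 \<le> 2 * card S" by simp
  have disj: "S \<inter> (\<lambda>u. y * u) ` S = {}"
  proof (rule ccontr)
    assume "S \<inter> (\<lambda>u. y * u) ` S \<noteq> {}"
    then obtain r t where "r\<^sup>2 = y * t\<^sup>2" "t \<noteq> 0" by (auto simp: S_def)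
    then have "y = (r / t)\<^sup>2" by (simp add: power_divide)
    then show False using y by blast
  qed
  have "card ((\<lambda>u. y * u) ` S) = card S" using y0 by (intro card_image) (auto simp: inj_on_def)
  then have "card (S \<union> (\<lambda>u. y * u) ` S) = 2 * card S" using disj by (subst card_Un_disjoint) auto
  then have "card (UNIV - {0 :: 'a}) \<le> card (S \<union> (\<lambda>u. y * u) ` S)"
    using card by (simp add: card_Diff_singleton)
  moreover have "S \<union> (\<lambda>u. y * u) ` S \<subseteq> UNIV - {0}" using y0 by (auto simp: S_def)
  ultimately have "S \<union> (\<lambda>u. y * u) ` S = UNIV - {0}" by (intro card_seteq) auto
  then have "x \<in> S \<union> (\<lambda>u. y * u) ` S" using x0 by blast
  then obtain t where "x = y * t\<^sup>2" using x by (auto simp: S_def)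
  then have "x * y = (y * t)\<^sup>2" by (simp add: power2_eq_square)
  then show ?thesis by blast
qed

lemma quadratic_character_mult:
  fixes x y :: "'a::{field,finite}"
  assumes odd: "odd CARD('a)" and "x \<noteq> 0" "y \<noteq> 0"
  shows "quadratic_character (x * y) = quadratic_character x * quadratic_character y"
proof -
  have sq: "(\<exists>t. x * y = t\<^sup>2) \<longleftrightarrow> (\<exists>t. y = t\<^sup>2)" if "\<exists>t. x = t\<^sup>2" "x \<noteq> 0" for x y :: 'a
  proof -
    from that obtain r where r: "x = r\<^sup>2" "r \<noteq> 0" by auto
    have "y = (t / r)\<^sup>2" if "x * y = t\<^sup>2" for t using that r by (simp add: power_divide field_simps)
    moreover have "x * t\<^sup>2 = (r * t)\<^sup>2" for t by (simp add: r power_mult_distrib)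
    ultimately show ?thesis by metis
  qed
  consider "\<exists>t. x = t\<^sup>2" | "\<exists>t. y = t\<^sup>2" | "\<nexists>t. x = t\<^sup>2" "\<nexists>t. y = t\<^sup>2" by blast
  then show ?thesis
  proof cases
    case 1
    then show ?thesis using sq[of x y] assms by (simp add: quadratic_character_def)
  next
    case 2
    then show ?thesis using sq[of y x] assms by (simp add: quadratic_character_def mult.commute)
  next
    case 3
    then show ?thesis using nonsquare_mult_nonsquare[OF odd 3] by (simp add: quadratic_character_def)
  qed
qed

text \<open>The sum depends only on the square class of \<open>s\<close>. For nonsquare
  \<open>s\<close>, the elements x and s x always represent both classes, so averaging over x shows
  that the two class values are opposite as soon as the total over nonzero x is 0.\<close>

lemma sum_square_character:
  fixes \<psi> :: "'a::{field,finite} \<Rightarrow> complex"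
  assumes odd: "odd CARD('a)" and \<psi>: "additive_character \<psi>" and "s \<noteq> 0"
  shows "(\<Sum>t\<in>UNIV. \<psi> (s * t\<^sup>2)) = quadratic_character s * (\<Sum>t\<in>UNIV. \<psi> (t\<^sup>2))"
proof -
  define g where "g s = (\<Sum>t\<in>UNIV. \<psi> (s * t\<^sup>2))" for s
  have scale: "g (x * r\<^sup>2) = g x" if "r \<noteq> 0" for x r
    unfolding g_def
    by (rule sum.reindex_bij_witness[of _ "\<lambda>t. t / r" "\<lambda>t. r * t"])
       (use that in \<open>auto simp: power_mult_distrib mult.assoc\<close>)
  show ?thesis
  proof (cases "\<exists>r. s = r\<^sup>2")
    case True
    then obtain r where r: "s = r\<^sup>2" by blast
    then have "r \<noteq> 0" using assms(3) by auto
    then have "g s = g 1" using scale[of r 1] r by simp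
    then show ?thesis using True by (simp add: g_def quadratic_character_eq)
  next
    case False
    define C where "C = complex_of_nat (card (UNIV - {0 :: 'a}))"
    have rat: "g x = (if \<exists>r. x = r\<^sup>2 then g 1 else g s)" if x: "x \<noteq> 0" for x
    proof (cases "\<exists>r. x = r\<^sup>2")
      case True
      then obtain r where "x = r\<^sup>2" "r \<noteq> 0" using x by auto
      then show ?thesis using scale[of r 1] by auto
    next
      case ns: False
      then obtain t where t: "x * s = t\<^sup>2" using nonsquare_mult_nonsquare[OF odd] False by blast
      then have "x = s * (t / s)\<^sup>2" using assms(3) by (simp add: power2_eq_square field_simps)
      moreover have "t / s \<noteq> 0" using t x assms(3) by auto
      ultimately have "g x = g s" using scale by metis
      then show ?thesis using ns by simp
    qed
    have "g x + g (s * x) = g 1 + g s" if x: "x \<noteq> 0" for x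
    proof (cases "\<exists>r. x = r\<^sup>2")
      case True
      then obtain r where "x = r\<^sup>2" "r \<noteq> 0" using x by auto
      then show ?thesis using scale[of r 1] scale[of r s] by auto
    next
      case ns: False
      then obtain t where t: "x * s = t\<^sup>2" using nonsquare_mult_nonsquare[OF odd] False by blast
      then have "t \<noteq> 0" using x assms(3) by auto
      then have "g (s * x) = g 1" using scale[of t 1] t by (simp add: mult.commute)
      then show ?thesis using rat[OF x] ns by simp
    qed
    then have "(\<Sum>x\<in>UNIV - {0}. g x + g (s * x)) = C * (g 1 + g s)" by (simp add: C_def)
    moreover have "(\<Sum>x\<in>UNIV - {0}. g (s * x)) = (\<Sum>x\<in>UNIV - {0}. g x)"
      by (rule sum.reindex_bij_witness[of _ "\<lambda>x. x / s" "\<lambda>x. s * x"]) (use assms(3) in auto)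
    \<comment> \<open>Over all \<open>x\<close> only \<open>t = 0\<close> contributes, with the size
      of the field; this is exactly the omitted term \<open>g 0\<close>.\<close>
    moreover have "(\<Sum>x\<in>UNIV - {0}. g x) = 0"
    proof -
      have "(\<Sum>x\<in>UNIV. g x) = (\<Sum>t\<in>UNIV. \<Sum>x\<in>UNIV. \<psi> (t\<^sup>2 * x))"
        unfolding g_def by (subst sum.swap) (simp add: mult.commute)
      also have "\<dots> = (\<Sum>(t::'a)\<in>UNIV. if t = 0 then of_nat CARD('a) else 0)"
        by (simp add: sum_additive_character_scale[OF \<psi>])
      also have "\<dots> = of_nat CARD('a)" by simp
      finally show ?thesis
        by (simp add: sum_diff1 g_def additive_character_0[OF \<psi>])
    qed
    ultimately have "C * (g 1 + g s) = 0" by (simp add: sum.distrib)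
    moreover have "(1 :: 'a) \<in> UNIV - {0}" by simp
    then have "card (UNIV - {0 :: 'a}) \<noteq> 0" by (metis card_0_eq empty_iff finite)
    then have "C \<noteq> 0" by (simp only: C_def of_nat_eq_0_iff not_False_eq_True)
    ultimately have "g s = - g 1" by (simp add: add_eq_0_iff2)
    then show ?thesis using False by (simp add: g_def quadratic_character_eq)
  qed
qed

lemma norm_square_character_sum:
  fixes \<psi> :: "'a::{field,finite} \<Rightarrow> complex"
  assumes odd: "odd CARD('a)" and \<psi>: "additive_character \<psi>"
  shows "cmod (\<Sum>t\<in>UNIV. \<psi> (t\<^sup>2)) = sqrt CARD('a)"
proof -
  have "(cmod (\<Sum>t\<in>UNIV. \<psi> (t\<^sup>2)))\<^sup>2 = real CARD('a)"
    using two_neq_zero[OF odd]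
    by (intro norm_gauss_sum[OF \<psi>, where B = "\<lambda>h x. 2 * h * x"])
       (simp_all add: power2_sum sum_additive_character_scale[OF \<psi>])
  then show ?thesis by (metis norm_ge_zero real_sqrt_abs abs_of_nonneg)
qed

text \<open>Multiplying by the Gauss sum \<open>g\<close> trades the quadratic character for a sum
  of \<open>\<psi> (s * t\<^sup>2)\<close>. Replacing \<open>t\<close> by \<open>t - c / s\<close>
  then cancels the term in 1/s, and the exponent becomes linear in \<open>s\<close>. Summation over
  \<open>s\<close> singles out the at most two \<open>t\<close> with t^2 = -a.\<close>

lemma norm_salie_sum_square:
  fixes \<psi> :: "'a::{field,finite} \<Rightarrow> complex"
  assumes odd: "odd CARD('a)" and \<psi>: "additive_character \<psi>"
  shows "cmod (\<Sum>s\<in>UNIV - {0}. quadratic_character s * \<psi> (a * s - c\<^sup>2 / s)) \<le> 2 * sqrt CARD('a)"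
    (is "cmod ?T \<le> _")
proof -
  define q where "q = CARD('a)"
  have q0: "0 < q" by (simp add: q_def)
  define g where "g = (\<Sum>t\<in>UNIV. \<psi> (t\<^sup>2))"
  have g: "cmod g = sqrt q" unfolding g_def q_def by (rule norm_square_character_sum[OF odd \<psi>])
  define w where "w t = \<psi> (- (2 * c * t))" for t
  have "g * ?T = (\<Sum>s\<in>UNIV - {0}. \<Sum>t\<in>UNIV. w t * \<psi> ((t\<^sup>2 + a) * s))"
    unfolding sum_distrib_left
  proof (rule sum.cong[OF refl])
    fix s :: 'a assume "s \<in> UNIV - {0}"
    then have s: "s \<noteq> 0" by simp
    have "g * (quadratic_character s * \<psi> (a * s - c\<^sup>2 / s)) = (\<Sum>t\<in>UNIV. \<psi> (s * t\<^sup>2)) * \<psi> (a * s - c\<^sup>2 / s)"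
      by (simp add: sum_square_character[OF odd \<psi> s] g_def)
    also have "(\<Sum>t\<in>UNIV. \<psi> (s * t\<^sup>2)) = (\<Sum>t\<in>UNIV. \<psi> (s * (t - c / s)\<^sup>2))"
      by (rule sum.reindex_bij_witness[of _ "\<lambda>t. t - c / s" "\<lambda>t. t + c / s"]) auto
    also have "\<dots> * \<psi> (a * s - c\<^sup>2 / s) = (\<Sum>t\<in>UNIV. \<psi> (s * (t - c / s)\<^sup>2 + (a * s - c\<^sup>2 / s)))"
      by (simp add: sum_distrib_right additive_character_add[OF \<psi>])
    also have "\<dots> = (\<Sum>t\<in>UNIV. \<psi> (- (2 * c * t) + (t\<^sup>2 + a) * s))"
    proof (rule sum.cong[OF refl])
      fix t
      have "s * (t - c / s)\<^sup>2 + (a * s - c\<^sup>2 / s) = - (2 * c * t) + (t\<^sup>2 + a) * s"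
        using s by (simp add: power2_eq_square field_simps)
      then show "\<psi> (s * (t - c / s)\<^sup>2 + (a * s - c\<^sup>2 / s)) = \<psi> (- (2 * c * t) + (t\<^sup>2 + a) * s)" by simp
    qed
    also have "\<dots> = (\<Sum>t\<in>UNIV. \<psi> (- (2 * c * t)) * \<psi> ((t\<^sup>2 + a) * s))"
      by (simp only: additive_character_add[OF \<psi>])
    finally show "g * (quadratic_character s * \<psi> (a * s - c\<^sup>2 / s)) =
        (\<Sum>t\<in>UNIV. w t * \<psi> ((t\<^sup>2 + a) * s))" by (simp only: w_def)
  qed
  also have "\<dots> = (\<Sum>t\<in>UNIV. w t * (\<Sum>s\<in>UNIV - {0}. \<psi> ((t\<^sup>2 + a) * s)))"
    by (subst sum.swap) (simp add: sum_distrib_left)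
  \<comment> \<open>The excluded \<open>s = 0\<close> is responsible for the
    \<open>- w t\<close>.\<close>
  also have "\<dots> = (\<Sum>t\<in>UNIV. (if t\<^sup>2 = - a then of_nat q * w t else 0) - w t)"
  proof (rule sum.cong[OF refl])
    fix t
    have "(\<Sum>s\<in>UNIV - {0}. \<psi> ((t\<^sup>2 + a) * s)) = (if t\<^sup>2 = - a then of_nat q else 0) - 1"
      using sum_additive_character_scale[OF \<psi>, of "t\<^sup>2 + a"]
      by (simp add: sum_diff1 additive_character_0[OF \<psi>] q_def add_eq_0_iff2)
    then show "w t * (\<Sum>s\<in>UNIV - {0}. \<psi> ((t\<^sup>2 + a) * s)) =
        (if t\<^sup>2 = - a then of_nat q * w t else 0) - w t"
      by (simp only: right_diff_distrib mult_1_right) simp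
  qed
  also have "\<dots> = (\<Sum>t | t\<^sup>2 = - a. of_nat q * w t) - (if c = 0 then of_nat q else 0)"
    using sum_additive_character_scale[OF \<psi>, of "- 2 * c"] two_neq_zero[OF odd]
    by (simp add: sum_subtractf sum.If_cases w_def q_def)
  finally have gT: "g * ?T = (\<Sum>t | t\<^sup>2 = - a. of_nat q * w t) - (if c = 0 then of_nat q else 0)" .
  have card: "card {t. t\<^sup>2 = - a} \<le> 2"
    using card_poly_roots_bound[of "[:a, 0, 1:]"] by (simp add: power2_eq_square add_eq_0_iff add.commute)
  have "cmod (g * ?T) \<le> 2 * real q"
  proof (cases "c = 0")
    case True
    have "g * ?T = of_nat q * of_nat (card {t. t\<^sup>2 = - a}) - of_nat q"
      unfolding gT using True by (simp add: w_def additive_character_0[OF \<psi>])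
    also have "\<dots> = of_real ((real (card {t. t\<^sup>2 = - a}) - 1) * real q)" by (simp add: algebra_simps)
    finally have "cmod (g * ?T) = \<bar>(real (card {t. t\<^sup>2 = - a}) - 1) * real q\<bar>"
      by (simp only: norm_of_real)
    also have "\<dots> = \<bar>real (card {t. t\<^sup>2 = - a}) - 1\<bar> * real q" by (simp add: abs_mult)
    also have "\<dots> \<le> 2 * real q" using card by (intro mult_right_mono) auto
    finally show ?thesis .
  next
    case False
    have "cmod (g * ?T) \<le> (\<Sum>t | t\<^sup>2 = - a. cmod (of_nat q * w t))"
      unfolding gT using False by (simp add: norm_sum)
    also have "\<dots> = real (card {t. t\<^sup>2 = - a}) * real q"
      by (simp add: norm_mult w_def norm_additive_character[OF \<psi>])
    also have "\<dots> \<le> 2 * real q" using card by (intro mult_right_mono) auto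
    finally show ?thesis .
  qed
  also have "2 * real q = sqrt q * (2 * sqrt q)" by (simp only: mult.left_commute[of "sqrt q"]) simp
  finally have "sqrt q * cmod ?T \<le> sqrt q * (2 * sqrt q)" by (simp only: norm_mult g)
  then show ?thesis using q0 by (simp add: q_def)
qed

text \<open>Substituting \<open>- b * s\<close> for \<open>s\<close> turns \<open>b / s\<close> into
  \<open>- 1 / s\<close>, so the previous lemma with \<open>c = 1\<close> handles every nonzero
  \<open>b\<close>, square or not. The character value pulled out has absolute value 1.\<close>

lemma norm_salie_sum_le:
  fixes \<psi> :: "'a::{field,finite} \<Rightarrow> complex"
  assumes odd: "odd CARD('a)" and \<psi>: "additive_character \<psi>"
  shows "cmod (\<Sum>s\<in>UNIV - {0}. quadratic_character s * \<psi> (a * s + b / s)) \<le> 2 * sqrt CARD('a)"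
proof (cases "b = 0")
  case True
  then show ?thesis using norm_salie_sum_square[OF odd \<psi>, of a 0] by simp
next
  case False
  have "(\<Sum>s\<in>UNIV - {0}. quadratic_character s * \<psi> (a * s + b / s)) =
      (\<Sum>s\<in>UNIV - {0}. quadratic_character (- b) * (quadratic_character s * \<psi> ((- (a * b)) * s - 1\<^sup>2 / s)))"
    by (rule sum.reindex_bij_witness[of _ "\<lambda>s. - b * s" "\<lambda>s. s / (- b)"])
       (use False in \<open>auto simp: quadratic_character_mult[OF odd, symmetric] mult.assoc[symmetric]\<close>)
  then show ?thesis
    using norm_salie_sum_square[OF odd \<psi>, of "- (a * b)" 1]
    by (simp add: sum_distrib_left[symmetric] norm_mult norm_quadratic_character)
qed

section \<open>The second moment bound\<close>

text \<open>An abstract kernel is used because the identity serves both for characters of the field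
  and for \<open>\<psi> (B y z)\<close> on the vector space, the latter in either argument.\<close>

lemma plancherel:
  fixes k :: "'m::finite \<Rightarrow> 'n::finite \<Rightarrow> complex"
  assumes orth: "\<And>z z'. (\<Sum>y\<in>UNIV. k y z * cnj (k y z')) = (if z = z' then of_real C else 0)"
  shows "(\<Sum>y\<in>UNIV. (cmod (\<Sum>z\<in>UNIV. u z * k y z))\<^sup>2) = C * (\<Sum>z\<in>UNIV. (cmod (u z))\<^sup>2)"
proof -
  have "of_real (\<Sum>y\<in>UNIV. (cmod (\<Sum>z\<in>UNIV. u z * k y z))\<^sup>2)
      = (\<Sum>y\<in>UNIV. (\<Sum>z\<in>UNIV. u z * k y z) * (\<Sum>z'\<in>UNIV. cnj (u z' * k y z')))"
    by (simp only: of_real_sum complex_norm_square cnj_sum)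
  also have "\<dots> = (\<Sum>y\<in>UNIV. \<Sum>z\<in>UNIV. \<Sum>z'\<in>UNIV. (u z * cnj (u z')) * (k y z * cnj (k y z')))"
    by (simp add: sum_product mult_ac)
  also have "\<dots> = (\<Sum>z\<in>UNIV. \<Sum>z'\<in>UNIV. \<Sum>y\<in>UNIV. (u z * cnj (u z')) * (k y z * cnj (k y z')))"
    by (subst sum.swap, rule sum.cong[OF refl], subst sum.swap, rule refl)
  also have "\<dots> = (\<Sum>z\<in>UNIV. \<Sum>z'\<in>UNIV. (u z * cnj (u z')) * (if z = z' then of_real C else 0))"
    by (simp only: sum_distrib_left[symmetric] orth)
  also have "\<dots> = (\<Sum>z\<in>UNIV. (u z * cnj (u z)) * of_real C)"
    by (rule sum.cong[OF refl]) (simp add: if_distrib sum.delta cong: if_cong)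
  also have "\<dots> = of_real (C * (\<Sum>z\<in>UNIV. (cmod (u z))\<^sup>2))"
    by (simp add: complex_norm_square[symmetric] sum_distrib_left mult.commute)
  finally show ?thesis by (simp only: of_real_eq_iff)
qed

section \<open>Indicator functions and characters of bilinear forms\<close>

lemma sum_centered_indicator:
  fixes c :: complex
  shows "finite S \<Longrightarrow> (\<Sum>x\<in>S. c * of_bool (P x) - 1) = c * of_nat (card {x \<in> S. P x}) - of_nat (card S)"
  by (simp add: sum_subtractf sum_distrib_left[symmetric] sum_of_bool_eq Collect_conj_eq)

lemma sum_indicator_mult:
  fixes g :: "'m::finite \<Rightarrow> complex"
  shows "(\<Sum>x\<in>UNIV. of_bool (x \<in> S) * g x) = (\<Sum>x\<in>S. g x)"
  by (simp add: sum_of_bool_mult_eq)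

lemma sum_norm_indicator:
  "(\<Sum>x\<in>UNIV. (cmod (of_bool (x \<in> S)))\<^sup>2) = real (card S)" for S :: "'m::finite set"
proof -
  have "(cmod (of_bool b))\<^sup>2 = of_bool b" for b by simp
  then show ?thesis by (simp add: sum_of_bool_eq)
qed

lemma bilinear_form_simps:
  assumes "bilinear_form B"
  shows "B (x + x') y = B x y + B x' y" "B x (y + y') = B x y + B x y'"
    "B (c *s x) y = c * B x y" "B x (c *s y) = c * B x y" "B 0 y = 0" "B x 0 = 0"
proof -
  have 1: "Vector_Spaces.linear (*s) (*) (\<lambda>y. B x y)" for x
    using assms by (simp add: bilinear_form_def)
  have 2: "Vector_Spaces.linear (*s) (*) (\<lambda>x. B x y)" for y
    using assms by (simp add: bilinear_form_def)
  show left: "B (x + x') y = B x y + B x' y" "B (c *s x) y = c * B x y" for x x' y c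
    using 2 by (simp_all add: Vector_Spaces.linear_iff)
  show right: "B x (y + y') = B x y + B x y'" "B x (c *s y) = c * B x y" for x y y' c
    using 1 by (simp_all add: Vector_Spaces.linear_iff)
  show "B 0 y = 0" "B x 0 = 0" using left(2)[of 0 0 y] right(2)[of x 0 0] by simp_all
qed

lemma nondegenerate_bilinear_form_swap:
  "nondegenerate_bilinear_form B \<Longrightarrow> nondegenerate_bilinear_form (\<lambda>x y. B y x)"
  by (auto simp: nondegenerate_bilinear_form_def bilinear_form_def)

lemma sum_character_bilinear:
  fixes \<psi> :: "'a::{field,finite} \<Rightarrow> complex" and B :: "'a ^ 'd \<Rightarrow> 'a ^ 'd \<Rightarrow> 'a"
  assumes \<psi>: "additive_character \<psi>" and B: "nondegenerate_bilinear_form B"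
  shows "(\<Sum>y\<in>UNIV. \<psi> (B y z)) = (if z = 0 then of_nat CARD('a ^ 'd) else 0)"
proof -
  have lin: "bilinear_form B" using B by (simp add: nondegenerate_bilinear_form_def)
  note B_simps = bilinear_form_simps[OF lin]
  show ?thesis
  proof (cases "z = 0")
    case True
    then show ?thesis by (simp add: B_simps additive_character_0[OF \<psi>])
  next
    case False
    then obtain y where y: "B y z \<noteq> 0" using B by (auto simp: nondegenerate_bilinear_form_def)
    obtain j where j: "\<psi> j \<noteq> 1" using \<psi> by (auto simp: additive_character_def)
    have "B ((j / B y z) *s y) z = j" using y by (simp add: B_simps)
    then have "\<psi> (B ((j / B y z) *s y) z) \<noteq> 1" using j by simp
    then have "(\<Sum>y\<in>UNIV. \<psi> (B y z)) = 0"
      by (intro sum_multiplicative_eq_0[of UNIV _ "(j / B y z) *s y"])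
         (auto simp: B_simps additive_character_add[OF \<psi>])
    then show ?thesis using False by simp
  qed
qed

lemma sum_character_bilinear_orthogonal:
  fixes \<psi> :: "'a::{field,finite} \<Rightarrow> complex" and B :: "'a ^ 'd \<Rightarrow> 'a ^ 'd \<Rightarrow> 'a"
  assumes \<psi>: "additive_character \<psi>" and B: "nondegenerate_bilinear_form B"
  shows "(\<Sum>y\<in>UNIV. \<psi> (B y z) * cnj (\<psi> (B y z'))) = (if z = z' then of_real (real CARD('a ^ 'd)) else 0)"
proof -
  have lin: "bilinear_form B" using B by (simp add: nondegenerate_bilinear_form_def)
  note B_simps = bilinear_form_simps[OF lin]
  have "B y (z - z') = B y z + - B y z'" for y
    using B_simps(2)[of y "z - z'" z'] by (simp add: algebra_simps)
  then have "\<psi> (B y z) * cnj (\<psi> (B y z')) = \<psi> (B y (z - z'))" for y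
    by (simp only: cnj_additive_character[OF \<psi>] additive_character_add[OF \<psi>])
  then show ?thesis using sum_character_bilinear[OF \<psi> B, of "z - z'"] by simp
qed

text \<open>Omitting the trivial character \<open>s = 0\<close> from the expansion of the indicator
  amounts to subtracting its mean.\<close>

lemma indicator_minus_mean_eq:
  fixes \<psi> :: "'a::{field,finite} \<Rightarrow> complex"
  assumes \<psi>: "additive_character \<psi>"
  shows "of_nat CARD('a) * of_bool (r = l) - 1 = (\<Sum>s\<in>UNIV - {0}. \<psi> (s * (r - l)))"
  using sum_additive_character_scale[OF \<psi>, of "r - l"]
  by (simp add: sum_diff1 additive_character_0[OF \<psi>] mult.commute)

text \<open>
  The constant is \<open>16 = (2 + 2)\<^sup>2\<close>, from a Kloosterman and a Salie sum of size at most \<open>2 \<surd>q\<close> each.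
\<close>

definition distance_regular :: "('a::{field,finite} ^ 'd \<Rightarrow> 'a ^ 'd \<Rightarrow> 'a) \<Rightarrow> bool" where
  "distance_regular \<phi> \<longleftrightarrow> (\<forall>l S. l \<noteq> 0 \<longrightarrow>
    (\<Sum>y\<in>UNIV. (real (card {x \<in> S. \<phi> y x = l}) - real (card S) / real CARD('a))\<^sup>2)
      \<le> 16 * real CARD('a) ^ (CARD('d) - 1) * real (card S))"

lemma card_vec: "real CARD('a::finite ^ 'd) = real CARD('a) * real CARD('a) ^ (CARD('d) - 1)"
proof -
  have "real CARD('a ^ 'd) = real CARD('a) ^ Suc (CARD('d) - 1)" by simp
  then show ?thesis by (simp only: power_Suc)
qed

text \<open>Expanding the condition in characters produces \<open>\<psi> (B y (s *s x))\<close>, and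
  the points \<open>s *s x\<close> coincide for different pairs when \<open>S\<close> has several
  points on a line through the origin. A trivial bound on the resulting coefficients
  \<open>u z\<close> could lose a factor of order q. Averaging over dilations of \<open>z\<close>
  repairs this: along such an orbit, \<open>u\<close> is a Fourier transform over the field of the
  indicator of \<open>T z\<close>. Its frequencies are distinct because \<open>l\<close> is
  nonzero.\<close>

lemma distance_regular_bilinear:
  fixes B :: "'a::{field,finite} ^ 'd \<Rightarrow> 'a ^ 'd \<Rightarrow> 'a"
  assumes B: "nondegenerate_bilinear_form B"
  shows "distance_regular B"
  unfolding distance_regular_def
proof (intro allI impI)
  fix l :: 'a and S :: "('a ^ 'd) set"
  assume l: "l \<noteq> 0"
  obtain \<psi> :: "'a \<Rightarrow> complex" where \<psi>: "additive_character \<psi>" using exists_additive_character by blast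
  have lin: "bilinear_form B" using B by (simp add: nondegenerate_bilinear_form_def)
  note B_simps = bilinear_form_simps[OF lin]
  define q where "q = CARD('a)"
  have q1: "1 < q" using card_mono[of UNIV "{0, 1 :: 'a}"] by (simp add: q_def)
  define F where "F = UNIV - {0 :: 'a}"
  have F: "finite F" "card F = q - 1" by (simp_all add: F_def q_def card_Diff_singleton)
  define T where "T z = {s \<in> F. z \<in> (\<lambda>x. s *s x) ` S}" for z :: "'a ^ 'd"
  define u where "u z = (\<Sum>s\<in>T z. \<psi> (s * (- l)))" for z
  have pairs: "(\<Sum>s\<in>F. \<Sum>x\<in>S. h s (s *s x)) = (\<Sum>z\<in>UNIV. \<Sum>s\<in>T z. h s z)" for h :: "'a \<Rightarrow> 'a ^ 'd \<Rightarrow> 'z::comm_monoid_add"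
  proof -
    have "(\<Sum>s\<in>F. \<Sum>x\<in>S. h s (s *s x)) = (\<Sum>s\<in>F. \<Sum>z\<in>(\<lambda>x. s *s x) ` S. h s z)"
    proof (rule sum.cong[OF refl])
      fix s assume "s \<in> F"
      then have "inj_on (\<lambda>x. s *s x) S" by (auto simp: F_def inj_on_def)
      then show "(\<Sum>x\<in>S. h s (s *s x)) = (\<Sum>z\<in>(\<lambda>x. s *s x) ` S. h s z)"
        by (simp add: sum.reindex)
    qed
    also have "\<dots> = (\<Sum>z\<in>UNIV. \<Sum>s\<in>T z. h s z)"
      unfolding T_def by (subst sum.swap_restrict[symmetric]) (auto simp: F intro!: sum.cong)
    finally show ?thesis .
  qed
  define W where "W y = real (card {x \<in> S. B y x = l}) - real (card S) / real q" for y
  have W: "of_nat q * of_real (W y) = (\<Sum>z\<in>UNIV. u z * \<psi> (B y z))" for y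
  proof -
    have "of_nat q * of_real (W y) = (\<Sum>x\<in>S. of_nat q * of_bool (B y x = l) - 1 :: complex)"
      using q1 by (simp add: sum_centered_indicator W_def right_diff_distrib)
    also have "\<dots> = (\<Sum>x\<in>S. \<Sum>s\<in>F. \<psi> (s * (- l)) * \<psi> (B y (s *s x)))"
      unfolding q_def indicator_minus_mean_eq[OF \<psi>] F_def
      by (simp add: additive_character_add[OF \<psi>, symmetric] B_simps algebra_simps)
    also have "\<dots> = (\<Sum>z\<in>UNIV. \<Sum>s\<in>T z. \<psi> (s * (- l)) * \<psi> (B y z))"
      by (subst sum.swap) (rule pairs)
    finally show ?thesis by (simp add: u_def sum_distrib_right)
  qed
  have scale: "(\<Sum>z\<in>UNIV. (cmod (u (r *s z)))\<^sup>2) = (\<Sum>z\<in>UNIV. (cmod (u z))\<^sup>2)" if "r \<in> F" for r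
    by (rule sum.reindex_bij_witness[of _ "\<lambda>z. (1 / r) *s z" "\<lambda>z. r *s z"]) (use that in \<open>auto simp: F_def\<close>)
  have u_scale: "u (r *s z) = (\<Sum>s\<in>T z. \<psi> (r * ((- l) * s)))" if "r \<in> F" for r z
    unfolding u_def
  proof (rule sum.reindex_bij_witness[of _ "\<lambda>s. r * s" "\<lambda>s. s / r"])
    have r0: "r \<noteq> 0" using that by (simp add: F_def)
    fix s
    show "r * (s / r) = s" "r * s / r = s" "\<psi> (r * (- l * (s / r))) = \<psi> (s * - l)" using r0 by (simp_all add: mult.commute)
    show "s / r \<in> T z" if "s \<in> T (r *s z)"
    proof -
      from that obtain x where x: "s \<in> F" "r *s z = s *s x" "x \<in> S" by (auto simp: T_def)
      have "z = (1 / r) *s (r *s z)" using r0 by simp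
      also have "\<dots> = (s / r) *s x" by (simp add: x(2))
      finally show ?thesis using x r0 by (auto simp: T_def F_def)
    qed
    show "r * s \<in> T (r *s z)" if "s \<in> T z"
    proof -
      from that obtain x where x: "s \<in> F" "z = s *s x" "x \<in> S" by (auto simp: T_def)
      have "r *s z = (r * s) *s x" by (simp add: x(2))
      then show ?thesis using x r0 by (auto simp: T_def F_def)
    qed
  qed
  have orbit: "(\<Sum>r\<in>F. (cmod (u (r *s z)))\<^sup>2) \<le> real q * real (card (T z))" for z
  proof -
    have orth: "(\<Sum>r\<in>UNIV. \<psi> (r * ((- l) * s)) * cnj (\<psi> (r * ((- l) * s')))) = (if s = s' then of_real (real q) else 0)"
      for s s'
    proof -
      have "\<psi> (r * ((- l) * s)) * cnj (\<psi> (r * ((- l) * s'))) = \<psi> (((- l) * (s - s')) * r)" for r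
        by (simp add: cnj_additive_character[OF \<psi>] additive_character_add[OF \<psi>, symmetric] algebra_simps)
      then show ?thesis using sum_additive_character_scale[OF \<psi>, of "(- l) * (s - s')"] l by (simp add: q_def)
    qed
    have "(\<Sum>r\<in>F. (cmod (u (r *s z)))\<^sup>2) = (\<Sum>r\<in>F. (cmod (\<Sum>s\<in>T z. \<psi> (r * ((- l) * s))))\<^sup>2)"
      by (intro sum.cong refl) (simp only: u_scale)
    \<comment> \<open>Admitting \<open>r = 0\<close> adds a nonnegative term and makes the
      characters orthogonal.\<close>
    also have "\<dots> \<le> (\<Sum>r\<in>UNIV. (cmod (\<Sum>s\<in>T z. \<psi> (r * ((- l) * s))))\<^sup>2)"
      by (rule sum_mono2) auto
    also have "\<dots> = (\<Sum>r\<in>UNIV. (cmod (\<Sum>s\<in>UNIV. of_bool (s \<in> T z) * \<psi> (r * ((- l) * s))))\<^sup>2)"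
      by (simp only: sum_indicator_mult)
    also have "\<dots> = real q * (\<Sum>s\<in>UNIV. (cmod (of_bool (s \<in> T z)))\<^sup>2)"
      by (rule plancherel) (rule orth)
    also have "(\<Sum>s\<in>UNIV. (cmod (of_bool (s \<in> T z)))\<^sup>2) = real (card (T z))"
      by (rule sum_norm_indicator)
    finally show ?thesis .
  qed
  have "real (q - 1) * (\<Sum>z\<in>UNIV. (cmod (u z))\<^sup>2) = (\<Sum>r\<in>F. \<Sum>z\<in>UNIV. (cmod (u (r *s z)))\<^sup>2)"
    by (simp add: scale F)
  also have "\<dots> = (\<Sum>z\<in>UNIV. \<Sum>r\<in>F. (cmod (u (r *s z)))\<^sup>2)" by (rule sum.swap)
  also have "\<dots> \<le> (\<Sum>z\<in>UNIV. real q * real (card (T z)))" by (rule sum_mono) (rule orbit)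
  also have "\<dots> = real (q - 1) * (real q * real (card S))"
    using pairs[of "\<lambda>_ _. real q"] F by (simp add: mult_ac)
  finally have U: "(\<Sum>z\<in>UNIV. (cmod (u z))\<^sup>2) \<le> real q * real (card S)" using q1 by simp
  have "(real q)\<^sup>2 * (\<Sum>y\<in>UNIV. (W y)\<^sup>2) = (\<Sum>y\<in>UNIV. (cmod (of_nat q * of_real (W y)))\<^sup>2)"
    by (simp add: sum_distrib_left norm_mult power_mult_distrib)
  also have "\<dots> = real CARD('a ^ 'd) * (\<Sum>z\<in>UNIV. (cmod (u z))\<^sup>2)"
    unfolding W by (rule plancherel) (rule sum_character_bilinear_orthogonal[OF \<psi> B])
  also have "\<dots> \<le> real CARD('a ^ 'd) * (real q * real (card S))" using U by (rule mult_left_mono) simp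
  also have "\<dots> = (real q)\<^sup>2 * (real q ^ (CARD('d) - 1) * real (card S))"
    by (simp only: card_vec q_def) (simp add: power2_eq_square)
  finally have "(\<Sum>y\<in>UNIV. (W y)\<^sup>2) \<le> 1 * (real q ^ (CARD('d) - 1) * real (card S))" using q1 by simp
  also have "\<dots> \<le> 16 * (real q ^ (CARD('d) - 1) * real (card S))" by (intro mult_right_mono) auto
  finally show "(\<Sum>y\<in>UNIV. (real (card {x \<in> S. B y x = l}) - real (card S) / real CARD('a))\<^sup>2)
      \<le> 16 * real CARD('a) ^ (CARD('d) - 1) * real (card S)"
    by (simp add: W_def q_def)
qed

text \<open>Completing the square leaves the Gauss sum \<open>G s\<close> of \<open>s * Q\<close>
  times \<open>\<psi>\<close> at - l s - Q(\<eta>) / s. \<open>G s\<close> depends only on the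
  square class of \<open>s\<close>, so it is a combination of 1 and the quadratic character, which
  give a Kloosterman and a Salie sum. This requires neither diagonalising \<open>Q\<close> nor
  separating odd from even dimension.\<close>

lemma norm_quadratic_form_transform_le:
  fixes Q :: "'a::{field,finite} ^ 'd \<Rightarrow> 'a" and \<psi> :: "'a \<Rightarrow> complex"
  assumes odd: "odd CARD('a)" and Q: "nondegenerate_quadratic_form Q" and \<psi>: "additive_character \<psi>"
    and l: "l \<noteq> 0"
  shows "cmod (\<Sum>z\<in>UNIV. (of_nat CARD('a) * of_bool (Q z = l) - 1) * \<psi> (polar_form Q z \<eta>))
    \<le> 4 * sqrt CARD('a) * sqrt CARD('a ^ 'd)"
proof -
  define B where "B = polar_form Q"
  have B: "nondegenerate_bilinear_form B" and scaleQ: "Q (c *s x) = c\<^sup>2 * Q x" for c x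
    using Q by (auto simp: nondegenerate_quadratic_form_def quadratic_form_def B_def)
  have lin: "bilinear_form B" using B by (simp add: nondegenerate_bilinear_form_def)
  note B_simps = bilinear_form_simps[OF lin]
  have addQ: "Q (x + y) = Q x + Q y + B x y" for x y by (simp add: B_def polar_form_def)
  have B_sym: "B x y = B y x" for x y by (simp add: B_def polar_form_def add.commute)
  have Q0: "Q 0 = 0" using scaleQ[of 0 0] by simp
  define F where "F = UNIV - {0 :: 'a}"
  define G where "G s = (\<Sum>z\<in>UNIV. \<psi> (s * Q z))" for s
  have normG: "cmod (G s) = sqrt CARD('a ^ 'd)" if "s \<noteq> 0" for s
  proof -
    have "(cmod (G s))\<^sup>2 = real CARD('a ^ 'd)"
      unfolding G_def
    proof (rule norm_gauss_sum[OF \<psi>])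
      show "s * Q (x + h) = s * Q x + s * Q h + s * B h x" for x h
        by (simp add: addQ B_sym[of x h] algebra_simps)
      fix h :: "'a ^ 'd" assume "h \<noteq> 0"
      then show "(\<Sum>x\<in>UNIV. \<psi> (s * B h x)) = 0"
        using sum_character_bilinear[OF additive_character_scale[OF \<psi> that] B, of h] B_sym by simp
    qed (simp_all add: Q0 B_simps)
    then show ?thesis by (metis norm_ge_zero real_sqrt_abs abs_of_nonneg)
  qed
  have G_scale: "G (s * t\<^sup>2) = G s" if "t \<noteq> 0" for s t
    unfolding G_def
    by (rule sum.reindex_bij_witness[of _ "\<lambda>z. (1 / t) *s z" "\<lambda>z. t *s z"])
       (use that in \<open>auto simp: scaleQ mult.assoc\<close>)
  \<comment> \<open>\<open>n\<close> represents the nonsquares. The case without nonsquares is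
    settled by \<open>n = 1\<close> instead of being ruled out.\<close>
  obtain n where n: "n \<noteq> 0" "\<And>s. s \<noteq> 0 \<Longrightarrow> G s = (if \<exists>t. s = t\<^sup>2 then G 1 else G n)"
  proof (cases "\<exists>n. \<nexists>t :: 'a. n = t\<^sup>2")
    case True
    then obtain n where ns: "\<nexists>t :: 'a. n = t\<^sup>2" by blast
    then have n0: "n \<noteq> 0" by (metis zero_power2)
    have "G s = (if \<exists>t. s = t\<^sup>2 then G 1 else G n)" if s: "s \<noteq> 0" for s
    proof (cases "\<exists>t. s = t\<^sup>2")
      case True
      then show ?thesis using G_scale[of _ 1] s by auto
    next
      case False
      then obtain t where t: "s * n = t\<^sup>2" using nonsquare_mult_nonsquare[OF odd] ns by blast
      then have "s = n * (t / n)\<^sup>2" using n0 by (simp add: power2_eq_square field_simps)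
      moreover have "t / n \<noteq> 0" using t s n0 by auto
      ultimately have "G s = G n" using G_scale by metis
      then show ?thesis using False by simp
    qed
    then show ?thesis using that n0 by blast
  next
    case False
    have "G s = (if \<exists>t. s = t\<^sup>2 then G 1 else G 1)" if s: "s \<noteq> 0" for s
    proof -
      obtain t where t: "s = t\<^sup>2" using False by blast
      then have "t \<noteq> 0" using s by auto
      then show ?thesis using G_scale[of t 1] t by simp
    qed
    with one_neq_zero show ?thesis by (rule that)
  qed
  have G_split: "G s = G 1 * ((1 + quadratic_character s) / 2) + G n * ((1 - quadratic_character s) / 2)"
    if "s \<noteq> 0" for s
    using n(2)[OF that] by (simp add: quadratic_character_def)
  define K where "K = (\<Sum>s\<in>F. \<psi> ((- l) * s + (- Q \<eta>) / s))"
  define T where "T = (\<Sum>s\<in>F. quadratic_character s * \<psi> ((- l) * s + (- Q \<eta>) / s))"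
  \<comment> \<open>If \<open>Q \<eta> = 0\<close>, the Kloosterman sum degenerates to a sum of a
    nontrivial character over nonzero elements, which is -1.\<close>
  have K: "cmod K \<le> 2 * sqrt CARD('a)"
  proof (cases "Q \<eta> = 0")
    case True
    then have "K = - 1"
      using sum_additive_character_scale[OF \<psi>, of "- l"] l
      by (simp add: K_def F_def sum_diff1 additive_character_0[OF \<psi>])
    then have "cmod K = 1" by simp
    moreover have "1 \<le> sqrt CARD('a)" by (simp add: Suc_leI)
    ultimately show ?thesis by linarith
  next
    case False
    then show ?thesis unfolding K_def F_def using l by (intro norm_kloosterman_sum_le[OF odd \<psi>]) auto
  qed
  have T: "cmod T \<le> 2 * sqrt CARD('a)"
    unfolding T_def F_def by (rule norm_salie_sum_le[OF odd \<psi>])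
  have "(\<Sum>z\<in>UNIV. (of_nat CARD('a) * of_bool (Q z = l) - 1) * \<psi> (B z \<eta>))
      = (\<Sum>z\<in>UNIV. \<Sum>s\<in>F. \<psi> (s * (Q z - l)) * \<psi> (B z \<eta>))"
    unfolding indicator_minus_mean_eq[OF \<psi>] F_def by (simp add: sum_distrib_right)
  also have "\<dots> = (\<Sum>s\<in>F. \<Sum>z\<in>UNIV. \<psi> (s * (Q z - l)) * \<psi> (B z \<eta>))" by (rule sum.swap)
  also have "\<dots> = (\<Sum>s\<in>F. \<psi> ((- l) * s + (- Q \<eta>) / s) * G s)"
  proof (rule sum.cong[OF refl])
    fix s assume "s \<in> F"
    then have s: "s \<noteq> 0" by (simp add: F_def)
    \<comment> \<open>The shift by \<eta> / s completes the square, because the cross term of the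
      polar form is then exactly \<open>B z \<eta>\<close>.\<close>
    have "s * Q (z + (1 / s) *s \<eta>) = s * Q z + Q \<eta> / s + B z \<eta>" for z
      using s by (simp add: addQ scaleQ B_simps distrib_left power2_eq_square)
    then have "s * (Q z - l) + B z \<eta> = ((- l) * s + (- Q \<eta>) / s) + s * Q (z + (1 / s) *s \<eta>)" for z
      by (simp add: algebra_simps)
    then have "\<psi> (s * (Q z - l)) * \<psi> (B z \<eta>) = \<psi> ((- l) * s + (- Q \<eta>) / s) * \<psi> (s * Q (z + (1 / s) *s \<eta>))" for z
      by (metis additive_character_add[OF \<psi>])
    moreover have "(\<Sum>z\<in>UNIV. \<psi> (s * Q (z + (1 / s) *s \<eta>))) = G s"
      unfolding G_def
      by (rule sum.reindex_bij_witness[of _ "\<lambda>z. z - (1 / s) *s \<eta>" "\<lambda>z. z + (1 / s) *s \<eta>"]) auto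
    ultimately show "(\<Sum>z\<in>UNIV. \<psi> (s * (Q z - l)) * \<psi> (B z \<eta>)) = \<psi> ((- l) * s + (- Q \<eta>) / s) * G s"
      by (simp only: sum_distrib_left[symmetric])
  qed
  also have "\<dots> = (\<Sum>s\<in>F. (G 1 / 2) * (\<psi> ((- l) * s + (- Q \<eta>) / s) + quadratic_character s * \<psi> ((- l) * s + (- Q \<eta>) / s))
      + (G n / 2) * (\<psi> ((- l) * s + (- Q \<eta>) / s) - quadratic_character s * \<psi> ((- l) * s + (- Q \<eta>) / s)))"
  proof (rule sum.cong[OF refl])
    fix s assume "s \<in> F"
    then have "s \<noteq> 0" by (simp add: F_def)
    from G_split[OF this]
    show "\<psi> ((- l) * s + (- Q \<eta>) / s) * G s =
      (G 1 / 2) * (\<psi> ((- l) * s + (- Q \<eta>) / s) + quadratic_character s * \<psi> ((- l) * s + (- Q \<eta>) / s))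
      + (G n / 2) * (\<psi> ((- l) * s + (- Q \<eta>) / s) - quadratic_character s * \<psi> ((- l) * s + (- Q \<eta>) / s))"
      by (simp only:) (simp add: field_simps)
  qed
  also have "\<dots> = (G 1 / 2) * (K + T) + (G n / 2) * (K - T)"
    by (simp only: sum.distrib sum_subtractf sum_distrib_left[symmetric] K_def T_def)
  finally have eq: "(\<Sum>z\<in>UNIV. (of_nat CARD('a) * of_bool (Q z = l) - 1) * \<psi> (B z \<eta>))
      = (G 1 / 2) * (K + T) + (G n / 2) * (K - T)" .
  have KT1: "cmod (K + T) \<le> 4 * sqrt CARD('a)" using norm_triangle_ineq[of K T] K T by linarith
  have KT2: "cmod (K - T) \<le> 4 * sqrt CARD('a)" using norm_triangle_ineq4[of K T] K T by linarith
  have "cmod ((G 1 / 2) * (K + T) + (G n / 2) * (K - T))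
      \<le> cmod ((G 1 / 2) * (K + T)) + cmod ((G n / 2) * (K - T))" by (rule norm_triangle_ineq)
  also have "\<dots> = sqrt CARD('a ^ 'd) / 2 * cmod (K + T) + sqrt CARD('a ^ 'd) / 2 * cmod (K - T)"
    using normG[of 1] normG[OF n(1)] by (simp only: norm_mult norm_divide) simp
  also have "\<dots> \<le> sqrt CARD('a ^ 'd) / 2 * (4 * sqrt CARD('a)) + sqrt CARD('a ^ 'd) / 2 * (4 * sqrt CARD('a))"
    using KT1 KT2 by (intro add_mono mult_left_mono) auto
  also have "\<dots> = 4 * sqrt CARD('a) * sqrt CARD('a ^ 'd)"
  proof -
    have "r / 2 * (4 * s) + r / 2 * (4 * s) = 4 * s * r" for r s :: real by simp
    then show ?thesis .
  qed
  finally show ?thesis using eq by (simp only: B_def)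
qed

text \<open>The deviation from the mean is a convolution of the centred sphere with the indicator of
  \<open>S\<close>, so its transform is a product whose first factor is bounded uniformly.
  Plancherel is applied once to the deviation and once to the indicator. The polar form itself
  serves as the pairing, which makes the transform match the completed square.\<close>

lemma distance_regular_quadratic:
  fixes Q :: "'a::{field,finite} ^ 'd \<Rightarrow> 'a"
  assumes odd: "odd CARD('a)" and Q: "nondegenerate_quadratic_form Q"
  shows "distance_regular (\<lambda>x y. Q (x - y))"
  unfolding distance_regular_def
proof (intro allI impI)
  fix l :: 'a and S :: "('a ^ 'd) set"
  assume l: "l \<noteq> 0"
  obtain \<psi> :: "'a \<Rightarrow> complex" where \<psi>: "additive_character \<psi>" using exists_additive_character by blast
  define B where "B = polar_form Q"
  have B: "nondegenerate_bilinear_form B"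
    using Q by (auto simp: nondegenerate_quadratic_form_def B_def)
  have lin: "bilinear_form B" using B by (simp add: nondegenerate_bilinear_form_def)
  note B_simps = bilinear_form_simps[OF lin]
  define q N where "q = CARD('a)" and "N = CARD('a ^ 'd)"
  have q0: "0 < q" by (simp add: q_def)
  have N0: "0 < N" by (simp add: N_def)
  define W where "W y = real (card {x \<in> S. Q (y - x) = l}) - real (card S) / real q" for y
  define f where "f z = of_nat q * of_bool (Q z = l) - (1 :: complex)" for z
  have W: "of_nat q * of_real (W y) = (\<Sum>x\<in>S. f (y - x))" for y
    using q0 by (simp add: f_def sum_centered_indicator W_def right_diff_distrib)
  define ft where "ft \<eta> = (\<Sum>z\<in>UNIV. f z * \<psi> (B z \<eta>))" for \<eta>
  define St where "St \<eta> = (\<Sum>x\<in>UNIV. of_bool (x \<in> S) * \<psi> (B x \<eta>))" for \<eta>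
  have ft: "(cmod (ft \<eta>))\<^sup>2 \<le> 16 * real q * real N" for \<eta>
  proof -
    have "cmod (ft \<eta>) \<le> 4 * sqrt q * sqrt N"
      using norm_quadratic_form_transform_le[OF odd Q \<psi> l, of \<eta>] by (simp add: ft_def f_def q_def N_def B_def)
    then have "(cmod (ft \<eta>))\<^sup>2 \<le> (4 * sqrt q * sqrt N)\<^sup>2" by (intro power_mono) auto
    then show ?thesis by (simp add: power_mult_distrib)
  qed
  have orth: "(\<Sum>\<eta>\<in>UNIV. \<psi> (B z \<eta>) * cnj (\<psi> (B z' \<eta>))) = (if z = z' then of_real (real N) else 0)" for z z'
    using sum_character_bilinear_orthogonal[OF \<psi> nondegenerate_bilinear_form_swap[OF B]] by (simp add: N_def)
  have conv: "(\<Sum>y\<in>UNIV. (of_nat q * of_real (W y)) * \<psi> (B y \<eta>)) = ft \<eta> * St \<eta>" for \<eta>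
  proof -
    have "(\<Sum>y\<in>UNIV. (of_nat q * of_real (W y)) * \<psi> (B y \<eta>)) = (\<Sum>y\<in>UNIV. \<Sum>x\<in>S. f (y - x) * \<psi> (B y \<eta>))"
      by (simp only: W sum_distrib_right)
    also have "\<dots> = (\<Sum>x\<in>S. \<Sum>y\<in>UNIV. f (y - x) * \<psi> (B y \<eta>))" by (rule sum.swap)
    also have "\<dots> = (\<Sum>x\<in>S. \<Sum>z\<in>UNIV. f z * \<psi> (B (x + z) \<eta>))"
    proof (rule sum.cong[OF refl])
      fix x
      show "(\<Sum>y\<in>UNIV. f (y - x) * \<psi> (B y \<eta>)) = (\<Sum>z\<in>UNIV. f z * \<psi> (B (x + z) \<eta>))"
        by (rule sum.reindex_bij_witness[of _ "\<lambda>z. x + z" "\<lambda>y. y - x"]) auto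
    qed
    also have "\<dots> = (\<Sum>x\<in>S. \<psi> (B x \<eta>) * ft \<eta>)"
      by (simp add: ft_def B_simps additive_character_add[OF \<psi>] sum_distrib_left mult_ac)
    also have "\<dots> = ft \<eta> * St \<eta>"
      unfolding St_def sum_indicator_mult by (simp add: sum_distrib_left mult.commute)
    finally show ?thesis .
  qed
  have "real N * ((real q)\<^sup>2 * (\<Sum>y\<in>UNIV. (W y)\<^sup>2)) = real N * (\<Sum>y\<in>UNIV. (cmod (of_nat q * of_real (W y)))\<^sup>2)"
    by (simp add: sum_distrib_left norm_mult power_mult_distrib)
  also have "\<dots> = (\<Sum>\<eta>\<in>UNIV. (cmod (\<Sum>y\<in>UNIV. (of_nat q * of_real (W y)) * \<psi> (B y \<eta>)))\<^sup>2)"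
    by (rule plancherel[symmetric]) (rule orth)
  also have "\<dots> = (\<Sum>\<eta>\<in>UNIV. (cmod (ft \<eta>))\<^sup>2 * (cmod (St \<eta>))\<^sup>2)"
    by (simp only: conv norm_mult power_mult_distrib)
  also have "\<dots> \<le> (\<Sum>\<eta>\<in>UNIV. (16 * real q * real N) * (cmod (St \<eta>))\<^sup>2)"
    by (intro sum_mono mult_right_mono ft) simp
  also have "\<dots> = (16 * real q * real N) * (real N * (\<Sum>x\<in>UNIV. (cmod (of_bool (x \<in> S)))\<^sup>2))"
    unfolding sum_distrib_left[symmetric] St_def
    by (rule arg_cong[where f = "\<lambda>r. _ * r"]) (rule plancherel, rule orth)
  also have "(\<Sum>x\<in>UNIV. (cmod (of_bool (x \<in> S)))\<^sup>2) = real (card S)"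
    by (rule sum_norm_indicator)
  also have "(16 * real q * real N) * (real N * real (card S))
      = real N * ((real q)\<^sup>2 * (16 * real q ^ (CARD('d) - 1) * real (card S)))"
    by (simp only: N_def card_vec q_def) (simp add: power2_eq_square)
  finally have "(\<Sum>y\<in>UNIV. (W y)\<^sup>2) \<le> 16 * real q ^ (CARD('d) - 1) * real (card S)"
    using q0 N0 by simp
  then show "(\<Sum>y\<in>UNIV. (real (card {x \<in> S. Q (y - x) = l}) - real (card S) / real CARD('a))\<^sup>2)
      \<le> 16 * real CARD('a) ^ (CARD('d) - 1) * real (card S)"
    by (simp add: W_def q_def)
qed

lemma distance_regular_distance_type:
  assumes "odd CARD('a)" "distance_type_function (\<phi> :: 'a::{field,finite} ^ 'd \<Rightarrow> 'a ^ 'd \<Rightarrow> 'a)"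
  shows "distance_regular \<phi>"
  using assms distance_regular_bilinear distance_regular_quadratic
  by (auto simp: distance_type_function_def)

section \<open>The greedy embedding\<close>

text \<open>Chebyshev's inequality.\<close>

lemma card_exceptional_le:
  fixes \<phi> :: "'a::{field,finite} ^ 'd \<Rightarrow> 'a ^ 'd \<Rightarrow> 'a"
  assumes reg: "distance_regular \<phi>" and l: "l \<noteq> 0" and \<delta>: "0 < \<delta>"
  defines "q \<equiv> real CARD('a)"
  shows "real (card {y. real (card {x \<in> S. \<phi> y x = l}) < (1 - \<delta>) * real (card S) / q})
      * (\<delta>\<^sup>2 * real (card S)) \<le> 16 * q ^ (CARD('d) + 1)"
proof (cases "card S = 0")
  case True
  then show ?thesis by (simp add: q_def)
next
  case False
  define s where "s = real (card S)"
  have s0: "0 < s" using False unfolding s_def by linarith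
  have q0: "0 < q" by (simp add: q_def)
  define D where "D = {y. real (card {x \<in> S. \<phi> y x = l}) < (1 - \<delta>) * s / q}"
  define N where "N y = real (card {x \<in> S. \<phi> y x = l})" for y
  have "real (card D) * (\<delta> * s / q)\<^sup>2 = (\<Sum>y\<in>D. (\<delta> * s / q)\<^sup>2)" by simp
  also have "\<dots> \<le> (\<Sum>y\<in>D. (N y - s / q)\<^sup>2)"
  proof (rule sum_mono)
    fix y assume "y \<in> D"
    then have "N y < (1 - \<delta>) * s / q" by (simp add: D_def N_def)
    also have "(1 - \<delta>) * s / q = s / q - \<delta> * s / q" by (simp add: left_diff_distrib diff_divide_distrib)
    finally have "\<delta> * s / q \<le> s / q - N y" by simp
    moreover have "0 \<le> \<delta> * s / q" using \<delta> s0 q0 by simp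
    ultimately have "(\<delta> * s / q)\<^sup>2 \<le> (s / q - N y)\<^sup>2" by (rule power_mono)
    then show "(\<delta> * s / q)\<^sup>2 \<le> (N y - s / q)\<^sup>2" by (simp add: power2_commute)
  qed
  also have "\<dots> \<le> (\<Sum>y\<in>UNIV. (N y - s / q)\<^sup>2)" by (rule sum_mono2) auto
  also have "\<dots> \<le> 16 * q ^ (CARD('d) - 1) * s"
    using reg l by (simp add: distance_regular_def N_def s_def q_def)
  finally have "real (card D) * (\<delta> * s / q)\<^sup>2 * q\<^sup>2 \<le> 16 * q ^ (CARD('d) - 1) * s * q\<^sup>2"
    by (rule mult_right_mono) simp
  also have "real (card D) * (\<delta> * s / q)\<^sup>2 * q\<^sup>2 = real (card D) * (\<delta>\<^sup>2 * s) * s"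
    using q0 by (simp add: power2_eq_square)
  also have "16 * q ^ (CARD('d) - 1) * s * q\<^sup>2 = 16 * (q ^ (CARD('d) - 1) * q\<^sup>2) * s" by simp
  also have "q ^ (CARD('d) - 1) * q\<^sup>2 = q ^ (CARD('d) - 1 + 2)" by (simp only: power_add)
  also have "CARD('d) - 1 + 2 = CARD('d) + 1" using zero_less_card_finite[where ?'a = 'd] by linarith
  finally show ?thesis using s0 by (simp add: D_def s_def)
qed

text \<open>
  One step of the greedy embedding: \<open>C\<close> is the candidate set of the vertex to be embedded and
  \<open>S j\<close>, for \<open>j \<in> J\<close>, are those of its neighbours that are still to be embedded.
\<close>
lemma exists_good_candidate:
  fixes \<phi> :: "'a::{field,finite} ^ 'd \<Rightarrow> 'a ^ 'd \<Rightarrow> 'a" and S :: "'j \<Rightarrow> ('a ^ 'd) set"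
  assumes reg: "distance_regular \<phi>" and l: "\<And>j. j \<in> J \<Longrightarrow> l j \<noteq> 0"
    and J: "finite J" "card J < n" and used: "finite U" "card U < n" and n: "0 < n"
    and C: "real n \<le> real (card C)"
    and big: "J \<noteq> {} \<Longrightarrow> 6 * (real n)\<^sup>2 * sqrt (real CARD('a) ^ (CARD('d) + 1)) \<le> real (card C)"
      "\<And>j. j \<in> J \<Longrightarrow> 6 * (real n)\<^sup>2 * sqrt (real CARD('a) ^ (CARD('d) + 1)) \<le> real (card (S j))"
  shows "\<exists>y\<in>C - U. \<forall>j\<in>J. (1 - 1 / (2 * real n)) * real (card (S j)) / real CARD('a)
      \<le> real (card {x \<in> S j. \<phi> y x = l j})"
proof -
  define q where "q = real CARD('a)"
  \<comment> \<open>Fewer than n steps each lose at most this fraction of a candidate set, so at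
    least half of the expected size survives.\<close>
  define \<delta> where "\<delta> = 1 / (2 * real n)"
  define D where "D j = {y. real (card {x \<in> S j. \<phi> y x = l j}) < (1 - \<delta>) * real (card (S j)) / q}" for j
  define r where "r = sqrt (q ^ (CARD('d) + 1))"
  have q1: "1 \<le> q" by (simp add: q_def Suc_leI)
  have "1 \<le> q ^ (CARD('d) + 1)" using q1 by (rule one_le_power)
  then have r1: "1 \<le> r" unfolding r_def by (rule real_sqrt_ge_one)
  have r2: "r * r = q ^ (CARD('d) + 1)" using q1 by (simp add: r_def)
  have \<delta>0: "0 < \<delta>" using n by (simp add: \<delta>_def)
  \<comment> \<open>A good candidate must avoid the points already used and the exceptional points
    of every remaining neighbour. Without such neighbours, it is enough that \<open>C\<close> has at
    least \<open>n\<close> elements.\<close>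
  have card: "card (U \<union> (\<Union>j\<in>J. D j)) < card C"
  proof (cases "J = {}")
    case True
    then show ?thesis using used(2) C by simp
  next
    case False
    have n2: "2 \<le> n" using J False by (cases "card J") auto
    \<comment> \<open>The factor \<delta>^2 turns 6 n^2 into 3/2, and 16 divided by 3/2 is below
      11.\<close>
    have D: "real (card (D j)) \<le> 11 * r" if "j \<in> J" for j
    proof -
      have "real (card (D j)) * (\<delta>\<^sup>2 * real (card (S j))) \<le> 16 * (r * r)"
        using card_exceptional_le[OF reg l[OF that] \<delta>0, of "S j"] by (simp add: D_def q_def r2)
      moreover have "\<delta>\<^sup>2 * (6 * (real n)\<^sup>2 * r) \<le> \<delta>\<^sup>2 * real (card (S j))"
        using big(2)[OF that] by (intro mult_left_mono) (simp_all add: r_def q_def)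
      moreover have "\<delta>\<^sup>2 * (6 * (real n)\<^sup>2 * r) = 3 / 2 * r"
        using n by (simp add: \<delta>_def power2_eq_square field_simps)
      ultimately have "real (card (D j)) * (3 / 2 * r) \<le> 16 * (r * r)"
        by (smt (verit) mult_left_mono of_nat_0_le_iff)
      then have "(real (card (D j)) * (3 / 2)) * r \<le> (16 * r) * r" by (simp only: mult_ac)
      then have "real (card (D j)) * (3 / 2) \<le> 16 * r"
        by (rule mult_right_le_imp_le) (use r1 in simp)
      then show ?thesis using r1 by linarith
    qed
    have "card (U \<union> (\<Union>j\<in>J. D j)) \<le> card U + card (\<Union>j\<in>J. D j)" by (rule card_Un_le)
    moreover have "card (\<Union>j\<in>J. D j) \<le> (\<Sum>j\<in>J. card (D j))" using J(1) by (rule card_UN_le)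
    ultimately have "card (U \<union> (\<Union>j\<in>J. D j)) \<le> card U + (\<Sum>j\<in>J. card (D j))" by linarith
    then have "real (card (U \<union> (\<Union>j\<in>J. D j))) \<le> real (card U) + (\<Sum>j\<in>J. real (card (D j)))"
      by (metis of_nat_add of_nat_le_iff of_nat_sum)
    also have "\<dots> \<le> real n + (\<Sum>j\<in>J. 11 * r)" using used D by (intro add_mono sum_mono) auto
    also have "\<dots> = real n + real (card J) * (11 * r)" by simp
    \<comment> \<open>With every term on the scale of \<open>r\<close>, the points to be avoided
      number at most (12 n - 11) r, which is below the assumed 6 n^2 r.\<close>
    also have "\<dots> \<le> real n * r + (real n - 1) * (11 * r)"
      using J r1 by (intro add_mono mult_right_mono) auto
    also have "\<dots> = (12 * real n - 11) * r" by (simp add: algebra_simps)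
    also have "\<dots> < (6 * (real n)\<^sup>2) * r"
    proof (rule mult_strict_right_mono)
      have "2 * real n \<le> real n * real n" using n2 by (intro mult_right_mono) auto
      then show "12 * real n - 11 < 6 * (real n)\<^sup>2" by (simp add: power2_eq_square)
    qed (use r1 in simp)
    also have "\<dots> \<le> real (card C)" using big(1)[OF False] by (simp add: r_def q_def)
    finally show ?thesis by simp
  qed
  have "finite (U \<union> (\<Union>j\<in>J. D j))" by simp
  with card have "\<not> C \<subseteq> U \<union> (\<Union>j\<in>J. D j)" using card_mono by (metis not_le)
  then obtain y where y: "y \<in> C" "y \<notin> U" "y \<notin> (\<Union>j\<in>J. D j)" by blast
  then show ?thesis by (intro bexI[of _ y]) (auto simp: D_def \<delta>_def q_def not_less)
qed

section \<open>Degrees, accumulated losses and the induction\<close>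

lemma card_edges_to_labels_le:
  assumes "distance_graph n V v E len" "max_degree V E = t" "j \<in> {1..n}" "I \<subseteq> {1..n}"
  shows "card {i \<in> I. {v i, v j} \<in> E} \<le> t"
proof -
  interpret distance_graph n V v E len by (rule assms)
  have inj: "inj_on v {1..n}" and V: "v ` {1..n} = V" using labelling by (auto simp: bij_betw_def)
  have finV: "finite V" using V by (metis finite_atLeastAtMost finite_imageI)
  have finE: "finite E" by (rule finite_subset[of _ "Pow V"]) (use edges finV in auto)
  have "inj_on (\<lambda>i. {v i, v j}) {i \<in> I. {v i, v j} \<in> E}"
  proof (rule inj_onI)
    fix i i' assume i: "i \<in> {i \<in> I. {v i, v j} \<in> E}" "i' \<in> {i \<in> I. {v i, v j} \<in> E}"
      and "{v i, v j} = {v i', v j}"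
    then have "v i = v i'" by (auto simp: doubleton_eq_iff)
    then show "i = i'" using inj_onD[OF inj] i assms(4) by blast
  qed
  then have "card {i \<in> I. {v i, v j} \<in> E} = card ((\<lambda>i. {v i, v j}) ` {i \<in> I. {v i, v j} \<in> E})"
    by (simp add: card_image)
  also have "\<dots> \<le> card {e \<in> E. v j \<in> e}" by (rule card_mono) (use finE in auto)
  also have "\<dots> = vertex_degree E (v j)" by (simp add: vertex_degree_def)
  also have "\<dots> \<le> max_degree V E"
    unfolding max_degree_def using finV V assms(3) by (intro Max_ge) auto
  finally show ?thesis using assms(2) by simp
qed

text \<open>Bernoulli's inequality. The surviving half is the reason why the hypothesis asks for 12
  where a single step asks for 6.\<close>

lemma half_le_loss_power:
  assumes "k < n \<or> k = 0"
  shows "1 / 2 \<le> (1 - 1 / (2 * real n)) ^ k"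
proof (cases "k = 0")
  case False
  then have n: "k < n" "0 < n" using assms by auto
  have "1 + real k * (- (1 / (2 * real n))) \<le> (1 + (- (1 / (2 * real n)))) ^ k"
    by (rule Bernoulli_inequality) (use n in \<open>simp add: field_simps\<close>)
  moreover have "real k / (2 * real n) \<le> 1 / 2" using n by (simp add: field_simps)
  ultimately show ?thesis by simp
qed simp

text \<open>
  Embedding the vertices in the order of their labels, every vertex \<open>v j\<close> not yet embedded keeps
  a candidate set whose density in \<open>A\<close> is at least \<open>((1 - 1/(2n)) / q)\<^sup>k\<close>, where \<open>k\<close> counts its
  embedded neighbours.
\<close>
lemma partial_embedding:
  fixes \<phi> :: "'a::{field,finite} ^ 'd \<Rightarrow> 'a ^ 'd \<Rightarrow> 'a" and len :: "'v set \<Rightarrow> 'a"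
  assumes reg: "distance_regular \<phi>" and graph: "distance_graph n V v E len"
    and t: "max_degree V E = t"
    and A: "12 * (real n)\<^sup>2 * sqrt (real CARD('a) ^ (CARD('d) - 1)) * real CARD('a) ^ t \<le> real (card A)"
    and m: "m \<le> n"
  shows "\<exists>f :: nat \<Rightarrow> 'a ^ 'd. inj_on f {1..m} \<and> f ` {1..m} \<subseteq> A \<and>
    (\<forall>i\<in>{1..m}. \<forall>j\<in>{1..m}. i < j \<and> {v i, v j} \<in> E \<longrightarrow> \<phi> (f i) (f j) = len {v i, v j}) \<and>
    (\<forall>j\<in>{m<..n}. ((1 - 1 / (2 * real n)) / real CARD('a)) ^ card {i \<in> {1..m}. {v i, v j} \<in> E} * real (card A)
      \<le> real (card {x \<in> A. \<forall>i\<in>{1..m}. {v i, v j} \<in> E \<longrightarrow> \<phi> (f i) x = len {v i, v j}}))"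
  using m
proof (induction m)
  case 0
  show ?case by (intro exI[of _ "\<lambda>_. 0"]) simp
next
  case (Suc m)
  interpret distance_graph n V v E len by (rule graph)
  define q \<rho> X where "q = real CARD('a)" and "\<rho> = (1 - 1 / (2 * real n)) / q"
    and "X = sqrt (q ^ (CARD('d) - 1))"
  have n: "0 < n" using Suc.prems by simp
  have q1: "1 \<le> q" by (simp add: q_def Suc_leI)
  have "1 \<le> q ^ (CARD('d) - 1)" using q1 by (rule one_le_power)
  then have X1: "1 \<le> X" unfolding X_def by (rule real_sqrt_ge_one)
  have \<rho>0: "0 \<le> \<rho>" using n q1 by (simp add: \<rho>_def field_simps)
  define N where "N m j = {i \<in> {1..m}. {v i, v j} \<in> E}" for m j
  define Cand where "Cand f m j = {x \<in> A. \<forall>i\<in>{1..m}. {v i, v j} \<in> E \<longrightarrow> \<phi> (f i) x = len {v i, v j}}"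
    for f m j
  obtain f where f: "inj_on f {1..m}" "f ` {1..m} \<subseteq> A"
      "\<And>i j. i \<in> {1..m} \<Longrightarrow> j \<in> {1..m} \<Longrightarrow> i < j \<Longrightarrow> {v i, v j} \<in> E \<Longrightarrow> \<phi> (f i) (f j) = len {v i, v j}"
      "\<And>j. j \<in> {m<..n} \<Longrightarrow> \<rho> ^ card (N m j) * real (card A) \<le> real (card (Cand f m j))"
    using Suc by (auto simp: N_def Cand_def \<rho>_def q_def)
  define w where "w = Suc m"
  have w: "w \<in> {1..n}" "w \<in> {m<..n}" using Suc.prems by (auto simp: w_def)
  define J where "J = {j \<in> {w<..n}. {v w, v j} \<in> E}"
  have deg: "card {i \<in> I. {v i, v j} \<in> E} \<le> t" if "j \<in> {1..n}" "I \<subseteq> {1..n}" for I j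
    by (rule card_edges_to_labels_le[OF graph t that])
  \<comment> \<open>A candidate set with \<open>k\<close> embedded neighbours still has a spare
    factor \<open>q ^ (t - k)\<close>.\<close>
  have size: "6 * (real n)\<^sup>2 * X * q ^ (t - k) \<le> \<rho> ^ k * real (card A)" if "k \<le> t" "k < n" for k
  proof -
    have "q ^ t = q ^ (t - k) * q ^ k" using that by (simp flip: power_add)
    then have "(6 * (real n)\<^sup>2 * X * q ^ (t - k)) * q ^ k = 1 / 2 * (12 * (real n)\<^sup>2 * X * q ^ t)" by simp
    also have "1 / 2 * (12 * (real n)\<^sup>2 * X * q ^ t) \<le> (1 - 1 / (2 * real n)) ^ k * real (card A)"
      using A half_le_loss_power[of k n] that q1 X1
      by (intro mult_mono) (auto simp: X_def q_def)
    finally have "(6 * (real n)\<^sup>2 * X * q ^ (t - k)) * q ^ k \<le> (1 - 1 / (2 * real n)) ^ k * real (card A)" .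
    then show ?thesis using q1 by (simp add: \<rho>_def power_divide field_simps)
  qed
  have N_less: "card (N m j) < n" for j
  proof -
    have "card (N m j) \<le> card {1..m}" unfolding N_def by (intro card_mono) auto
    then show ?thesis using Suc.prems by simp
  qed
  have sqrt_X: "sqrt (q ^ (CARD('d) + 1)) = X * q"
  proof -
    have "CARD('d) + 1 = CARD('d) - 1 + 2" using zero_less_card_finite[where ?'a = 'd] by linarith
    then have eq: "q ^ (CARD('d) + 1) = q ^ (CARD('d) - 1) * q\<^sup>2" by (metis power_add)
    show ?thesis unfolding eq X_def real_sqrt_mult using q1 by simp
  qed
  \<comment> \<open>While some neighbour is missing, \<open>k < t\<close> leaves at least one spare
    factor \<open>q\<close>; together with \<open>X\<close> it is the
    \<open>sqrt (q ^ (CARD('d) + 1))\<close> that Chebyshev's inequality asks for.\<close>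
  have big: "6 * (real n)\<^sup>2 * (X * q) \<le> \<rho> ^ k * real (card A)" if "k < t" "k < n" for k
  proof -
    have "q ^ 1 \<le> q ^ (t - k)" using that q1 by (intro power_increasing) auto
    then have "6 * (real n)\<^sup>2 * (X * q) \<le> 6 * (real n)\<^sup>2 * X * q ^ (t - k)"
      unfolding mult.assoc using X1 by (intro mult_left_mono) auto
    also have "\<dots> \<le> \<rho> ^ k * real (card A)" using that by (intro size) auto
    finally show ?thesis .
  qed
  \<comment> \<open>The new point enters \<open>\<phi>\<close> as first argument and the later
    vertices as second. This is the order of the labels, so no symmetry of \<open>\<phi>\<close> is
    involved.\<close>
  have "\<exists>y\<in>Cand f m w - f ` {1..m}. \<forall>j\<in>J. (1 - 1 / (2 * real n)) * real (card (Cand f m j)) / real CARD('a)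
      \<le> real (card {x \<in> Cand f m j. \<phi> y x = len {v w, v j}})"
  proof (rule exists_good_candidate[OF reg])
    show "finite J" by (simp add: J_def)
    have "card J \<le> card {w<..n}" unfolding J_def by (intro card_mono) auto
    then show "card J < n" using w by simp
    have "card (f ` {1..m}) \<le> m" using card_image_le[of "{1..m}" f] by simp
    then show "card (f ` {1..m}) < n" using Suc.prems by simp
    have Nw: "card (N m w) \<le> t" unfolding N_def using w Suc.prems by (intro deg) auto
    have "real n * 1 \<le> real n * real n" using n by (intro mult_left_mono) auto
    then have "real n \<le> 6 * (real n)\<^sup>2" by (simp add: power2_eq_square)
    also have "\<dots> = 6 * (real n)\<^sup>2 * (1 * 1)" by simp
    also have "\<dots> \<le> 6 * (real n)\<^sup>2 * (X * q ^ (t - card (N m w)))"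
      using X1 q1 by (intro mult_left_mono mult_mono) (auto simp: one_le_power)
    also have "\<dots> \<le> \<rho> ^ card (N m w) * real (card A)"
      using size[OF Nw N_less] by (simp only: mult.assoc)
    also have "\<dots> \<le> real (card (Cand f m w))" by (rule f(4)[OF w(2)])
    finally show "real n \<le> real (card (Cand f m w))" .
    {
      assume "J \<noteq> {}"
      then obtain j where j: "j \<in> {w<..n}" "{v w, v j} \<in> E" by (auto simp: J_def)
      \<comment> \<open>A neighbour \<open>j\<close> that comes later is counted in the degree of
        \<open>v w\<close> but not among the embedded neighbours, so their number is strictly below
        \<open>t\<close>.\<close>
      have "card (N m w) < card {i \<in> {1..n}. {v i, v w} \<in> E}"
      proof (rule psubset_card_mono)
        have "j \<in> {i \<in> {1..n}. {v i, v w} \<in> E} - N m w"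
          using j by (auto simp: N_def w_def insert_commute)
        moreover have "N m w \<subseteq> {i \<in> {1..n}. {v i, v w} \<in> E}" using Suc.prems by (auto simp: N_def)
        ultimately show "N m w \<subset> {i \<in> {1..n}. {v i, v w} \<in> E}" by blast
      qed simp
      also have "\<dots> \<le> t" using w by (intro deg) auto
      finally have "6 * (real n)\<^sup>2 * (X * q) \<le> \<rho> ^ card (N m w) * real (card A)"
        using N_less by (intro big) auto
      also have "\<dots> \<le> real (card (Cand f m w))" by (rule f(4)[OF w(2)])
      finally show "6 * (real n)\<^sup>2 * sqrt (real CARD('a) ^ (CARD('d) + 1)) \<le> real (card (Cand f m w))"
        using sqrt_X by (simp only: q_def)
    }
    fix j assume "j \<in> J"
    then have j: "j \<in> {w<..n}" "{v w, v j} \<in> E" by (auto simp: J_def)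
    show "len {v w, v j} \<noteq> 0" using j(2) by (rule length_nonzero)
    \<comment> \<open>Here \<open>w\<close> itself is the neighbour of \<open>j\<close> that has not
      been embedded before this step.\<close>
    have "card (N m j) < card (N w j)"
    proof (rule psubset_card_mono)
      have "w \<in> N w j - N m j" using j by (auto simp: N_def w_def)
      moreover have "N m j \<subseteq> N w j" by (auto simp: N_def w_def)
      ultimately show "N m j \<subset> N w j" by blast
    qed (simp add: N_def)
    also have "card (N w j) \<le> t" unfolding N_def using w j by (intro deg) auto
    finally have "6 * (real n)\<^sup>2 * (X * q) \<le> \<rho> ^ card (N m j) * real (card A)"
      using N_less by (intro big) auto
    also have "\<dots> \<le> real (card (Cand f m j))" using j by (intro f(4)) (auto simp: w_def)
    finally show "6 * (real n)\<^sup>2 * sqrt (real CARD('a) ^ (CARD('d) + 1)) \<le> real (card (Cand f m j))"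
      using sqrt_X by (simp only: q_def)
  qed (use n in simp_all)
  then obtain y where y: "y \<in> Cand f m w" "y \<notin> f ` {1..m}"
    "\<And>j. j \<in> J \<Longrightarrow> \<rho> * real (card (Cand f m j)) \<le> real (card {x \<in> Cand f m j. \<phi> y x = len {v w, v j}})"
    by (auto simp: \<rho>_def q_def)
  define g where "g = f(w := y)"
  have g: "g i = f i" if "i \<in> {1..m}" for i using that by (auto simp: g_def w_def)
  have gw: "g w = y" by (simp add: g_def)
  have ins: "{1..Suc m} = insert w {1..m}" by (auto simp: w_def)
  have img: "g ` {1..m} = f ` {1..m}" using refl g by (rule image_cong)
  have "inj_on g {1..m} \<longleftrightarrow> inj_on f {1..m}" using g by (rule inj_on_cong)
  moreover have "{1..m} - {w} = {1..m}" by (auto simp: w_def)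
  ultimately have inj: "inj_on g {1..Suc m}"
    unfolding ins using f(1) y(2) by (simp only: inj_on_insert gw img not_False_eq_True simp_thms)
  have yA: "y \<in> A" using y(1) by (simp add: Cand_def)
  have sub: "g ` {1..Suc m} \<subseteq> A" unfolding ins using f(2) yA by (simp only: image_insert gw img insert_subset simp_thms)
  have iso: "\<phi> (g i) (g j) = len {v i, v j}"
    if ij: "i \<in> {1..Suc m}" "j \<in> {1..Suc m}" "i < j" "{v i, v j} \<in> E" for i j
  proof (cases "j = w")
    case True
    then have "i \<in> {1..m}" using ij by (auto simp: w_def)
    then show ?thesis using y(1) ij True by (simp add: g gw Cand_def)
  next
    case False
    then have "i \<in> {1..m}" "j \<in> {1..m}" using ij by (auto simp: w_def)
    then show ?thesis using ij f(3) by (simp add: g)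
  qed
  have cand: "\<rho> ^ card (N (Suc m) j) * real (card A) \<le> real (card (Cand g (Suc m) j))" if j: "j \<in> {Suc m<..n}" for j
  proof -
    have IH: "\<rho> ^ card (N m j) * real (card A) \<le> real (card (Cand f m j))" using j by (intro f(4)) auto
    have Cand: "Cand g (Suc m) j = {x \<in> Cand f m j. {v w, v j} \<in> E \<longrightarrow> \<phi> y x = len {v w, v j}}"
      unfolding Cand_def ins by (auto simp: g gw)
    show ?thesis
    proof (cases "{v w, v j} \<in> E")
      case True
      have "N (Suc m) j = insert w (N m j)" "w \<notin> N m j" using True by (auto simp: N_def ins w_def)
      then have "\<rho> ^ card (N (Suc m) j) * real (card A) = \<rho> * (\<rho> ^ card (N m j) * real (card A))"
        by (simp add: N_def)
      also have "\<dots> \<le> \<rho> * real (card (Cand f m j))" using IH \<rho>0 by (rule mult_left_mono)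
      also have "\<dots> \<le> real (card {x \<in> Cand f m j. \<phi> y x = len {v w, v j}})"
        using j True by (intro y(3)) (auto simp: J_def w_def)
      finally show ?thesis using True by (simp add: Cand)
    next
      case False
      then have "N (Suc m) j = N m j" unfolding N_def ins by auto
      then show ?thesis using IH False by (simp add: Cand)
    qed
  qed
  show ?case
    using inj sub iso cand by (intro exI[of _ g]) (auto simp: N_def Cand_def \<rho>_def q_def)
qed

theorem theorem1p2:
  fixes \<phi> :: "'a::{field,finite} ^ 'd \<Rightarrow> 'a ^ 'd \<Rightarrow> 'a"
    and n t :: nat
    and A :: "('a ^ 'd) set"
    and V :: "'v set" and v :: "nat \<Rightarrow> 'v"
    and E :: "'v set set" and len :: "'v set \<Rightarrow> 'a"
  assumes "odd CARD('a)"
    and "CARD('d) \<ge> 2"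
    and "distance_type_function \<phi>"
    and "real (card A) \<ge>
           12 * (real n)\<^sup>2 * real CARD('a) powr ((real CARD('d) - 1) / 2 + real t)"
    and "distance_graph n V v E len"
    and "max_degree V E = t"
  shows "\<exists>X. X \<subseteq> A \<and> isometric_copy \<phi> n V v E len X"
proof -
  define q where "q = real CARD('a)"
  have q0: "0 < q" by (simp add: q_def)
  \<comment> \<open>The embedding is run with a square root and natural exponents; the real exponent
    is split accordingly.\<close>
  have "q powr ((real CARD('d) - 1) / 2 + real t) = q powr (real (CARD('d) - 1) / 2) * q powr real t"
    using assms(2) by (simp add: powr_add of_nat_diff)
  also have "q powr (real (CARD('d) - 1) / 2) = sqrt (q ^ (CARD('d) - 1))"
    using q0 by (simp add: powr_half_sqrt[symmetric] powr_realpow[symmetric] powr_powr)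
  also have "q powr real t = q ^ t" using q0 by (rule powr_realpow)
  finally have "12 * (real n)\<^sup>2 * sqrt (q ^ (CARD('d) - 1)) * q ^ t \<le> real (card A)"
    using assms(4) by (simp add: q_def)
  from partial_embedding[OF distance_regular_distance_type[OF assms(1,3)] assms(5,6) this[unfolded q_def] order.refl]
  obtain f :: "nat \<Rightarrow> 'a ^ 'd" where f: "inj_on f {1..n}" "f ` {1..n} \<subseteq> A"
    "\<And>i j. i \<in> {1..n} \<Longrightarrow> j \<in> {1..n} \<Longrightarrow> i < j \<Longrightarrow> {v i, v j} \<in> E \<Longrightarrow> \<phi> (f i) (f j) = len {v i, v j}"
    by blast
  have v: "bij_betw v {1..n} V" using assms(5) by (rule distance_graph.labelling)
  define \<iota> where "\<iota> = f \<circ> inv_into {1..n} v"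
  have \<iota>: "\<iota> (v i) = f i" if "i \<in> {1..n}" for i
    using that v by (simp add: \<iota>_def bij_betw_inv_into_left)
  have "bij_betw \<iota> V (f ` {1..n})"
    unfolding \<iota>_def using bij_betw_inv_into[OF v] f(1) by (rule bij_betw_trans[OF _ inj_on_imp_bij_betw])
  then have "isometric_copy \<phi> n V v E len (f ` {1..n})"
    unfolding isometric_copy_def using f(3) by (intro exI[of _ \<iota>]) (auto simp: \<iota>)
  then show ?thesis using f(2) by blast
qed

end
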